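(* Assume (C1)–(C4). Then the approximation error of the population B-spline discriminant direction satisfies $$\|\tilde\theta-\theta^*\|_{L_2}\lesssim \sqrt p\,L_n^{-d}.$$
   Context: Model: $U\in[0,1]$ is an exposure variable, $Y\in\{0,1\}$ a label independent of $U$ with $\mathbb P(Y=1)=\mathbb P(Y=0)=1/2$, and $X\in\mathbb R^p$ satisfies, conditionally on $U=u$, $X\sim\mathcal N(\mu_1(u),\Sigma(u))$ if $Y=1$ and $X\sim\mathcal N(\mu_2(u),\Sigma(u))$ if $Y=0$. Write $\delta(u)=\mu_1(u)-\mu_2(u)$, $\mu(u)=(\mu_1(u)+\mu_2(u))/2$, $\beta^*(u)=\Sigma(u)^{-1}\delta(u)$. Let $Z=\mathbb 1(Y=1)-1/2$ and let $\theta^*(u)$ be the minimizer over $\theta\in\mathbb R^p$ of $\mathbb E[(Z-\theta^\top(X-\mu(U)))^2\mid U=u]$. B-splines: $B^*(u)=(B^*_1(u),\dots,B^*_{L_n}(u))^\top$ is a normalized B-spline basis of fixed order on $[0,1]$ with quasi-uniform knots ($B_k^*\ge0$, $\sum_kB_k^*=1$) and $B(u)=\sqrt{L_n}B^*(u)$. For $v\in\mathbb R^{pL_n}$, $v_{(j)}\in\mathbb R^{L_n}$ denotes its $j$-th consecutive block. Population quantities: $\tilde B(U)=(X-\mu(U))\otimes B(U)$, $D=\mathbb E[\tilde B\tilde B^\top]$, $b=\mathbb E[\tilde BZ]$, $\tilde\gamma=D^{-1}b$, $\tilde\theta(u)=(\tilde\gamma_{(1)}^\top B(u),\dots,\tilde\gamma_{(p)}^\top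 B(u))^\top$. For $\nu,\xi:[0,1]\to\mathbb R^m$, $\|\nu-\xi\|_{L_2}=(\int_0^1\|\nu(u)-\xi(u)\|_2^2du)^{1/2}$. Asymptotics: $n\to\infty$, $p=p_n$, $L_n\to\infty$; $\lesssim$ hides constants independent of $n,p,L_n$. Conditions: (C1) there are constants $0<\lambda_0\le\lambda_1<\infty$ with $\lambda_0\le\lambda_{\min}(\Sigma(u))\le\lambda_{\max}(\Sigma(u))\le\lambda_1$ for all $u$. (C2) $U$ has a density $h$ with $0<D_1\le h(u)\le D_2<\infty$ on $[0,1]$. (C3) every coordinate of $\mu_1,\mu_2,\beta^*$ lies in $\mathcal W^d([0,1])=\{f:\sup_x|f^{(\ell)}(x)|\le D,\ \ell=0,\dots,t;\ |f^{(t)}(x)-f^{(t)}(x')|\le L|x-x'|^r\}$ with $d=r+t\ge1$ and fixed constants $D,L$. (C4) $\sup_u\max\{\|\delta(u)\|_2,\|\theta^*(u)\|_2\}=\delta_p\le M$ for a constant $M$, and $p=o(n^{(2d-1)/(2d+1)})$.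
   Formalization: The order of the B-spline basis is assumed to be at least d (with 0 < r ≤ 1), which the statement leaves open; for a smaller fixed order, e.g. piecewise constants with d = 2, the rate L_n^{-d} fails. *)

theory Defs
  imports "HOL-Probability.Probability" "HOL-Library.Landau_Symbols"
begin

text \<open>Vectors in R^p are functions nat => real of which only the indices below p matter;
  p x p matrices are functions nat => nat => real of which only indices below p matter.\<close>

definition vnorm :: "nat \<Rightarrow> (nat \<Rightarrow> real) \<Rightarrow> real" where
  "vnorm p v = sqrt (\<Sum>j<p. (v j)^2)"

definition mdet :: "nat \<Rightarrow> (nat \<Rightarrow> nat \<Rightarrow> real) \<Rightarrow> real" where
  "mdet p A = (\<Sum>\<sigma> | \<sigma> permutes {..<p}. of_int (sign \<sigma>) * (\<Prod>i<p. A i (\<sigma> i)))"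

definition mat_inv :: "nat \<Rightarrow> (nat \<Rightarrow> nat \<Rightarrow> real) \<Rightarrow> nat \<Rightarrow> nat \<Rightarrow> real" where
  "mat_inv p A = (SOME B. \<forall>i<p. \<forall>j<p. (\<Sum>k<p. A i k * B k j) = (if i = j then 1 else 0))"

definition is_eigenvalue :: "nat \<Rightarrow> (nat \<Rightarrow> nat \<Rightarrow> real) \<Rightarrow> real \<Rightarrow> bool" where
  "is_eigenvalue p A k \<longleftrightarrow>
     (\<exists>v. (\<exists>i<p. v i \<noteq> 0) \<and> (\<forall>i<p. (\<Sum>j<p. A i j * v j) = k * v i))"

definition lam_min :: "nat \<Rightarrow> (nat \<Rightarrow> nat \<Rightarrow> real) \<Rightarrow> real" where
  "lam_min p A = Min {k. is_eigenvalue p A k}"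

definition lam_max :: "nat \<Rightarrow> (nat \<Rightarrow> nat \<Rightarrow> real) \<Rightarrow> real" where
  "lam_max p A = Max {k. is_eigenvalue p A k}"

section \<open>Hoelder-type smoothness class W^d([0,1]), d = r + t\<close>

definition holder_class :: "nat \<Rightarrow> real \<Rightarrow> real \<Rightarrow> real \<Rightarrow> (real \<Rightarrow> real) \<Rightarrow> bool" where
  "holder_class t r Dc Lc f \<longleftrightarrow>
     (\<exists>g :: nat \<Rightarrow> real \<Rightarrow> real.
        (\<forall>x\<in>{0..1}. g 0 x = f x) \<and>
        (\<forall>l<t. \<forall>x\<in>{0..1}. (g l has_real_derivative g (Suc l) x) (at x within {0..1})) \<and>
        (\<forall>l\<le>t. \<forall>x\<in>{0..1}. \<bar>g l x\<bar> \<le> Dc) \<and>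
        (\<forall>x\<in>{0..1}. \<forall>x'\<in>{0..1}. \<bar>g t x - g t x'\<bar> \<le> Lc * \<bar>x - x'\<bar> powr r))"

text \<open>Interior knots xi 1 < ... < xi K; extended with xi_0 = 0, xi_(K+1) = 1.\<close>
definition ext_knot :: "nat \<Rightarrow> (nat \<Rightarrow> real) \<Rightarrow> nat \<Rightarrow> real" where
  "ext_knot K xi i = (if i = 0 then 0 else if i \<le> K then xi i else 1)"

definition knotvec :: "nat \<Rightarrow> nat \<Rightarrow> (nat \<Rightarrow> real) \<Rightarrow> nat \<Rightarrow> real" where
  "knotvec m K xi i = (if i < m then 0 else if i < m + K then xi (i - m + 1) else 1)"

text \<open>bspl tk k i x: i-th normalised B-spline of order k for knot vector tk (0/0 = 0 convention;
  the right end point 1 is included in the last nondegenerate interval).\<close>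
fun bspl :: "(nat \<Rightarrow> real) \<Rightarrow> nat \<Rightarrow> nat \<Rightarrow> real \<Rightarrow> real" where
  "bspl tk 0 i x = 0"
| "bspl tk (Suc 0) i x =
     (if (tk i \<le> x \<and> x < tk (Suc i)) \<or> (x = 1 \<and> tk i < 1 \<and> tk (Suc i) = 1) then 1 else 0)"
| "bspl tk (Suc (Suc k)) i x =
     (x - tk i) / (tk (i + k + 1) - tk i) * bspl tk (Suc k) i x
     + (tk (i + k + 2) - x) / (tk (i + k + 2) - tk (Suc i)) * bspl tk (Suc k) (Suc i) x"

text \<open>Scaled basis B(u) = sqrt(L) B*(u), with L = K + m basis functions (indices 0..L-1).\<close>
definition Bsc :: "nat \<Rightarrow> nat \<Rightarrow> (nat \<Rightarrow> real) \<Rightarrow> nat \<Rightarrow> real \<Rightarrow> real" where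
  "Bsc m K xi k u = sqrt (real (K + m)) * bspl (knotvec m K xi) m k u"

definition gauss_dens :: "nat \<Rightarrow> (nat \<Rightarrow> real) \<Rightarrow> (nat \<Rightarrow> nat \<Rightarrow> real) \<Rightarrow> (nat \<Rightarrow> real) \<Rightarrow> real" where
  "gauss_dens p mm S x = (2 * pi) powr (- real p / 2) * mdet p S powr (-1/2) *
     exp (- (1/2) * (\<Sum>i<p. \<Sum>j<p. (x i - mm i) * mat_inv p S i j * (x j - mm j)))"

definition gaussian :: "nat \<Rightarrow> (nat \<Rightarrow> real) \<Rightarrow> (nat \<Rightarrow> nat \<Rightarrow> real) \<Rightarrow> (nat \<Rightarrow> real) measure" where
  "gaussian p mm S = density (PiM {..<p} (\<lambda>_. lborel)) (\<lambda>x. ennreal (gauss_dens p mm S x))"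

definition Zval :: "bool \<Rightarrow> real" where
  "Zval y = (if y then 1 else 0) - 1/2"

definition mid :: "(real \<Rightarrow> nat \<Rightarrow> real) \<Rightarrow> (real \<Rightarrow> nat \<Rightarrow> real) \<Rightarrow> real \<Rightarrow> nat \<Rightarrow> real" where
  "mid mu1 mu2 u j = (mu1 u j + mu2 u j) / 2"

text \<open>Conditional expectation of g(Y,X) given U = u: Y fair coin (True means Y = 1),
  X | U=u,Y=1 ~ N(mu1 u, Sig u), X | U=u,Y=0 ~ N(mu2 u, Sig u).\<close>
definition condE :: "nat \<Rightarrow> (real \<Rightarrow> nat \<Rightarrow> real) \<Rightarrow> (real \<Rightarrow> nat \<Rightarrow> real)
    \<Rightarrow> (real \<Rightarrow> nat \<Rightarrow> nat \<Rightarrow> real) \<Rightarrow> real \<Rightarrow> (bool \<Rightarrow> (nat \<Rightarrow> real) \<Rightarrow> real) \<Rightarrow> real" where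
  "condE p mu1 mu2 Sig u g =
     (1/2) * integral\<^sup>L (gaussian p (mu1 u) (Sig u)) (g True)
   + (1/2) * integral\<^sup>L (gaussian p (mu2 u) (Sig u)) (g False)"

definition popE :: "nat \<Rightarrow> (real \<Rightarrow> real) \<Rightarrow> (real \<Rightarrow> nat \<Rightarrow> real) \<Rightarrow> (real \<Rightarrow> nat \<Rightarrow> real)
    \<Rightarrow> (real \<Rightarrow> nat \<Rightarrow> nat \<Rightarrow> real) \<Rightarrow> (real \<Rightarrow> bool \<Rightarrow> (nat \<Rightarrow> real) \<Rightarrow> real) \<Rightarrow> real" where
  "popE p h mu1 mu2 Sig f = (LINT u:{0..1}|lborel. h u * condE p mu1 mu2 Sig u (f u))"

definition beta_star :: "nat \<Rightarrow> (real \<Rightarrow> nat \<Rightarrow> real) \<Rightarrow> (real \<Rightarrow> nat \<Rightarrow> real)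
    \<Rightarrow> (real \<Rightarrow> nat \<Rightarrow> nat \<Rightarrow> real) \<Rightarrow> real \<Rightarrow> nat \<Rightarrow> real" where
  "beta_star p mu1 mu2 Sig u j = (\<Sum>k<p. mat_inv p (Sig u) j k * (mu1 u k - mu2 u k))"

definition lsq_risk :: "nat \<Rightarrow> (real \<Rightarrow> nat \<Rightarrow> real) \<Rightarrow> (real \<Rightarrow> nat \<Rightarrow> real)
    \<Rightarrow> (real \<Rightarrow> nat \<Rightarrow> nat \<Rightarrow> real) \<Rightarrow> real \<Rightarrow> (nat \<Rightarrow> real) \<Rightarrow> real" where
  "lsq_risk p mu1 mu2 Sig u \<theta> =
     condE p mu1 mu2 Sig u (\<lambda>y x. (Zval y - (\<Sum>j<p. \<theta> j * (x j - mid mu1 mu2 u j)))^2)"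

text \<open>Coordinate i = j * L + k (j < p, k < L) of Btilde(U) = (X - mu(U)) (x) B(U).\<close>
definition Btil :: "nat \<Rightarrow> nat \<Rightarrow> (nat \<Rightarrow> real) \<Rightarrow> (real \<Rightarrow> nat \<Rightarrow> real) \<Rightarrow> (real \<Rightarrow> nat \<Rightarrow> real)
    \<Rightarrow> nat \<Rightarrow> real \<Rightarrow> (nat \<Rightarrow> real) \<Rightarrow> real" where
  "Btil m K xi mu1 mu2 i u x =
     (x (i div (K + m)) - mid mu1 mu2 u (i div (K + m))) * Bsc m K xi (i mod (K + m)) u"

definition Dmat :: "nat \<Rightarrow> nat \<Rightarrow> nat \<Rightarrow> (nat \<Rightarrow> real) \<Rightarrow> (real \<Rightarrow> real) \<Rightarrow> (real \<Rightarrow> nat \<Rightarrow> real)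
    \<Rightarrow> (real \<Rightarrow> nat \<Rightarrow> real) \<Rightarrow> (real \<Rightarrow> nat \<Rightarrow> nat \<Rightarrow> real) \<Rightarrow> nat \<Rightarrow> nat \<Rightarrow> real" where
  "Dmat p m K xi h mu1 mu2 Sig i i' =
     popE p h mu1 mu2 Sig (\<lambda>u y x. Btil m K xi mu1 mu2 i u x * Btil m K xi mu1 mu2 i' u x)"

definition bvec :: "nat \<Rightarrow> nat \<Rightarrow> nat \<Rightarrow> (nat \<Rightarrow> real) \<Rightarrow> (real \<Rightarrow> real) \<Rightarrow> (real \<Rightarrow> nat \<Rightarrow> real)
    \<Rightarrow> (real \<Rightarrow> nat \<Rightarrow> real) \<Rightarrow> (real \<Rightarrow> nat \<Rightarrow> nat \<Rightarrow> real) \<Rightarrow> nat \<Rightarrow> real" where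
  "bvec p m K xi h mu1 mu2 Sig i =
     popE p h mu1 mu2 Sig (\<lambda>u y x. Btil m K xi mu1 mu2 i u x * Zval y)"

definition gamma_til :: "nat \<Rightarrow> nat \<Rightarrow> nat \<Rightarrow> (nat \<Rightarrow> real) \<Rightarrow> (real \<Rightarrow> real) \<Rightarrow> (real \<Rightarrow> nat \<Rightarrow> real)
    \<Rightarrow> (real \<Rightarrow> nat \<Rightarrow> real) \<Rightarrow> (real \<Rightarrow> nat \<Rightarrow> nat \<Rightarrow> real) \<Rightarrow> nat \<Rightarrow> real" where
  "gamma_til p m K xi h mu1 mu2 Sig i =
     (\<Sum>i'<p * (K + m). mat_inv (p * (K + m)) (Dmat p m K xi h mu1 mu2 Sig) i i'
                          * bvec p m K xi h mu1 mu2 Sig i')"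

definition theta_til :: "nat \<Rightarrow> nat \<Rightarrow> nat \<Rightarrow> (nat \<Rightarrow> real) \<Rightarrow> (real \<Rightarrow> real) \<Rightarrow> (real \<Rightarrow> nat \<Rightarrow> real)
    \<Rightarrow> (real \<Rightarrow> nat \<Rightarrow> real) \<Rightarrow> (real \<Rightarrow> nat \<Rightarrow> nat \<Rightarrow> real) \<Rightarrow> real \<Rightarrow> nat \<Rightarrow> real" where
  "theta_til p m K xi h mu1 mu2 Sig u j =
     (\<Sum>k<K + m. gamma_til p m K xi h mu1 mu2 Sig (j * (K + m) + k) * Bsc m K xi k u)"

definition L2dist :: "nat \<Rightarrow> (real \<Rightarrow> nat \<Rightarrow> real) \<Rightarrow> (real \<Rightarrow> nat \<Rightarrow> real) \<Rightarrow> real" where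
  "L2dist p f g = sqrt (LINT u:{0..1}|lborel. (\<Sum>j<p. (f u j - g u j)^2))"

end

theory Submission
  imports Defs "Jordan_Normal_Form.Determinant" "Jordan_Normal_Form.Char_Poly"
begin

text \<open>
  The conditional second moment of \<open>X - mu(u)\<close> is \<open>A = Sig + delta delta^T / 4\<close> and
  \<open>E((X - mu(u)) Z | U = u)\<close> is \<open>delta / 4\<close>, so the minimiser is \<open>theta* = beta* / (4 + s)\<close> with \<open>s = delta . beta* \<ge> 0\<close>, and
  the normal equations say that the spline estimator is the orthogonal projection of \<open>theta*\<close> onto the
  spline space in the inner product weighted by \<open>h A\<close>. This weight is bounded above and below, hence it
  suffices to approximate \<open>theta*\<close> by some spline with error \<open>sqrt p L^(-d)\<close>.

  The derivatives of \<open>s\<close> are sums of \<open>p\<close> products and might be of order \<open>p\<close>. At the scale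
  \<open>H = p^(-1/(2d))\<close>, however, the vectors \<open>delta\<close> and \<open>beta*\<close> have Taylor polynomials whose rescaled
  coefficients are bounded in Euclidean norm independently of \<open>p\<close>, because the functions themselves are
  bounded and the Taylor remainder \<open>sqrt p H^d\<close> is \<open>O(1)\<close>. This property is inherited by products and by
  \<open>1 / (4 + s)\<close>, so \<open>theta*\<close> has local Taylor polynomials with error \<open>sqrt p |x - x0|^d\<close> for
  \<open>|x - x0| \<le> H\<close>. If the mesh is finer than \<open>H\<close>, a quasi-interpolant built from these polynomials and
  Marsden's identity gives the rate; otherwise \<open>sqrt p L^(-d)\<close> is bounded below and the zero spline does.
\<close>

section \<open>Symmetric matrices\<close>

definition quad :: "nat \<Rightarrow> (nat \<Rightarrow> nat \<Rightarrow> real) \<Rightarrow> (nat \<Rightarrow> real) \<Rightarrow> real" where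
  "quad n A v = (\<Sum>i<n. \<Sum>j<n. v i * A i j * v j)"

abbreviation sqn :: "nat \<Rightarrow> (nat \<Rightarrow> real) \<Rightarrow> real" where
  "sqn p v \<equiv> \<Sum>i<p. (v i)^2"

definition fmat :: "nat \<Rightarrow> (nat \<Rightarrow> nat \<Rightarrow> real) \<Rightarrow> real mat" where
  "fmat n A = mat n n (\<lambda>(i, j). A i j)"

lemma fmat_carrier [simp]: "fmat n A \<in> carrier_mat n n"
  by (simp add: fmat_def)

lemma mdet_eq_det: "mdet n A = det (fmat n A)"
proof -
  have "det (fmat n A) = (\<Sum> p \<in> {p. p permutes {0 ..< n}}. signof p * (\<Prod> i = 0 ..< n. fmat n A $$ (i, p i)))"
    by (rule det_def') simp
  also have "... = (\<Sum>p | p permutes {..<n}. of_int (sign p) * (\<Prod>i<n. A i (p i)))"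
  proof (rule sum.cong)
    fix p assume "p \<in> {p. p permutes {..<n}}"
    hence "p i < n" if "i < n" for i using that permutes_in_image[of p "{..<n}" i] by auto
    hence "(\<Prod>i = 0..<n. fmat n A $$ (i, p i)) = (\<Prod>i<n. A i (p i))"
      by (intro prod.cong) (auto simp: fmat_def lessThan_atLeast0)
    then show "signof p * (\<Prod>i = 0..<n. fmat n A $$ (i, p i)) = of_int (sign p) * (\<Prod>i<n. A i (p i))"
      by simp
  qed (simp add: lessThan_atLeast0)
  finally show ?thesis by (simp add: mdet_def)
qed

lemma right_inverse_exists:
  fixes n :: nat
  assumes "\<And>v. (\<forall>i<n. (\<Sum>j<n. A i j * v j) = 0) \<Longrightarrow> \<forall>i<n. v i = 0"
  shows "\<exists>B. \<forall>i<n. \<forall>j<n. (\<Sum>k<n. A i k * B k j) = (if i = j then 1 else (0::real))"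
proof -
  have "det (fmat n A) \<noteq> 0"
  proof
    assume "det (fmat n A) = 0"
    then obtain v where v: "v \<in> carrier_vec n" "v \<noteq> 0\<^sub>v n" "fmat n A *\<^sub>v v = 0\<^sub>v n"
      using det_0_iff_vec_prod_zero[OF fmat_carrier] by blast
    have "(\<Sum>j<n. A i j * v $ j) = 0" if "i < n" for i
    proof -
      have "(fmat n A *\<^sub>v v) $ i = (\<Sum>j<n. A i j * v $ j)"
        using v(1) that by (auto simp: fmat_def scalar_prod_def lessThan_atLeast0 intro!: sum.cong)
      thus ?thesis using v(3) that by simp
    qed
    hence "\<forall>i<n. v $ i = 0" using assms[of "\<lambda>j. v $ j"] by auto
    hence "v = 0\<^sub>v n" using v(1) by (intro eq_vecI) auto
    thus False using v(2) by simp
  qed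
  hence "fmat n A \<in> Units (ring_mat TYPE(real) n ())" by (intro det_non_zero_imp_unit) auto
  then obtain B where B: "B \<in> carrier_mat n n" "fmat n A * B = 1\<^sub>m n"
    unfolding Units_def by (auto simp: ring_mat_def)
  have "(\<Sum>k<n. A i k * B $$ (k, j)) = (if i = j then 1 else 0)" if "i < n" "j < n" for i j
  proof -
    have "(fmat n A * B) $$ (i, j) = (\<Sum>k<n. A i k * B $$ (k, j))"
      using B(1) that by (auto simp: fmat_def scalar_prod_def lessThan_atLeast0 intro!: sum.cong)
    thus ?thesis using B(2) that by simp
  qed
  thus ?thesis by (intro exI[of _ "\<lambda>k j. B $$ (k, j)"]) auto
qed

lemma mat_inv_solve:
  fixes n :: nat
  assumes inj: "\<And>v. (\<forall>i<n. (\<Sum>j<n. A i j * v j) = 0) \<Longrightarrow> \<forall>i<n. v i = 0" and "i < n"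
  shows "(\<Sum>j<n. A i j * (\<Sum>k<n. mat_inv n A j k * b k)) = b i"
proof -
  have inv: "\<forall>i<n. \<forall>j<n. (\<Sum>k<n. A i k * mat_inv n A k j) = (if i = j then 1 else 0)"
    using someI_ex[OF right_inverse_exists[OF inj]] unfolding mat_inv_def by simp
  have "(\<Sum>j<n. A i j * (\<Sum>k<n. mat_inv n A j k * b k))
      = (\<Sum>k<n. (\<Sum>j<n. A i j * mat_inv n A j k) * b k)"
    unfolding sum_distrib_left sum_distrib_right by (subst sum.swap) (simp add: mult_ac)
  also have "... = (\<Sum>k<n. (if i = k then 1 else 0) * b k)"
    using inv \<open>i < n\<close> by (intro sum.cong) auto
  finally show ?thesis using \<open>i < n\<close> by (simp add: if_distrib[of "\<lambda>x. x * _"] cong: if_cong)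
qed

lemma quad_add:
  assumes sym: "\<forall>i<n. \<forall>j<n. A i j = A j i"
  shows "quad n A (\<lambda>i. v i + s * w i)
    = quad n A v + 2 * s * (\<Sum>i<n. w i * (\<Sum>j<n. A i j * v j)) + s^2 * quad n A w"
proof -
  have 1: "(\<Sum>i<n. \<Sum>j<n. v i * A i j * w j) = (\<Sum>i<n. w i * (\<Sum>j<n. A i j * v j))"
    unfolding sum_distrib_left by (subst sum.swap) (auto intro!: sum.cong simp: sym)
  have "quad n A (\<lambda>i. v i + s * w i) = quad n A v + s * (\<Sum>i<n. \<Sum>j<n. v i * A i j * w j)
      + s * (\<Sum>i<n. w i * (\<Sum>j<n. A i j * v j)) + s^2 * quad n A w"
    unfolding quad_def sum_distrib_left sum.distrib[symmetric]
    by (intro sum.cong refl) (simp add: algebra_simps power2_eq_square)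
  thus ?thesis unfolding 1 by (simp add: algebra_simps)
qed

lemma quad_scale: "quad n A (\<lambda>i. s * v i) = s^2 * quad n A v"
  unfolding quad_def sum_distrib_left by (intro sum.cong refl) (simp add: algebra_simps power2_eq_square)

lemma linear_coeff_zero_if_nonneg:
  fixes c e :: real
  assumes "\<And>s. 0 \<le> 2 * s * c + s^2 * e"
  shows "c = 0"
proof (rule ccontr)
  assume c: "c \<noteq> 0"
  define k where "k = abs e + 1"
  have k: "k > 0" "e \<le> k" by (auto simp: k_def)
  have "0 \<le> 2 * (- c / k) * c + (- c / k)^2 * e" by (rule assms)
  also have "... \<le> 2 * (- c / k) * c + (- c / k)^2 * k"
    by (intro add_left_mono mult_left_mono k) auto
  also have "... = - (c^2 / k)" using k by (simp add: power2_eq_square field_simps)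
  also have "... < 0" using k c by simp
  finally show False by simp
qed

lemma compact_unit_sphere_fun:
  "compact {v :: nat \<Rightarrow> real. (\<forall>i. i \<ge> p \<longrightarrow> v i = 0) \<and> sqn p v = 1}" (is "compact ?S")
proof -
  have "compactin (product_topology (\<lambda>_. euclidean) UNIV) (PiE UNIV (\<lambda>_::nat. {-1..1::real}))"
    by (subst compactin_PiE) auto
  hence c: "compact (PiE UNIV (\<lambda>_::nat. {-1..1::real}))"
    by (simp add: euclidean_product_topology)
  have cl: "closed ?S"
    by (intro closed_Collect_conj closed_Collect_all closed_Collect_imp closed_Collect_eq
        continuous_intros continuous_on_product_coordinates open_Collect_const)
  have "?S \<subseteq> PiE UNIV (\<lambda>_::nat. {-1..1::real})"
  proof
    fix v assume v: "v \<in> ?S"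
    have "abs (v i) \<le> 1" for i
    proof (cases "i < p")
      case True
      hence "(v i)^2 \<le> sqn p v" by (intro member_le_sum) auto
      hence "(v i)^2 \<le> 1^2" using v by simp
      thus ?thesis using abs_le_square_iff[of "v i" 1] by simp
    qed (use v in auto)
    thus "v \<in> PiE UNIV (\<lambda>_::nat. {-1..1::real})" by (intro PiE_I) (auto simp: abs_le_iff minus_le_iff)
  qed
  thus ?thesis using c cl compact_Int_closed[OF c cl] by (simp add: Int_absorb1)
qed

lemma rayleigh_min_eigenvalue:
  assumes p: "1 \<le> p" and sym: "\<forall>i<p. \<forall>j<p. A i j = A j i"
  shows "\<exists>k. is_eigenvalue p A k \<and> (\<forall>v. k * sqn p v \<le> quad p A v)"
proof -
  let ?S = "{v :: nat \<Rightarrow> real. (\<forall>i. i \<ge> p \<longrightarrow> v i = 0) \<and> sqn p v = 1}"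
  have ne: "?S \<noteq> {}"
  proof -
    have "(\<Sum>i<p. (if i = 0 then 1 else (0::real))^2) = (\<Sum>i<p. (if i = 0 then 1 else (0::real)))"
      by (intro sum.cong) auto
    hence "(\<lambda>i. if i = 0 then 1 else (0::real)) \<in> ?S" using p by auto
    thus ?thesis by (rule ex_in_conv[THEN iffD1, OF exI])
  qed
  have cont: "continuous_on ?S (quad p A)"
    unfolding quad_def
    by (intro continuous_intros continuous_on_subset[OF continuous_on_product_coordinates subset_UNIV])
  obtain v0 where v0: "v0 \<in> ?S" "\<And>v. v \<in> ?S \<Longrightarrow> quad p A v0 \<le> quad p A v"
    using continuous_attains_inf[OF compact_unit_sphere_fun ne cont] by auto
  define k where "k = quad p A v0"
  have ge: "k * sqn p v \<le> quad p A v" for v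
  proof -
    define q where "q = sqn p v"
    have q0: "q \<ge> 0" unfolding q_def by (intro sum_nonneg) auto
    show ?thesis
    proof (cases "q = 0")
      case True
      hence "\<forall>i<p. v i = 0" unfolding q_def by (subst (asm) sum_nonneg_eq_0_iff) auto
      hence "quad p A v = 0" unfolding quad_def by (intro sum.neutral ballI) auto
      thus ?thesis using True by (simp add: q_def)
    next
      case False
      with q0 have q: "q > 0" by simp
      define w where "w = (\<lambda>i. if i < p then 1 / sqrt q * v i else 0)"
      have "sqn p w = (\<Sum>i<p. (v i)^2 / q)"
        using q by (intro sum.cong) (auto simp: w_def power_divide)
      also have "... = 1" using q by (simp add: sum_divide_distrib[symmetric] q_def[symmetric])
      finally have "w \<in> ?S" by (auto simp: w_def)
      hence "k \<le> quad p A w" using v0(2) k_def by auto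
      also have "quad p A w = quad p A (\<lambda>i. 1 / sqrt q * v i)"
        unfolding quad_def by (intro sum.cong refl) (auto simp: w_def)
      also have "... = (1 / sqrt q)^2 * quad p A v" by (rule quad_scale)
      finally show ?thesis using q by (simp add: q_def[symmetric] power_divide field_simps)
    qed
  qed
  have "(\<Sum>j<p. A i j * v0 j) = k * v0 i" if i: "i < p" for i
  proof -
    define w :: "nat \<Rightarrow> real" where "w = (\<lambda>j. if j = i then 1 else 0)"
    have sw: "(\<Sum>j<p. w j * f j) = f i" for f
      using i by (simp add: w_def if_distrib[of "\<lambda>x. x * _"] cong: if_cong)
    have "0 \<le> 2 * s * ((\<Sum>j<p. A i j * v0 j) - k * v0 i) + s^2 * (quad p A w - k)" for s
    proof -
      have n: "(\<Sum>j<p. (v0 j + s * w j)^2) = 1 + 2 * s * v0 i + s^2"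
      proof -
        have "(\<Sum>j<p. (v0 j + s * w j)^2) = sqn p v0 + 2 * s * (\<Sum>j<p. w j * v0 j) + s^2 * (\<Sum>j<p. w j * w j)"
          unfolding sum_distrib_left sum.distrib[symmetric]
          by (intro sum.cong refl) (simp add: algebra_simps power2_eq_square)
        thus ?thesis using v0(1) unfolding sw by (simp add: w_def)
      qed
      have "k * (1 + 2 * s * v0 i + s^2) \<le> quad p A (\<lambda>j. v0 j + s * w j)"
        using ge[of "\<lambda>j. v0 j + s * w j"] unfolding n .
      also have "... = k + 2 * s * (\<Sum>j<p. A i j * v0 j) + s^2 * quad p A w"
        unfolding quad_add[OF sym] sw k_def ..
      finally show ?thesis by (simp add: algebra_simps)
    qed
    from linear_coeff_zero_if_nonneg[OF this] show ?thesis by simp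
  qed
  moreover have "\<exists>i<p. v0 i \<noteq> 0"
  proof (rule ccontr)
    assume "\<not> (\<exists>i<p. v0 i \<noteq> 0)"
    hence "sqn p v0 = 0" by (intro sum.neutral) auto
    thus False using v0(1) by simp
  qed
  ultimately have "is_eigenvalue p A k" unfolding is_eigenvalue_def by blast
  thus ?thesis using ge by blast
qed

lemma finite_eigenvalues: "finite {k. is_eigenvalue p A k}"
proof -
  have "{k. is_eigenvalue p A k} \<subseteq> {k. poly (char_poly (fmat p A)) k = 0}"
  proof clarify
    fix k assume "is_eigenvalue p A k"
    then obtain v where v: "\<exists>i<p. v i \<noteq> 0" "\<forall>i<p. (\<Sum>j<p. A i j * v j) = k * v i"
      unfolding is_eigenvalue_def by blast
    have "vec p v \<noteq> 0\<^sub>v p"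
    proof
      assume h: "vec p v = 0\<^sub>v p"
      obtain i where "i < p" "v i \<noteq> 0" using v(1) by blast
      thus False using arg_cong[OF h, of "\<lambda>w. w $ i"] by simp
    qed
    moreover have "fmat p A *\<^sub>v vec p v = k \<cdot>\<^sub>v vec p v"
      using v(2) by (intro eq_vecI) (auto simp: fmat_def scalar_prod_def lessThan_atLeast0)
    ultimately have "eigenvector (fmat p A) (vec p v) k"
      unfolding eigenvector_def by (auto simp: fmat_def)
    hence "eigenvalue (fmat p A) k" unfolding eigenvalue_def by blast
    thus "poly (char_poly (fmat p A)) k = 0"
      by (simp add: eigenvalue_root_char_poly[OF fmat_carrier])
  qed
  moreover have "char_poly (fmat p A) \<noteq> 0"
    using degree_monic_char_poly[OF fmat_carrier, of p A] by auto
  ultimately show ?thesis using poly_roots_finite finite_subset by blast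
qed

lemma lam_min_le_quad:
  assumes "1 \<le> p" "\<forall>i<p. \<forall>j<p. A i j = A j i"
  shows "lam_min p A * sqn p v \<le> quad p A v"
proof -
  obtain k where k: "is_eigenvalue p A k" "\<And>v. k * sqn p v \<le> quad p A v"
    using rayleigh_min_eigenvalue[OF assms] by blast
  have "lam_min p A \<le> k" unfolding lam_min_def using k(1) finite_eigenvalues by (intro Min_le) auto
  hence "lam_min p A * sqn p v \<le> k * sqn p v"
    by (intro mult_right_mono sum_nonneg) auto
  thus ?thesis using k(2)[of v] by linarith
qed

lemma quad_le_lam_max:
  assumes "1 \<le> p" "\<forall>i<p. \<forall>j<p. A i j = A j i"
  shows "quad p A v \<le> lam_max p A * sqn p v"
proof -
  obtain k where k: "is_eigenvalue p (\<lambda>i j. - A i j) k"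
      "\<And>v. k * sqn p v \<le> quad p (\<lambda>i j. - A i j) v"
    using rayleigh_min_eigenvalue[of p "\<lambda>i j. - A i j"] assms by auto
  obtain w where w: "\<exists>i<p. w i \<noteq> 0" "\<forall>i<p. (\<Sum>j<p. - A i j * w j) = k * w i"
    using k(1) unfolding is_eigenvalue_def by blast
  have "\<forall>i<p. (\<Sum>j<p. A i j * w j) = (- k) * w i"
    using w(2) by (auto simp: sum_negf)
  hence "is_eigenvalue p A (- k)" unfolding is_eigenvalue_def using w(1) by blast
  hence "- k \<le> lam_max p A" unfolding lam_max_def using finite_eigenvalues by (intro Max_ge) auto
  hence "- k * sqn p v \<le> lam_max p A * sqn p v"
    by (intro mult_right_mono sum_nonneg) auto
  moreover have "quad p (\<lambda>i j. - A i j) v = - quad p A v"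
    by (simp add: quad_def sum_negf)
  ultimately show ?thesis using k(2)[of v] by simp
qed

lemma quad_eq_sum: "quad n A v = (\<Sum>i<n. v i * (\<Sum>j<n. A i j * v j))"
  unfolding quad_def sum_distrib_left by (intro sum.cong refl) (simp add: mult_ac)

lemma quad_pos_if_elliptic:
  assumes "0 < c" "c * sqn n v \<le> quad n A v" "\<exists>i<n. v i \<noteq> 0"
  shows "0 < quad n A v"
proof -
  obtain i where i: "i < n" "v i \<noteq> 0" using assms(3) by blast
  have "0 < sqn n v" using i by (intro sum_pos2[of _ i]) auto
  hence "0 < c * sqn n v" using assms(1) by simp
  thus ?thesis using assms(2) by linarith
qed

lemma posdef_inj:
  assumes pos: "\<And>v. \<exists>i<n. v i \<noteq> 0 \<Longrightarrow> 0 < quad n A v"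
    and z: "\<forall>i<n. (\<Sum>j<n. A i j * v j) = 0"
  shows "\<forall>i<n. v i = 0"
proof (rule ccontr)
  assume "\<not> (\<forall>i<n. v i = 0)"
  hence "0 < quad n A v" using pos by blast
  thus False using z by (simp add: quad_eq_sum)
qed

text \<open>The new row \<open>l\<close> solves \<open>L l = a\<close>, where \<open>a\<close> is the new column; the new pivot is the value of the
  quadratic form at \<open>(-u, 1)\<close> with \<open>A u = a\<close>, hence positive.\<close>

lemma cholesky_exists:
  assumes "\<forall>i<n. \<forall>j<n. A i j = A j i"
    and "\<And>v. \<exists>i<n. v i \<noteq> 0 \<Longrightarrow> 0 < quad n A v"
  shows "\<exists>L. (\<forall>i<n. \<forall>j>i. L i j = 0) \<and> (\<forall>i<n. 0 < L i i)
    \<and> (\<forall>i<n. \<forall>j<n. (\<Sum>k<n. L i k * L j k) = A i (j::nat))"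
  using assms
proof (induction n)
  case 0
  show ?case by simp
next
  case (Suc n)
  have quad_Suc: "quad (Suc n) A v = quad n A v + 2 * v n * (\<Sum>i<n. v i * A i n) + A n n * (v n)^2" for v
  proof -
    have "(\<Sum>j<n. v n * A n j * v j) = v n * (\<Sum>i<n. v i * A i n)"
      unfolding sum_distrib_left using Suc.prems(1) by (intro sum.cong) auto
    moreover have "(\<Sum>i<n. v i * A i n * v n) = v n * (\<Sum>i<n. v i * A i n)"
      unfolding sum_distrib_left by (intro sum.cong) auto
    ultimately show ?thesis
      by (simp add: quad_def sum.distrib power2_eq_square algebra_simps)
  qed
  have pos_n: "0 < quad n A v" if "\<exists>i<n. v i \<noteq> 0" for v
  proof -
    have "0 < quad (Suc n) A (v(n := 0))" using that by (intro Suc.prems(2)) auto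
    also have "... = quad n A (v(n := 0))" unfolding quad_Suc by simp
    also have "... = quad n A v" by (simp add: quad_def)
    finally show ?thesis .
  qed
  obtain L where L: "\<forall>i<n. \<forall>j>i. L i j = 0" "\<forall>i<n. 0 < L i i"
      "\<forall>i<n. \<forall>j<n. (\<Sum>k<n. L i k * L j k) = A i j"
    using Suc.IH pos_n Suc.prems(1) by fastforce
  define u where "u j = (\<Sum>k<n. mat_inv n A j k * A k n)" for j
  have u: "(\<Sum>j<n. A i j * u j) = A i n" if "i < n" for i
    unfolding u_def by (rule mat_inv_solve[OF posdef_inj[OF pos_n] that])
  define l where "l k = (\<Sum>i<n. L i k * u i)" for k
  have l: "(\<Sum>k<n. L i k * l k) = A i n" if "i < n" for i
  proof -
    have "(\<Sum>k<n. L i k * l k) = (\<Sum>j<n. (\<Sum>k<n. L i k * L j k) * u j)"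
      unfolding l_def sum_distrib_left sum_distrib_right by (subst sum.swap) (simp add: mult_ac)
    also have "... = (\<Sum>j<n. A i j * u j)" using L(3) that by simp
    finally show ?thesis using u that by simp
  qed
  have ll: "(\<Sum>k<n. l k * l k) = (\<Sum>i<n. u i * A i n)"
  proof -
    have "(\<Sum>k<n. l k * l k) = (\<Sum>i<n. u i * (\<Sum>k<n. L i k * l k))"
      unfolding sum_distrib_left by (subst sum.swap) (simp add: l_def sum_distrib_left sum_distrib_right mult_ac)
    thus ?thesis using l by simp
  qed
  define e where "e = A n n - (\<Sum>k<n. l k * l k)"
  have "0 < quad (Suc n) A (\<lambda>i. if i < n then - u i else 1)" by (intro Suc.prems(2)) (auto intro!: exI[of _ n])
  also have "... = quad n A (\<lambda>i. -1 * u i) - 2 * (\<Sum>i<n. u i * A i n) + A n n"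
    unfolding quad_Suc by (simp add: quad_def sum_negf)
  also have "quad n A (\<lambda>i. -1 * u i) = (\<Sum>i<n. u i * A i n)"
    unfolding quad_scale by (simp add: quad_eq_sum u)
  finally have e: "e > 0" unfolding e_def ll by simp
  define L' where "L' i j = (if i < n then (if j < n then L i j else 0)
      else if j < n then l j else if j = n then sqrt e else 0)" for i j
  have L'n: "i < n \<Longrightarrow> j < n \<Longrightarrow> L' i j = L i j" "i < n \<Longrightarrow> L' i n = 0"
    "j < n \<Longrightarrow> L' n j = l j" "L' n n = sqrt e" for i j by (auto simp: L'_def)
  show ?case
  proof (intro exI[of _ L'] conjI allI impI)
    fix i j assume "i < Suc n" "i < j" thus "L' i j = 0" using L(1) by (auto simp: L'_def)
  next
    fix i assume "i < Suc n" thus "0 < L' i i" using L(2) e by (auto simp: L'_def)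
  next
    fix i j assume ij: "i < Suc n" "j < Suc n"
    consider "i < n" "j < n" | "i < n" "j = n" | "i = n" "j < n" | "i = n" "j = n" using ij by linarith
    thus "(\<Sum>k<Suc n. L' i k * L' j k) = A i j"
    proof cases
      case 1 thus ?thesis using L(3) by (simp add: L'n)
    next
      case 2 thus ?thesis using l by (simp add: L'n)
    next
      case 3
      have "(\<Sum>k<n. l k * L j k) = (\<Sum>k<n. L j k * l k)" by (simp add: mult_ac)
      thus ?thesis using 3 l Suc.prems(1) by (simp add: L'n)
    next
      case 4 thus ?thesis using e by (simp add: L'n e_def)
    qed
  qed
qed

lemma mdet_cholesky:
  assumes L: "\<forall>i<n. \<forall>j>i. L i j = 0" "\<forall>i<n. \<forall>j<n. (\<Sum>k<n. L i k * L j k) = A i j"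
  shows "mdet n A = (\<Prod>i<n. L i i)^2"
proof -
  have "fmat n A = fmat n L * transpose_mat (fmat n L)"
    using L(2) by (intro eq_matI) (auto simp: fmat_def scalar_prod_def lessThan_atLeast0)
  hence "det (fmat n A) = det (fmat n L) * det (fmat n L)"
    by (simp add: det_mult[of _ n] det_transpose[of _ n])
  moreover have "det (fmat n L) = prod_list (diag_mat (fmat n L))"
    by (rule det_lower_triangular[of n]) (use L(1) in \<open>auto simp: fmat_def\<close>)
  moreover have "prod_list (diag_mat (fmat n L)) = (\<Prod>i<n. L i i)"
    unfolding prod_list_diag_prod by (auto simp: fmat_def lessThan_atLeast0 intro!: prod.cong)
  ultimately show ?thesis by (simp add: mdet_eq_det power2_eq_square)
qed

section \<open>Moments of the Gaussian measure\<close>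

abbreviation lebn :: "nat \<Rightarrow> (nat \<Rightarrow> real) measure" where
  "lebn n \<equiv> PiM {..<n} (\<lambda>_. lborel)"

lemma coord_measurable: "k < n \<Longrightarrow> (\<lambda>z. z k) \<in> borel_measurable (lebn n)"
  using measurable_component_singleton[of k "{..<n}" "\<lambda>_. lborel"] by simp

lemma measurable_affine_PiM [measurable]:
  "(\<lambda>z. \<lambda>i\<in>{..<n}. c i + (\<Sum>k<n. L i k * z k)) \<in> lebn n \<rightarrow>\<^sub>M lebn n"
  by (intro measurable_restrict) measurable

lemma nn_integral_lower_triangular:
  fixes L :: "nat \<Rightarrow> nat \<Rightarrow> real"
  assumes "\<forall>i<n. \<forall>j>i. L i j = 0" "\<forall>i<n. 0 < L i i" "f \<in> borel_measurable (lebn n)"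
  shows "(\<integral>\<^sup>+x. f x \<partial>lebn n) = ennreal (\<Prod>i<n. L i i) *
     (\<integral>\<^sup>+z. f (\<lambda>i\<in>{..<n}. c i + (\<Sum>k<n. L i k * z k)) \<partial>lebn n)"
  using assms
proof (induction n arbitrary: f)
  case 0
  have [simp]: "(\<lambda>i\<in>{}. c i) = (\<lambda>_. undefined)" by auto
  show ?case by (simp add: PiM_empty nn_integral_count_space_finite)
next
  case (Suc n)
  interpret product_sigma_finite "\<lambda>_::nat. lborel :: real measure" by standard
  let ?X = "\<lambda>z. \<lambda>i\<in>{..<n}. c i + (\<Sum>k<n. L i k * z k)"
  let ?X' = "\<lambda>z. \<lambda>i\<in>{..<Suc n}. c i + (\<Sum>k<Suc n. L i k * z k)"
  have set: "{..<Suc n} = insert n {..<n}" by auto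
  note f [measurable] = Suc.prems(3)
  have fm: "f \<in> borel_measurable (PiM (insert n {..<n}) (\<lambda>_. lborel))"
    using f unfolding set .
  have m: "(\<lambda>(x, y). f (x(n := y))) \<in> borel_measurable (lebn n \<Otimes>\<^sub>M lborel)"
    using measurable_compose[OF measurable_add_dim[of n "{..<n}" "\<lambda>_. lborel"] fm]
    by (simp add: split_beta')
  define g where "g = (\<lambda>z. f (?X' z))"
  have gm: "g \<in> borel_measurable (lebn (Suc n))"
    unfolding g_def by (rule measurable_compose[OF measurable_affine_PiM f])
  define F where "F x = (\<integral>\<^sup>+y. f (x(n := y)) \<partial>lborel)" for x
  have F: "F \<in> borel_measurable (lebn n)"
    unfolding F_def using m by (rule lborel.borel_measurable_nn_integral)
  have "(\<integral>\<^sup>+x. f x \<partial>lebn (Suc n)) = (\<integral>\<^sup>+x. F x \<partial>lebn n)"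
    unfolding set F_def by (rule product_nn_integral_insert) (auto simp: fm)
  also have "... = ennreal (\<Prod>i<n. L i i) * (\<integral>\<^sup>+z. F (?X z) \<partial>lebn n)"
    using Suc.prems(1,2) F by (intro Suc.IH) auto
  also have "(\<integral>\<^sup>+z. F (?X z) \<partial>lebn n)
      = (\<integral>\<^sup>+z. ennreal (L n n) * (\<integral>\<^sup>+y. f (?X' (z(n := y))) \<partial>lborel) \<partial>lebn n)"
  proof (rule nn_integral_cong)
    fix z assume z: "z \<in> space (lebn n)"
    have Xz: "?X z \<in> space (lebn n)" by (auto simp: space_PiM)
    have m1: "(\<lambda>y. f ((?X z)(n := y))) \<in> borel_measurable borel"
      using measurable_compose[OF measurable_Pair1'[OF Xz] m] by simp
    have "F (?X z) = ennreal (abs (L n n)) * (\<integral>\<^sup>+y. f ((?X z)(n := (c n + (\<Sum>k<n. L n k * z k)) + L n n * y)) \<partial>lborel)"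
      unfolding F_def using Suc.prems(2) by (intro nn_integral_real_affine m1) auto
    moreover have "(?X z)(n := (c n + (\<Sum>k<n. L n k * z k)) + L n n * y) = ?X' (z(n := y))" for y
      using Suc.prems(1) by (auto simp: restrict_def fun_eq_iff less_Suc_eq intro!: sum.cong)
    moreover have "abs (L n n) = L n n" using Suc.prems(2) by auto
    ultimately show "F (?X z) = ennreal (L n n) * (\<integral>\<^sup>+y. f (?X' (z(n := y))) \<partial>lborel)" by simp
  qed
  also have "... = ennreal (L n n) * (\<integral>\<^sup>+z. (\<integral>\<^sup>+y. g (z(n := y)) \<partial>lborel) \<partial>lebn n)"
    unfolding fun_cong[OF g_def, symmetric]
  proof (rule nn_integral_cmult)
    have "(\<lambda>(x, y). g (x(n := y))) \<in> borel_measurable (lebn n \<Otimes>\<^sub>M lborel)"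
      using measurable_compose[OF measurable_add_dim[of n "{..<n}" "\<lambda>_. lborel"] gm[unfolded set]]
      by (simp add: split_beta')
    thus "(\<lambda>z. \<integral>\<^sup>+y. g (z(n := y)) \<partial>lborel) \<in> borel_measurable (lebn n)"
      by (rule lborel.borel_measurable_nn_integral)
  qed
  also have "(\<integral>\<^sup>+z. (\<integral>\<^sup>+y. g (z(n := y)) \<partial>lborel) \<partial>lebn n) = (\<integral>\<^sup>+z. f (?X' z) \<partial>lebn (Suc n))"
    unfolding fun_cong[OF g_def, symmetric]
    using product_nn_integral_insert[of "{..<n}" n g, folded set, OF _ _ gm] by simp
  also have "ennreal (\<Prod>i<n. L i i) * (ennreal (L n n) * I) = ennreal (\<Prod>i<Suc n. L i i) * I" for I
  proof -
    have "0 \<le> (\<Prod>i<n. L i i)" "0 \<le> L n n"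
      using Suc.prems(2) by (auto intro!: prod_nonneg simp: less_imp_le)
    thus ?thesis by (simp add: ennreal_mult mult.assoc)
  qed
  finally show ?case .
qed

definition std_dens :: "nat \<Rightarrow> (nat \<Rightarrow> real) \<Rightarrow> real" where
  "std_dens n z = (\<Prod>i<n. std_normal_density (z i))"

lemma std_dens_measurable [measurable]: "std_dens n \<in> borel_measurable (lebn n)"
  unfolding std_dens_def by measurable

lemma std_dens_nonneg [simp]: "std_dens n z \<ge> 0"
  by (simp add: std_dens_def prod_nonneg)

lemma std_dens_eq: "std_dens n z = (2 * pi) powr (- real n / 2) * exp (- (1/2) * sqn n z)"
proof -
  have "std_dens n z = (\<Prod>i<n. (2 * pi) powr (-1/2) * exp (- (1/2) * (z i)^2))"
    unfolding std_dens_def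
    by (intro prod.cong refl) (simp add: std_normal_density_def powr_minus powr_half_sqrt[symmetric] field_simps)
  also have "... = ((2 * pi) powr (-1/2)) ^ n * exp (\<Sum>i<n. - (1/2) * (z i)^2)"
    by (simp add: prod.distrib exp_sum)
  also have "((2 * pi) powr (-1/2)) ^ n = (2 * pi) powr (- real n / 2)"
    by (simp add: powr_realpow[symmetric] powr_powr)
  finally show ?thesis by (simp add: sum_distrib_left)
qed

lemma std_dens_monomial:
  "has_bochner_integral (lebn n) (\<lambda>z. \<Prod>i<n. std_normal_density (z i) * z i ^ a i)
     (\<Prod>i<n. \<integral>x. std_normal_density x * x ^ a i \<partial>lborel)"
proof -
  interpret product_sigma_finite "\<lambda>_::nat. lborel :: real measure" by standard
  show ?thesis
    using product_integrable_prod[of "{..<n}" "\<lambda>i x. std_normal_density x * x ^ a i"]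
      product_integral_prod[of "{..<n}" "\<lambda>i x. std_normal_density x * x ^ a i"]
      integrable_std_normal_moment
    by (simp add: has_bochner_integral_iff)
qed

lemma std_moments:
  "(\<integral>x. std_normal_density x * x ^ 0 \<partial>lborel) = 1"
  "(\<integral>x. std_normal_density x * x ^ 1 \<partial>lborel) = 0"
  "(\<integral>x. std_normal_density x * x ^ 2 \<partial>lborel) = 1"
  using integral_std_normal_moment_even[of 0] integral_std_normal_moment_odd[of 0]
    integral_std_normal_moment_even[of 1] by (simp_all add: numeral_2_eq_2)

definition std_gauss :: "nat \<Rightarrow> (nat \<Rightarrow> real) measure" where
  "std_gauss n = density (lebn n) (\<lambda>z. ennreal (std_dens n z))"

lemma std_gauss_moments:
  "has_bochner_integral (std_gauss n) (\<lambda>z. 1) (1::real)"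
  "k < n \<Longrightarrow> has_bochner_integral (std_gauss n) (\<lambda>z. z k) 0"
  "k < n \<Longrightarrow> l < n \<Longrightarrow> has_bochner_integral (std_gauss n) (\<lambda>z. z k * z l) (if k = l then 1 else 0)"
proof -
  have dens: "has_bochner_integral (std_gauss n) g v"
    if "has_bochner_integral (lebn n) (\<lambda>z. std_dens n z * g z) v" "g \<in> borel_measurable (lebn n)" for g v
    unfolding std_gauss_def using that
    by (intro has_bochner_integral_density) auto
  have "has_bochner_integral (lebn n) (\<lambda>z. std_dens n z * 1) 1"
    using std_dens_monomial[of n "\<lambda>_. 0"] std_moments by (simp add: std_dens_def)
  from dens[OF this] show "has_bochner_integral (std_gauss n) (\<lambda>z. 1) (1::real)" by simp
  show "has_bochner_integral (std_gauss n) (\<lambda>z. z k) 0" if k: "k < n"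
  proof (rule dens)
    let ?a = "\<lambda>i. if i = k then 1 else (0::nat)"
    have a: "(\<Prod>i<n. std_normal_density (z i) * z i ^ ?a i) = std_dens n z * z k" for z
      using k by (simp add: prod.distrib std_dens_def if_distrib[of "\<lambda>x. _ ^ x"] cong: if_cong)
    have b: "(\<Prod>i<n. \<integral>x. std_normal_density x * x ^ ?a i \<partial>lborel) = 0"
      using k std_moments(2) by (intro prod_zero bexI[of _ k]) auto
    show "has_bochner_integral (lebn n) (\<lambda>z. std_dens n z * z k) 0"
      using std_dens_monomial[of n ?a] unfolding a b .
    show "(\<lambda>z. z k) \<in> borel_measurable (lebn n)" by (rule coord_measurable[OF k])
  qed
  show "has_bochner_integral (std_gauss n) (\<lambda>z. z k * z l) (if k = l then 1 else 0)" if k: "k < n" "l < n"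
  proof (rule dens)
    let ?a = "\<lambda>i. (if i = k then 1 else (0::nat)) + (if i = l then 1 else (0::nat))"
    have a: "(\<Prod>i<n. std_normal_density (z i) * z i ^ ?a i) = std_dens n z * (z k * z l)" for z
      using k by (simp add: power_add prod.distrib std_dens_def if_distrib[of "\<lambda>x. _ ^ x"] cong: if_cong)
    have b: "(\<Prod>i<n. \<integral>x. std_normal_density x * x ^ ?a i \<partial>lborel) = (if k = l then 1 else 0)"
    proof (cases "k = l")
      case True
      have "(\<integral>x. std_normal_density x * x ^ ?a i \<partial>lborel) = 1" for i
      proof (cases "i = l")
        case i: True
        have "?a i = 2" using i True by simp
        thus ?thesis using std_moments(3) by simp
      next
        case i: False
        thus ?thesis using i True std_moments(1) by simp
      qed
      thus ?thesis using True by simp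
    next
      case False
      have "(\<integral>x. std_normal_density x * x ^ ?a k \<partial>lborel) = 0"
        using False std_moments(2) by simp
      thus ?thesis using False k by (auto intro!: prod_zero)
    qed
    show "has_bochner_integral (lebn n) (\<lambda>z. std_dens n z * (z k * z l)) (if k = l then 1 else 0)"
      using std_dens_monomial[of n ?a] unfolding a b .
    show "(\<lambda>z. z k * z l) \<in> borel_measurable (lebn n)" using k by (intro borel_measurable_times coord_measurable)
  qed
qed

lemma gauss_dens_measurable [measurable]: "gauss_dens n mm S \<in> borel_measurable (lebn n)"
  unfolding gauss_dens_def by measurable

lemma gauss_dens_cholesky:
  assumes pos: "\<And>v. \<exists>i<n. v i \<noteq> 0 \<Longrightarrow> 0 < quad n S v"
    and L: "\<forall>i<n. \<forall>j>i. L i j = 0" "\<forall>i<n. 0 < L i i" "\<forall>i<n. \<forall>j<n. (\<Sum>k<n. L i k * L j k) = S i j"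
    and x: "\<And>i. i < n \<Longrightarrow> x i = mm i + (\<Sum>k<n. L i k * z k)"
  shows "(\<Prod>i<n. L i i) * gauss_dens n mm S x = std_dens n z"
proof -
  define P where "P = (\<Prod>i<n. L i i)"
  have P: "P > 0" unfolding P_def using L(2) by (intro prod_pos) auto
  have det: "mdet n S powr (-1/2) = 1 / P"
    using P unfolding mdet_cholesky[OF L(1,3)] P_def[symmetric]
    by (simp add: powr_minus powr_half_sqrt divide_simps)
  define w where "w = (\<lambda>i. \<Sum>k<n. L i k * z k)"
  define u where "u j = (\<Sum>k<n. mat_inv n S j k * w k)" for j
  have u: "(\<Sum>j<n. S i j * u j) = w i" if "i < n" for i
    unfolding u_def by (rule mat_inv_solve[OF posdef_inj[OF pos] that])
  define q where "q k = (\<Sum>j<n. L j k * u j) - z k" for k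
  have Lq: "(\<Sum>k<n. L i k * q k) = 0" if i: "i < n" for i
  proof -
    have "(\<Sum>k<n. L i k * (\<Sum>j<n. L j k * u j)) = (\<Sum>j<n. (\<Sum>k<n. L i k * L j k) * u j)"
      unfolding sum_distrib_left sum_distrib_right by (subst sum.swap) (simp add: mult_ac)
    also have "... = (\<Sum>j<n. S i j * u j)" using L(3) i by simp
    finally show ?thesis using u[OF i] by (simp add: q_def w_def algebra_simps sum_subtractf)
  qed
  have q0: "k < n \<Longrightarrow> q k = 0" for k
  proof (induction k rule: less_induct)
    case (less k)
    have "(\<Sum>j<n. L k j * q j) = (\<Sum>j\<in>{k}. L k j * q j)"
      using less L(1) by (intro sum.mono_neutral_right) (auto, metis linorder_neqE_nat)
    hence "L k k * q k = 0" using Lq[OF less.prems] by simp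
    moreover have "L k k \<noteq> 0" using L(2) less.prems by (metis less_irrefl)
    ultimately show ?case by simp
  qed
  have xw: "x i - mm i = w i" if "i < n" for i using x[OF that] by (simp add: w_def)
  have "(\<Sum>i<n. \<Sum>j<n. (x i - mm i) * mat_inv n S i j * (x j - mm j)) = (\<Sum>i<n. w i * u i)"
    by (simp add: u_def xw sum_distrib_left mult_ac)
  also have "... = (\<Sum>k<n. z k * (\<Sum>i<n. L i k * u i))"
    unfolding w_def sum_distrib_left sum_distrib_right by (subst sum.swap) (simp add: mult_ac)
  also have "... = sqn n z"
    using q0 by (intro sum.cong) (auto simp: q_def power2_eq_square)
  finally have "gauss_dens n mm S x = (2 * pi) powr (- real n / 2) * (1 / P) * exp (- (1/2) * sqn n z)"
    unfolding gauss_dens_def det by simp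
  thus ?thesis using P unfolding std_dens_eq P_def[symmetric] by (simp add: field_simps)
qed

lemma gaussian_eq_distr:
  assumes pos: "\<And>v. \<exists>i<n. v i \<noteq> 0 \<Longrightarrow> 0 < quad n S v"
    and L: "\<forall>i<n. \<forall>j>i. L i j = 0" "\<forall>i<n. 0 < L i i" "\<forall>i<n. \<forall>j<n. (\<Sum>k<n. L i k * L j k) = S i j"
  shows "gaussian n mm S = distr (std_gauss n) (lebn n) (\<lambda>z. \<lambda>i\<in>{..<n}. mm i + (\<Sum>k<n. L i k * z k))"
    (is "_ = distr _ _ ?X")
proof (rule measure_eqI)
  show "sets (gaussian n mm S) = sets (distr (std_gauss n) (lebn n) ?X)" by (simp add: gaussian_def)
next
  fix A assume "A \<in> sets (gaussian n mm S)"
  hence A [measurable]: "A \<in> sets (lebn n)" by (simp add: gaussian_def)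
  have P: "(\<Prod>i<n. L i i) \<ge> 0" using L(2) by (intro prod_nonneg) (auto simp: less_imp_le)
  have X [measurable]: "?X \<in> std_gauss n \<rightarrow>\<^sub>M lebn n" unfolding std_gauss_def by measurable
  have "emeasure (gaussian n mm S) A = (\<integral>\<^sup>+x. ennreal (gauss_dens n mm S x) * indicator A x \<partial>lebn n)"
    unfolding gaussian_def by (subst emeasure_density) auto
  also have "... = ennreal (\<Prod>i<n. L i i) * (\<integral>\<^sup>+z. ennreal (gauss_dens n mm S (?X z)) * indicator A (?X z) \<partial>lebn n)"
    by (rule nn_integral_lower_triangular[OF L(1,2)]) measurable
  also have "... = (\<integral>\<^sup>+z. ennreal (\<Prod>i<n. L i i) * (ennreal (gauss_dens n mm S (?X z)) * indicator A (?X z)) \<partial>lebn n)"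
    by (rule nn_integral_cmult[symmetric]) measurable
  also have "... = (\<integral>\<^sup>+z. ennreal (std_dens n z) * indicator A (?X z) \<partial>lebn n)"
  proof (rule nn_integral_cong)
    fix z
    have "ennreal (\<Prod>i<n. L i i) * ennreal (gauss_dens n mm S (?X z)) = ennreal (std_dens n z)"
      using gauss_dens_cholesky[OF pos L, of "?X z" mm z] P by (simp add: ennreal_mult'[symmetric])
    thus "ennreal (\<Prod>i<n. L i i) * (ennreal (gauss_dens n mm S (?X z)) * indicator A (?X z))
        = ennreal (std_dens n z) * indicator A (?X z)" by (simp add: mult.assoc[symmetric])
  qed
  also have "... = emeasure (std_gauss n) (?X -` A \<inter> space (lebn n))"
    unfolding std_gauss_def
    by (subst emeasure_density) (auto intro!: nn_integral_cong simp: indicator_def)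
  also have "... = emeasure (distr (std_gauss n) (lebn n) ?X) A"
    by (subst emeasure_distr) (auto simp: std_gauss_def)
  finally show "emeasure (gaussian n mm S) A = emeasure (distr (std_gauss n) (lebn n) ?X) A" .
qed

lemma gaussian_moments:
  assumes sym: "\<forall>i<n. \<forall>j<n. S i j = S j i"
    and pos: "\<And>v. \<exists>i<n. v i \<noteq> 0 \<Longrightarrow> 0 < quad n S v"
  shows "has_bochner_integral (gaussian n mm S) (\<lambda>x. 1) (1::real)"
    and "i < n \<Longrightarrow> has_bochner_integral (gaussian n mm S) (\<lambda>x. x i - a) (mm i - a)"
    and "i < n \<Longrightarrow> j < n \<Longrightarrow> has_bochner_integral (gaussian n mm S) (\<lambda>x. (x i - a) * (x j - b))
        (S i j + (mm i - a) * (mm j - b))"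
proof -
  obtain L where L: "\<forall>i<n. \<forall>j>i. L i j = 0" "\<forall>i<n. 0 < L i i" "\<forall>i<n. \<forall>j<n. (\<Sum>k<n. L i k * L j k) = S i j"
    using cholesky_exists[OF sym pos] by blast
  let ?X = "\<lambda>z. \<lambda>i\<in>{..<n}. mm i + (\<Sum>k<n. L i k * z k)"
  have G: "gaussian n mm S = distr (std_gauss n) (lebn n) ?X"
    by (rule gaussian_eq_distr[OF _ L]) (rule pos)
  have X [measurable]: "?X \<in> std_gauss n \<rightarrow>\<^sub>M lebn n" unfolding std_gauss_def by measurable
  have distr: "has_bochner_integral (gaussian n mm S) g v"
    if "has_bochner_integral (std_gauss n) (\<lambda>z. g (?X z)) v" "g \<in> borel_measurable (lebn n)" for g :: "(nat \<Rightarrow> real) \<Rightarrow> real" and v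
    unfolding G using that
    by (intro has_bochner_integral_distr) auto
  show "has_bochner_integral (gaussian n mm S) (\<lambda>x. 1) (1::real)"
    by (rule distr) (auto intro: std_gauss_moments)
  have lin: "has_bochner_integral (std_gauss n) (\<lambda>z. \<Sum>k<n. L i k * z k) 0" for i
  proof -
    have "has_bochner_integral (std_gauss n) (\<lambda>z. \<Sum>k<n. L i k * z k) (\<Sum>k<n. L i k * 0)"
      by (intro has_bochner_integral_sum has_bochner_integral_mult_right std_gauss_moments) auto
    thus ?thesis by simp
  qed
  have const: "has_bochner_integral (std_gauss n) (\<lambda>z. c) c" for c :: real
    using has_bochner_integral_mult_right[OF std_gauss_moments(1)[of n], of c] by simp
  show "has_bochner_integral (gaussian n mm S) (\<lambda>x. x i - a) (mm i - a)" if i: "i < n"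
  proof (rule distr)
    have "has_bochner_integral (std_gauss n) (\<lambda>z. (mm i - a) + (\<Sum>k<n. L i k * z k)) (mm i - a + 0)"
      by (intro has_bochner_integral_add const lin)
    thus "has_bochner_integral (std_gauss n) (\<lambda>z. ?X z i - a) (mm i - a)" using i by (simp add: algebra_simps)
    show "(\<lambda>x. x i - a) \<in> borel_measurable (lebn n)" using i by (intro borel_measurable_diff coord_measurable) auto
  qed
  show "has_bochner_integral (gaussian n mm S) (\<lambda>x. (x i - a) * (x j - b)) (S i j + (mm i - a) * (mm j - b))"
    if i: "i < n" and j: "j < n"
  proof (rule distr)
    have q: "has_bochner_integral (std_gauss n) (\<lambda>z. \<Sum>k<n. \<Sum>l<n. L i k * L j l * (z k * z l))
        (\<Sum>k<n. \<Sum>l<n. L i k * L j l * (if k = l then 1 else 0))"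
      by (intro has_bochner_integral_sum has_bochner_integral_mult_right std_gauss_moments) auto
    have e: "(\<Sum>k<n. \<Sum>l<n. L i k * L j l * (if k = l then 1 else 0)) = S i j"
      using L(3) i j by (simp add: if_distrib[of "\<lambda>x. _ * x"] cong: if_cong)
    have "has_bochner_integral (std_gauss n) (\<lambda>z. (\<Sum>k<n. \<Sum>l<n. L i k * L j l * (z k * z l))
        + (mm i - a) * (mm j - b) + (mm i - a) * (\<Sum>k<n. L j k * z k) + (mm j - b) * (\<Sum>k<n. L i k * z k))
        (S i j + (mm i - a) * (mm j - b) + (mm i - a) * 0 + (mm j - b) * 0)"
      using q unfolding e by (intro has_bochner_integral_add has_bochner_integral_mult_right lin const) auto
    moreover have "(\<Sum>k<n. \<Sum>l<n. L i k * L j l * (z k * z l))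
        + (mm i - a) * (mm j - b) + (mm i - a) * (\<Sum>k<n. L j k * z k) + (mm j - b) * (\<Sum>k<n. L i k * z k)
        = (?X z i - a) * (?X z j - b)" for z
    proof -
      have "(\<Sum>k<n. \<Sum>l<n. L i k * L j l * (z k * z l)) = (\<Sum>k<n. L i k * z k) * (\<Sum>k<n. L j k * z k)"
        unfolding sum_product by (intro sum.cong) auto
      thus ?thesis using i j by (simp add: algebra_simps)
    qed
    ultimately show "has_bochner_integral (std_gauss n) (\<lambda>z. (?X z i - a) * (?X z j - b))
        (S i j + (mm i - a) * (mm j - b))" by simp
    show "(\<lambda>x. (x i - a) * (x j - b)) \<in> borel_measurable (lebn n)"
      using i j by (intro borel_measurable_times borel_measurable_diff coord_measurable) auto
  qed
qed

section \<open>B-splines\<close>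

lemma coeff_prod_linear_bound:
  fixes s :: "'i \<Rightarrow> real"
  assumes "finite I" "\<And>j. j \<in> I \<Longrightarrow> abs (s j) \<le> h" "l \<le> card I" "h \<ge> 0"
  shows "\<bar>coeff (\<Prod>j\<in>I. [:- s j, 1:]) (card I - l)\<bar> \<le> real (card I choose l) * h ^ l"
  using assms
proof (induction I arbitrary: l rule: finite_induct)
  case empty
  thus ?case by simp
next
  case (insert a I)
  let ?P = "\<Prod>j\<in>I. [:- s j, 1:]"
  let ?n = "card I"
  have prod: "(\<Prod>j\<in>insert a I. [:- s j, 1:]) = [:- s a, 1:] * ?P" using insert by simp
  have co: "coeff ([:- s a, 1:] * ?P) i = - s a * coeff ?P i + (if i = 0 then 0 else coeff ?P (i - 1))" for i
    by (cases i) (auto simp: coeff_pCons)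
  have IH: "l \<le> ?n \<Longrightarrow> \<bar>coeff ?P (?n - l)\<bar> \<le> real (?n choose l) * h ^ l" for l
    using insert by auto
  have sa: "abs (s a) \<le> h" using insert by auto
  have card: "card (insert a I) = Suc ?n" using insert by simp
  have deg: "degree ?P \<le> ?n"
    using degree_prod_sum_le[OF insert.hyps(1), of "\<lambda>j. [:- s j, 1:]"] by simp
  show ?case
  proof (cases l)
    case 0
    have "coeff ?P (Suc ?n) = 0" using deg by (intro coeff_eq_0) auto
    thus ?thesis using IH[of 0] unfolding prod card co by (simp add: 0)
  next
    case (Suc k)
    have t1: "\<bar>s a * coeff ?P (?n - k)\<bar> \<le> real (?n choose k) * h ^ l"
    proof -
      have "abs (s a) * \<bar>coeff ?P (?n - k)\<bar> \<le> h * (real (?n choose k) * h ^ k)"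
        using IH[of k] Suc insert.prems card sa by (intro mult_mono) auto
      thus ?thesis by (simp add: abs_mult Suc mult_ac)
    qed
    show ?thesis
    proof (cases "k = ?n")
      case True
      thus ?thesis using t1 unfolding prod card co by (simp add: Suc abs_mult)
    next
      case False
      hence k: "k < ?n" using Suc insert.prems card by auto
      have t2: "\<bar>coeff ?P (?n - l)\<bar> \<le> real (?n choose l) * h ^ l" using k Suc by (intro IH) auto
      have "\<bar>- s a * coeff ?P (?n - k) + coeff ?P (?n - l)\<bar> \<le> real (?n choose k) * h ^ l + real (?n choose l) * h ^ l"
        using t1 t2 by (simp add: abs_le_iff)
      also have "... = real (Suc ?n choose l) * h ^ l" by (simp add: Suc algebra_simps)
      finally show ?thesis using k Suc unfolding prod card co by simp
    qed
  qed
qed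

lemma knotvec_eq_ext_knot: "knotvec m K xi i = ext_knot K xi (i + 1 - m)"
  by (auto simp: knotvec_def ext_knot_def Suc_diff_le)

lemma borel_measurable_bspl [measurable]: "bspl tk q i \<in> borel_measurable borel"
proof (induction q arbitrary: i)
  case 0
  have "bspl tk 0 i = (\<lambda>x. 0)" by (rule ext) simp
  thus ?case by simp
next
  case (Suc q)
  show ?case
  proof (cases q)
    case 0
    have "bspl tk (Suc 0) i = (\<lambda>x. if (tk i \<le> x \<and> x < tk (Suc i)) \<or> (x = 1 \<and> tk i < 1 \<and> tk (Suc i) = 1) then 1 else 0)"
      by (rule ext) simp
    also have "... \<in> borel_measurable borel" by measurable
    finally show ?thesis using 0 by simp
  next
    case (Suc k)
    have [measurable]: "bspl tk (Suc k) i \<in> borel_measurable borel" for i using Suc.IH Suc by simp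
    have "bspl tk (Suc (Suc k)) i = (\<lambda>x. (x - tk i) / (tk (i + k + 1) - tk i) * bspl tk (Suc k) i x
        + (tk (i + k + 2) - x) / (tk (i + k + 2) - tk (Suc i)) * bspl tk (Suc k) (Suc i) x)"
      by (rule ext) simp
    also have "... \<in> borel_measurable borel" by measurable
    finally show ?thesis using Suc by simp
  qed
qed

locale spline_knots =
  fixes m K :: nat and xi :: "nat \<Rightarrow> real"
  assumes m_pos: "1 \<le> m"
    and knots_incr: "\<And>i. i \<le> K \<Longrightarrow> ext_knot K xi i < ext_knot K xi (Suc i)"
begin

abbreviation tk :: "nat \<Rightarrow> real" where "tk \<equiv> knotvec m K xi"

abbreviation Bs :: "nat \<Rightarrow> real \<Rightarrow> real" where "Bs \<equiv> bspl tk m"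

lemma tk_mono: "i \<le> j \<Longrightarrow> tk i \<le> tk j"
proof (rule lift_Suc_mono_le[of tk])
  fix n
  have e: "ext_knot K xi i \<le> ext_knot K xi (Suc i)" for i
    using knots_incr[of i] by (cases "i \<le> K") (auto simp: ext_knot_def)
  show "tk n \<le> tk (Suc n)"
    unfolding knotvec_eq_ext_knot using e[of "n + 1 - m"] m_pos
    by (cases "n + 1 \<ge> m") (auto simp: Suc_diff_le)
qed

lemma tk_eq_0: "i < m \<Longrightarrow> tk i = 0" and tk_eq_1: "i \<ge> K + m \<Longrightarrow> tk i = 1"
  by (auto simp: knotvec_def)

lemma tk_less_Suc: "m - 1 \<le> j \<Longrightarrow> j < K + m \<Longrightarrow> tk j < tk (Suc j)"
  unfolding knotvec_eq_ext_knot using knots_incr[of "j + 1 - m"] m_pos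
  by (auto simp: Suc_diff_le)

lemma tk_nonneg: "0 \<le> tk i" and tk_le_1: "tk i \<le> 1"
proof -
  show "0 \<le> tk i" using tk_mono[of 0 i] tk_eq_0[of 0] m_pos by simp
  show "tk i \<le> 1" using tk_mono[of i "i + (K + m)"] tk_eq_1[of "i + (K + m)"] by simp
qed

lemma bspl_nonneg_support:
  assumes "x < 1"
  shows "0 \<le> bspl tk q i x \<and> (bspl tk q i x \<noteq> 0 \<longrightarrow> tk i \<le> x \<and> x < tk (i + q))"
proof (induction q arbitrary: i)
  case 0
  show ?case by simp
next
  case (Suc q)
  show ?case
  proof (cases q)
    case 0
    thus ?thesis using assms by auto
  next
    case (Suc k)
    let ?W = "\<lambda>i. bspl tk (Suc k) i x"
    have W: "0 \<le> ?W i" "?W i \<noteq> 0 \<Longrightarrow> tk i \<le> x \<and> x < tk (i + Suc k)" for i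
      using Suc.IH[of i] Suc by auto
    have a: "0 \<le> (x - tk i) / (tk (i + k + 1) - tk i) * ?W i"
      using W[of i] by (cases "?W i = 0") auto
    have b: "0 \<le> (tk (i + k + 2) - x) / (tk (i + k + 2) - tk (Suc i)) * ?W (Suc i)"
      using W[of "Suc i"] by (cases "?W (Suc i) = 0") auto
    have "tk i \<le> x \<and> x < tk (i + Suc q)" if "?W i \<noteq> 0 \<or> ?W (Suc i) \<noteq> 0"
      using that W(2)[of i] W(2)[of "Suc i"] tk_mono[of i "Suc i"] tk_mono[of "i + Suc k" "i + Suc q"] Suc
      by auto
    moreover have "?W i \<noteq> 0 \<or> ?W (Suc i) \<noteq> 0" if "bspl tk (Suc q) i x \<noteq> 0" using that Suc by auto
    moreover have "0 \<le> bspl tk (Suc q) i x" using a b Suc by simp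
    ultimately show ?thesis by blast
  qed
qed

lemmas bspl_nonneg = bspl_nonneg_support[THEN conjunct1]
lemmas bspl_support = bspl_nonneg_support[THEN conjunct2, rule_format]

lemma bspl_pos:
  assumes x: "tk j < x" "x < tk (Suc j)" and "i \<le> j" "j < i + q"
  shows "0 < bspl tk q i x"
  using assms(3,4)
proof (induction q arbitrary: i)
  case 0
  thus ?case by simp
next
  case (Suc q)
  have x1: "x < 1" using x tk_le_1[of "Suc j"] by simp
  show ?case
  proof (cases q)
    case 0
    hence "i = j" using Suc.prems by simp
    thus ?thesis using 0 x by simp
  next
    case (Suc k)
    let ?W = "\<lambda>i. bspl tk (Suc k) i x"
    have lo: "tk l < x" if "l \<le> j" for l using tk_mono[OF that] x by simp
    have hi: "x < tk l" if "j < l" for l using tk_mono[of "Suc j" l] that x by simp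
    have W: "0 \<le> ?W i" "?W i \<noteq> 0 \<Longrightarrow> tk i \<le> x \<and> x < tk (i + Suc k)" for i
      using bspl_nonneg[OF x1, of "Suc k" i] bspl_support[OF x1, of "Suc k" i] by auto
    have a: "0 \<le> (x - tk i) / (tk (i + k + 1) - tk i) * ?W i"
      using W[of i] by (cases "?W i = 0") auto
    have b: "0 \<le> (tk (i + k + 2) - x) / (tk (i + k + 2) - tk (Suc i)) * ?W (Suc i)"
      using W[of "Suc i"] by (cases "?W (Suc i) = 0") auto
    show ?thesis
    proof (cases "j < i + q")
      case True
      hence "0 < ?W i" using Suc.IH[of i] Suc.prems Suc by simp
      hence "0 < (x - tk i) / (tk (i + k + 1) - tk i) * ?W i"
        using lo[of i] hi[of "i + k + 1"] Suc.prems True Suc by auto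
      thus ?thesis using b Suc by simp
    next
      case False
      hence "0 < ?W (Suc i)" using Suc.IH[of "Suc i"] Suc.prems Suc by simp
      hence "0 < (tk (i + k + 2) - x) / (tk (i + k + 2) - tk (Suc i)) * ?W (Suc i)"
        using lo[of "Suc i"] hi[of "i + k + 2"] Suc.prems False Suc by auto
      thus ?thesis using a Suc by simp
    qed
  qed
qed

lemma marsden:
  assumes x: "0 \<le> x" "x < 1" and q: "Suc k \<le> m"
  shows "(\<Sum>i<K + m. (\<Prod>j=1..<Suc k. z - tk (i + j)) * bspl tk (Suc k) i x) = (z - x) ^ k"
  using q
proof (induction k)
  case 0
  have "(\<Sum>i<n. bspl tk (Suc 0) i x) = (if x < tk n then 1 else 0)" for n
  proof (induction n)
    case 0
    show ?case using x tk_nonneg[of 0] tk_eq_0[of 0] m_pos by simp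
  next
    case (Suc n)
    thus ?case using x tk_mono[of n "Suc n"] by auto
  qed
  thus ?case using x tk_eq_1[of "K + m"] by simp
next
  case (Suc k)
  let ?N = "K + m"
  let ?W = "\<lambda>i. bspl tk (Suc k) i x"
  define a where "a i = (x - tk i) / (tk (i + k + 1) - tk i)" for i
  define b where "b i = (tk (i + k + 1) - x) / (tk (i + k + 1) - tk i)" for i
  define ps where "ps i = (\<Prod>j=1..<Suc k. z - tk (i + j))" for i
  define Ps where "Ps i = (\<Prod>j=1..<Suc (Suc k). z - tk (i + j))" for i
  have Ps1: "Ps i = ps i * (z - tk (i + k + 1))" for i
    unfolding Ps_def ps_def by (subst prod.atLeastLessThan_Suc) auto
  have Ps2: "Ps i = (z - tk (Suc i)) * ps (Suc i)" for i
  proof -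
    have "Ps i = (\<Prod>j=0..<Suc k. z - tk (i + Suc j))"
      unfolding Ps_def by (subst prod.shift_bounds_Suc_ivl[symmetric]) simp
    also have "... = (z - tk (Suc i)) * (\<Prod>j=1..<Suc k. z - tk (i + Suc j))"
      by (subst prod.atLeast_Suc_lessThan) auto
    finally show ?thesis by (simp add: ps_def)
  qed
  have W0: "?W 0 = 0" using bspl_support[OF x(2), of "Suc k" 0] tk_eq_0[of "Suc k"] Suc.prems x by force
  have WN: "?W ?N = 0" using bspl_support[OF x(2), of "Suc k" ?N] tk_eq_1[of ?N] x by force
  have rec: "bspl tk (Suc (Suc k)) i x = a i * ?W i + b (Suc i) * ?W (Suc i)" for i
    by (simp add: a_def b_def)
  have shift: "(\<Sum>i<?N. Ps i * b (Suc i) * ?W (Suc i)) = (\<Sum>i<?N. (z - tk i) * ps i * b i * ?W i)"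
  proof -
    have "(\<Sum>i<?N. Ps i * b (Suc i) * ?W (Suc i)) = (\<Sum>i<?N. (z - tk (Suc i)) * ps (Suc i) * b (Suc i) * ?W (Suc i))"
      by (simp add: Ps2)
    also have "... = (\<Sum>i<Suc ?N. (z - tk i) * ps i * b i * ?W i) - (z - tk 0) * ps 0 * b 0 * ?W 0"
      unfolding sum.lessThan_Suc_shift[of _ ?N] by simp
    also have "... = (\<Sum>i<?N. (z - tk i) * ps i * b i * ?W i)" by (simp add: W0 WN)
    finally show ?thesis .
  qed
  have "(\<Sum>i<?N. Ps i * bspl tk (Suc (Suc k)) i x)
      = (\<Sum>i<?N. Ps i * a i * ?W i) + (\<Sum>i<?N. Ps i * b (Suc i) * ?W (Suc i))"
    unfolding rec by (simp add: algebra_simps sum.distrib)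
  also have "... = (\<Sum>i<?N. (Ps i * a i + (z - tk i) * ps i * b i) * ?W i)"
    unfolding shift by (simp add: algebra_simps flip: sum.distrib)
  also have "... = (\<Sum>i<?N. (z - x) * (ps i * ?W i))"
  proof (rule sum.cong)
    fix i
    show "(Ps i * a i + (z - tk i) * ps i * b i) * ?W i = (z - x) * (ps i * ?W i)"
    proof (cases "?W i = 0")
      case False
      hence ne: "tk (i + k + 1) - tk i \<noteq> 0" using bspl_support[OF x(2), of "Suc k" i] by auto
      define d where "d = tk (i + k + 1) - tk i"
      have "(z - tk (i + k + 1)) * ((x - tk i) / d) + (z - tk i) * ((tk (i + k + 1) - x) / d)
          = ((z - tk (i + k + 1)) * (x - tk i) + (z - tk i) * (tk (i + k + 1) - x)) / d"
        by (simp add: add_divide_distrib)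
      also have "(z - tk (i + k + 1)) * (x - tk i) + (z - tk i) * (tk (i + k + 1) - x) = (z - x) * d"
        by (simp add: d_def algebra_simps)
      finally have "(z - tk (i + k + 1)) * a i + (z - tk i) * b i = z - x"
        using ne by (simp add: a_def b_def d_def)
      moreover have "Ps i * a i + (z - tk i) * ps i * b i
          = ps i * ((z - tk (i + k + 1)) * a i + (z - tk i) * b i)"
        unfolding Ps1 by (simp add: algebra_simps)
      ultimately show ?thesis by simp
    qed simp
  qed simp
  also have "... = (z - x) * (\<Sum>i<?N. ps i * ?W i)" by (simp add: sum_distrib_left)
  also have "... = (z - x) * (z - x) ^ k" using Suc unfolding ps_def by simp
  finally show ?case by (simp add: Ps_def)
qed

text \<open>The coefficient of \<open>(x - a)^l\<close> in the B-spline basis, read off from Marsden's identity.\<close>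

definition cf :: "nat \<Rightarrow> nat \<Rightarrow> real \<Rightarrow> real" where
  "cf k l a = (-1) ^ l * coeff (\<Prod>j=1..<m. [:- (tk (k + j) - a), 1:]) (m - 1 - l) / real (m - 1 choose l)"

lemma power_eq_spline:
  assumes x: "0 \<le> x" "x < 1" and l: "l < m"
  shows "(x - a) ^ l = (\<Sum>k<K + m. cf k l a * Bs k x)"
proof -
  let ?P = "\<lambda>k. \<Prod>j=1..<m. [:- (tk (k + j) - a), 1:]"
  have "poly (\<Sum>k<K + m. Polynomial.smult (Bs k x) (?P k)) = poly ([:- (x - a), 1:] ^ (m - 1))"
  proof
    fix z
    have "poly (\<Sum>k<K + m. Polynomial.smult (Bs k x) (?P k)) z = (\<Sum>k<K + m. (\<Prod>j=1..<m. (z + a) - tk (k + j)) * Bs k x)"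
      by (simp add: poly_sum poly_prod mult_ac algebra_simps)
    also have "... = ((z + a) - x) ^ (m - 1)"
      using marsden[OF x, of "m - 1" "z + a"] m_pos by simp
    finally show "poly (\<Sum>k<K + m. Polynomial.smult (Bs k x) (?P k)) z = poly ([:- (x - a), 1:] ^ (m - 1)) z"
      by (simp add: algebra_simps)
  qed
  hence "(\<Sum>k<K + m. Polynomial.smult (Bs k x) (?P k)) = [:- (x - a), 1:] ^ (m - 1)"
    by (simp add: poly_eq_poly_eq_iff)
  hence *: "coeff (\<Sum>k<K + m. Polynomial.smult (Bs k x) (?P k)) (m - 1 - l) = coeff ([:- (x - a), 1:] ^ (m - 1)) (m - 1 - l)"
    by simp
  have "(\<Sum>k<K + m. Bs k x * coeff (?P k) (m - 1 - l)) = coeff (\<Sum>k<K + m. Polynomial.smult (Bs k x) (?P k)) (m - 1 - l)"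
    by (simp add: coeff_sum)
  also note *
  also have "coeff ([:- (x - a), 1:] ^ (m - 1)) (m - 1 - l) = real (m - 1 choose l) * (- (x - a)) ^ l"
    using l binomial_symmetric[of l "m - 1"] by (subst coeff_linear_poly_power) auto
  also have "(- (x - a)) ^ l = (-1) ^ l * (x - a) ^ l" by (rule power_minus)
  finally have "(\<Sum>k<K + m. Bs k x * coeff (?P k) (m - 1 - l)) = real (m - 1 choose l) * ((-1) ^ l * (x - a) ^ l)" .
  moreover have "real (m - 1 choose l) \<noteq> 0" using l by simp
  moreover have "(\<Sum>k<K + m. cf k l a * Bs k x) =
      (-1) ^ l * (\<Sum>k<K + m. Bs k x * coeff (?P k) (m - 1 - l)) / real (m - 1 choose l)"
    unfolding cf_def by (simp add: sum_distrib_left sum_divide_distrib mult_ac)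
  moreover have "(-1::real) ^ l * (-1) ^ l = 1" by (simp flip: power_mult_distrib)
  ultimately show ?thesis by simp
qed

lemma partition_of_unity: "0 \<le> x \<Longrightarrow> x < 1 \<Longrightarrow> (\<Sum>k<K + m. Bs k x) = 1"
proof -
  assume x: "0 \<le> x" "x < 1"
  have "coeff (\<Prod>j=1..<m. [:- (tk (k + j) - a), 1:]) (m - 1) = 1" for k a
    using lead_coeff_prod[of "\<lambda>j. [:- (tk (k + j) - a), 1:]" "{1..<m}"]
      degree_prod_eq_sum_degree[of "{1..<m}" "\<lambda>j. [:- (tk (k + j) - a), 1:]"] by simp
  hence "cf k 0 a = 1" for k a by (simp add: cf_def)
  thus ?thesis using power_eq_spline[OF x, of 0 0] m_pos by simp
qed

lemma cf_bound:
  assumes l: "l < m" and h: "\<And>j. 1 \<le> j \<Longrightarrow> j < m \<Longrightarrow> abs (tk (k + j) - a) \<le> h" "0 \<le> h"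
  shows "abs (cf k l a) \<le> h ^ l"
proof -
  have c: "card {1..<m} = m - 1" by simp
  have "\<bar>coeff (\<Prod>j=1..<m. [:- (tk (k + j) - a), 1:]) (m - 1 - l)\<bar> \<le> real (m - 1 choose l) * h ^ l"
    using coeff_prod_linear_bound[of "{1..<m}" "\<lambda>j. tk (k + j) - a" h l] h l unfolding c by auto
  moreover have "real (m - 1 choose l) > 0" using l by simp
  ultimately show ?thesis unfolding cf_def by (simp add: abs_mult field_simps)
qed

lemma bspl_bounds_at_0:
  assumes "1 \<le> q" "m \<le> i + q" "i < m"
  shows "\<exists>al>0. \<exists>be>0. \<forall>x. 0 < x \<longrightarrow> x \<le> tk m / 2 \<longrightarrow>
    al * x ^ (i + q - m) \<le> bspl tk q i x \<and> bspl tk q i x \<le> be * x ^ (i + q - m)"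
  using assms
proof (induction q arbitrary: i)
  case 0
  thus ?case by simp
next
  case (Suc q)
  have tm: "0 < tk m" using tk_less_Suc[of "m - 1"] m_pos tk_eq_0[of "m - 1"] by simp
  have tm1: "tk m \<le> 1" by (rule tk_le_1)
  have ti: "tk i = 0" using Suc.prems tk_eq_0 by simp
  show ?case
  proof (cases q)
    case 0
    hence i: "i = m - 1" using Suc.prems by auto
    have "bspl tk (Suc 0) i x = 1" if "0 < x" "x \<le> tk m / 2" for x
      using that tm tm1 ti i m_pos by simp
    thus ?thesis using 0 i m_pos by (intro exI[of _ 1] conjI) auto
  next
    case (Suc k)
    have rec: "bspl tk (Suc q) i x = x / tk (i + q) * bspl tk q i x
       + (tk (i + q + 1) - x) / (tk (i + q + 1) - tk (Suc i)) * bspl tk q (Suc i) x" for x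
      using Suc ti by simp
    have pos: "0 < tk l" if "m \<le> l" for l using tk_mono[OF that] tm by simp
    have q1: "1 \<le> q" using Suc by simp
    let ?w = "\<lambda>x. (tk (i + q + 1) - x) / (tk (i + q + 1) - tk (Suc i))"
    have ub: "?w x \<le> 1"
      "1 / 2 \<le> ?w x" if "Suc i < m" "0 < x" "x \<le> tk m / 2" for x
    proof -
      have t: "tk m \<le> tk (i + q + 1)" using Suc.prems by (intro tk_mono) auto
      show "?w x \<le> 1"
        using t tm that tk_eq_0[OF that(1)] by simp
      show "1 / 2 \<le> ?w x"
        using t tm that tk_eq_0[OF that(1)] by (simp add: field_simps)
    qed
    show ?thesis
    proof (cases "i + q = m - 1")
      case True
      have si: "Suc i < m" using True q1 m_pos by auto
      obtain al be where ab: "al > 0" "be > 0" "\<And>x. 0 < x \<Longrightarrow> x \<le> tk m / 2 \<Longrightarrow>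
          al * x ^ (Suc i + q - m) \<le> bspl tk q (Suc i) x \<and> bspl tk q (Suc i) x \<le> be * x ^ (Suc i + q - m)"
        using Suc.IH[OF q1, of "Suc i"] si Suc.prems by auto
      have e: "Suc i + q - m = 0" "i + Suc q - m = 0" using True m_pos by auto
      have "al / 2 \<le> bspl tk (Suc q) i x \<and> bspl tk (Suc q) i x \<le> be" if x: "0 < x" "x \<le> tk m / 2" for x
      proof -
        have z: "tk (i + q) = 0" using True tk_eq_0[of "i + q"] m_pos by simp
        have b: "bspl tk (Suc q) i x = ?w x * bspl tk q (Suc i) x" unfolding rec z by simp
        have B: "al \<le> bspl tk q (Suc i) x" "bspl tk q (Suc i) x \<le> be" using ab(3)[OF x] e by auto
        have w0: "0 \<le> ?w x" using ub(2)[OF si x] by linarith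
        have "1/2 * al \<le> ?w x * bspl tk q (Suc i) x" using B ub(2)[OF si x] w0 ab(1) by (intro mult_mono) linarith+
        moreover have "?w x * bspl tk q (Suc i) x \<le> 1 * be" using B ub(1)[OF si x] ab(1) by (intro mult_mono) linarith+
        ultimately show ?thesis unfolding b by simp
      qed
      thus ?thesis using ab(1,2) unfolding e by (intro exI[of _ "al / 2"] conjI exI[of _ be]) auto
    next
      case False
      hence iq: "m \<le> i + q" using Suc.prems by auto
      obtain al be where ab: "al > 0" "be > 0" "\<And>x. 0 < x \<Longrightarrow> x \<le> tk m / 2 \<Longrightarrow>
          al * x ^ (i + q - m) \<le> bspl tk q i x \<and> bspl tk q i x \<le> be * x ^ (i + q - m)"
        using Suc.IH[OF q1 iq] Suc.prems by auto
      have e: "i + Suc q - m = Suc (i + q - m)" "Suc i + q - m = Suc (i + q - m)" using iq by auto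
      have tq: "0 < tk (i + q)" using pos[OF iq] .
      obtain ga where g: "ga > 0" "\<And>x. 0 < x \<Longrightarrow> x \<le> tk m / 2 \<Longrightarrow>
          0 \<le> ?w x * bspl tk q (Suc i) x \<and>
          ?w x * bspl tk q (Suc i) x \<le> ga * x ^ Suc (i + q - m)"
      proof (cases "Suc i < m")
        case True
        obtain al' be' where ab': "al' > 0" "be' > 0" "\<And>x. 0 < x \<Longrightarrow> x \<le> tk m / 2 \<Longrightarrow>
            al' * x ^ (Suc i + q - m) \<le> bspl tk q (Suc i) x \<and> bspl tk q (Suc i) x \<le> be' * x ^ (Suc i + q - m)"
          using Suc.IH[OF q1, of "Suc i"] True iq by auto
        show thesis
        proof (rule that[of be'])
          show "be' > 0" by (rule ab')
          fix x :: real assume x: "0 < x" "x \<le> tk m / 2"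
          have B: "bspl tk q (Suc i) x \<le> be' * x ^ Suc (i + q - m)" using ab'(3)[OF x] e by simp
          have B0: "0 \<le> bspl tk q (Suc i) x" using x tm1 by (intro bspl_nonneg) auto
          have "?w x * bspl tk q (Suc i) x \<le> 1 * (be' * x ^ Suc (i + q - m))"
            using B B0 ub(1)[OF True x] by (intro mult_mono) linarith+
          moreover have "0 \<le> ?w x * bspl tk q (Suc i) x"
            using B0 ub(2)[OF True x] by (intro mult_nonneg_nonneg) linarith+
          ultimately show "0 \<le> ?w x * bspl tk q (Suc i) x \<and> ?w x * bspl tk q (Suc i) x \<le> be' * x ^ Suc (i + q - m)"
            by simp
        qed
      next
        case False
        hence "Suc i = m" using Suc.prems by simp
        hence "bspl tk q (Suc i) x = 0" if "0 < x" "x \<le> tk m / 2" for x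
          using bspl_support[of x q "Suc i"] that tm tm1 by force
        thus thesis by (intro that[of 1]) auto
      qed
      have "al / tk (i + q) * x ^ Suc (i + q - m) \<le> bspl tk (Suc q) i x \<and>
          bspl tk (Suc q) i x \<le> (be / tk (i + q) + ga) * x ^ Suc (i + q - m)" if x: "0 < x" "x \<le> tk m / 2" for x
      proof -
        have "x / tk (i + q) * (al * x ^ (i + q - m)) \<le> x / tk (i + q) * bspl tk q i x"
          using ab(3)[OF x] x tq by (intro mult_left_mono) auto
        moreover have "x / tk (i + q) * bspl tk q i x \<le> x / tk (i + q) * (be * x ^ (i + q - m))"
          using ab(3)[OF x] x tq by (intro mult_left_mono) auto
        ultimately show ?thesis using g(2)[OF x] unfolding rec by (simp add: algebra_simps)
      qed
      moreover have "0 < al / tk (i + q)" "0 < be / tk (i + q) + ga"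
        using ab(1,2) g(1) tq by (auto intro!: add_pos_pos)
      ultimately show ?thesis unfolding e by blast
    qed
  qed
qed

text \<open>The first nonzero coefficient is isolated on the interval where its B-spline starts; the \<open>m\<close>
  B-splines starting at 0 are separated by their order of vanishing there.\<close>

lemma bspl_lin_indep:
  assumes dense: "\<And>a b. 0 \<le> a \<Longrightarrow> a < b \<Longrightarrow> b \<le> 1 \<Longrightarrow> \<exists>x. a < x \<and> x < b \<and> (\<Sum>k<K + m. c k * Bs k x) = 0"
    and "k < K + m"
  shows "c k = 0"
  using assms(2)
proof (induction k rule: less_induct)
  case (less i)
  have zero: "c k = 0" if "k < i" for k using less that by simp
  show ?case
  proof (cases "m - 1 \<le> i")
    case True
    have "tk i < tk (Suc i)" using tk_less_Suc True less.prems by simp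
    then obtain x where x: "tk i < x" "x < tk (Suc i)" "(\<Sum>k<K + m. c k * Bs k x) = 0"
      using dense[of "tk i" "tk (Suc i)"] tk_nonneg tk_le_1 by blast
    have x1: "x < 1" using x tk_le_1[of "Suc i"] by simp
    have "(\<Sum>k<K + m. c k * Bs k x) = (\<Sum>k\<in>{i}. c k * Bs k x)"
    proof (rule sum.mono_neutral_right)
      show "\<forall>k\<in>{..<K + m} - {i}. c k * Bs k x = 0"
      proof
        fix k assume k: "k \<in> {..<K + m} - {i}"
        show "c k * Bs k x = 0"
        proof (cases "k < i")
          case False
          hence "x < tk k" using k x tk_mono[of "Suc i" k] by auto
          thus ?thesis using bspl_support[OF x1, of m k] by force
        qed (simp add: zero)
      qed
    qed (use less.prems in auto)
    moreover have "0 < Bs i x" using x m_pos by (intro bspl_pos[of i]) auto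
    ultimately show ?thesis using x(3) by simp
  next
    case False
    have tm: "0 < tk m" using tk_less_Suc[of "m - 1"] m_pos tk_eq_0[of "m - 1"] by simp
    have tm1: "tk m \<le> 1" by (rule tk_le_1)
    have im: "i < m" using False by simp
    obtain al where ai: "al > 0" "\<And>x. 0 < x \<Longrightarrow> x \<le> tk m / 2 \<Longrightarrow> al * x ^ i \<le> Bs i x"
      using bspl_bounds_at_0[OF m_pos _ im] by auto
    have "\<exists>be. \<forall>x. 0 < x \<longrightarrow> x \<le> tk m / 2 \<longrightarrow> abs (c k * Bs k x) \<le> be * x ^ Suc i" if k: "k \<noteq> i" for k
    proof -
      consider "k < i" | "i < k" "k < m" | "m \<le> k" using k by linarith
      thus ?thesis
      proof cases
        case 1 thus ?thesis by (intro exI[of _ 0]) (simp add: zero)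
      next
        case 2
        obtain be where b: "be > 0" "\<And>x. 0 < x \<Longrightarrow> x \<le> tk m / 2 \<Longrightarrow> Bs k x \<le> be * x ^ k"
          using bspl_bounds_at_0[OF m_pos _ 2(2)] by auto
        have "abs (c k * Bs k x) \<le> (abs (c k) * be) * x ^ Suc i" if x: "0 < x" "x \<le> tk m / 2" for x
        proof -
          have "0 \<le> Bs k x" using x tm1 by (intro bspl_nonneg) auto
          moreover have "x ^ k \<le> x ^ Suc i" using x tm1 2 by (intro power_decreasing) auto
          hence "be * x ^ k \<le> be * x ^ Suc i" using b by (intro mult_left_mono) auto
          ultimately have "abs (Bs k x) \<le> be * x ^ Suc i" using b(2)[OF x] by simp
          hence "abs (c k) * abs (Bs k x) \<le> abs (c k) * (be * x ^ Suc i)" by (intro mult_left_mono) auto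
          thus ?thesis by (simp add: abs_mult mult_ac)
        qed
        thus ?thesis by blast
      next
        case 3
        have "Bs k x = 0" if "0 < x" "x \<le> tk m / 2" for x
          using bspl_support[of x m k] tk_mono[OF 3] that tm tm1 by force
        thus ?thesis by (intro exI[of _ 0]) simp
      qed
    qed
    then obtain be where b: "\<And>k x. k \<noteq> i \<Longrightarrow> 0 < x \<Longrightarrow> x \<le> tk m / 2 \<Longrightarrow> abs (c k * Bs k x) \<le> be k * x ^ Suc i"
      by metis
    define S where "S = (\<Sum>k\<in>{..<K + m} - {i}. be k)"
    have key: "abs (c i) * al \<le> S * x" if x: "0 < x" "x \<le> tk m / 2" "(\<Sum>k<K + m. c k * Bs k x) = 0" for x
    proof -
      have "(\<Sum>k<K + m. c k * Bs k x) = c i * Bs i x + (\<Sum>k\<in>{..<K + m} - {i}. c k * Bs k x)"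
        using less.prems by (intro sum.remove) auto
      hence "abs (c i * Bs i x) = \<bar>\<Sum>k\<in>{..<K + m} - {i}. c k * Bs k x\<bar>" using x(3) by simp
      also have "... \<le> (\<Sum>k\<in>{..<K + m} - {i}. be k * x ^ Suc i)"
        using b x by (intro order_trans[OF sum_abs] sum_mono) auto
      also have "... = S * x ^ Suc i" by (simp only: S_def sum_distrib_right)
      finally have 1: "abs (c i * Bs i x) \<le> S * x ^ Suc i" .
      have "abs (c i) * (al * x ^ i) \<le> abs (c i) * abs (Bs i x)"
        using ai(2)[OF x(1,2)] by (intro mult_left_mono) auto
      hence "(abs (c i) * al) * x ^ i \<le> (S * x) * x ^ i" using 1 by (simp add: abs_mult mult_ac)
      thus ?thesis using x(1) by (simp add: mult_le_cancel_right)
    qed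
    show ?thesis
    proof (rule ccontr)
      assume "c i \<noteq> 0"
      hence ca: "0 < abs (c i) * al" using ai(1) by simp
      define e where "e = min (tk m / 2) (abs (c i) * al / (abs S + 1))"
      have e: "0 < e" "e \<le> 1" using tm tm1 ca by (auto simp: e_def)
      obtain x where x: "0 < x" "x < e" "(\<Sum>k<K + m. c k * Bs k x) = 0" using dense[of 0 e] e by auto
      have "abs (c i) * al \<le> S * x" using x by (intro key) (auto simp: e_def)
      also have "... \<le> (abs S + 1) * x" using x by (intro mult_right_mono) auto
      also have "... < (abs S + 1) * (abs (c i) * al / (abs S + 1))"
        using x by (intro mult_strict_left_mono) (auto simp: e_def)
      finally show False by simp
    qed
  qed
qed

text \<open>Linear independence makes the coefficients of a polynomial independent of the expansion point.\<close>

lemma cf_recenter: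
  assumes l: "l < m" and k: "k < K + m"
  shows "cf k l a = (\<Sum>i\<le>l. real (l choose i) * (b - a) ^ (l - i) * cf k i b)"
proof -
  define c where "c k = cf k l a - (\<Sum>i\<le>l. real (l choose i) * (b - a) ^ (l - i) * cf k i b)" for k
  have "(\<Sum>k<K + m. c k * Bs k x) = 0" if x: "0 \<le> x" "x < 1" for x
  proof -
    have "(\<Sum>k<K + m. c k * Bs k x) = (\<Sum>k<K + m. cf k l a * Bs k x)
        - (\<Sum>k<K + m. \<Sum>i\<le>l. real (l choose i) * (b - a) ^ (l - i) * (cf k i b * Bs k x))"
      by (simp add: c_def left_diff_distrib sum_subtractf sum_distrib_right mult.assoc)
    also have "(\<Sum>k<K + m. \<Sum>i\<le>l. real (l choose i) * (b - a) ^ (l - i) * (cf k i b * Bs k x))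
        = (\<Sum>i\<le>l. real (l choose i) * (b - a) ^ (l - i) * (\<Sum>k<K + m. cf k i b * Bs k x))"
      unfolding sum_distrib_left by (rule sum.swap)
    also have "... = (\<Sum>i\<le>l. real (l choose i) * (x - b) ^ i * (b - a) ^ (l - i))"
      using l power_eq_spline[OF x] by (intro sum.cong) auto
    also have "... = ((x - b) + (b - a)) ^ l" by (rule binomial_ring[symmetric])
    finally show ?thesis using power_eq_spline[OF x l, of a] by simp
  qed
  hence "\<exists>x. u < x \<and> x < v \<and> (\<Sum>k<K + m. c k * Bs k x) = 0" if "0 \<le> u" "u < v" "v \<le> 1" for u v
    using that dense[of u v] by (metis less_eq_real_def less_le_trans order.strict_trans)
  from bspl_lin_indep[OF this k] show ?thesis by (simp add: c_def)
qed

end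

section \<open>Local Taylor polynomials of vector functions\<close>

lemma vnorm_eq_L2_set: "vnorm p v = L2_set v {..<p}"
  by (simp add: vnorm_def L2_set_def)

lemma vnorm_nonneg [simp]: "0 \<le> vnorm p v"
  by (simp add: vnorm_eq_L2_set L2_set_nonneg)

lemma vnorm_cong: "(\<And>j. j < p \<Longrightarrow> v j = w j) \<Longrightarrow> vnorm p v = vnorm p w"
  by (simp add: vnorm_def)

lemma vnorm_sq: "(vnorm p v)^2 = sqn p v"
  unfolding vnorm_def by (simp add: sum_nonneg)

lemma vnorm_add: "vnorm p (\<lambda>j. v j + w j) \<le> vnorm p v + vnorm p w"
  unfolding vnorm_eq_L2_set by (rule L2_set_triangle_ineq)

lemma vnorm_scale: "vnorm p (\<lambda>j. c * v j) = abs c * vnorm p v"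
proof -
  have "(\<Sum>j<p. (c * v j)^2) = c^2 * sqn p v" by (simp add: power_mult_distrib sum_distrib_left)
  thus ?thesis by (simp add: vnorm_def real_sqrt_mult)
qed

lemma vnorm_diff: "vnorm p (\<lambda>j. v j - w j) \<le> vnorm p v + vnorm p w"
  using vnorm_add[of p v "\<lambda>j. -1 * w j"] vnorm_scale[of p "-1" w] by simp

lemma vnorm_zero [simp]: "vnorm p (\<lambda>j. 0) = 0"
  by (simp add: vnorm_def)

lemma vnorm_sum: "finite I \<Longrightarrow> vnorm p (\<lambda>j. \<Sum>i\<in>I. f i j) \<le> (\<Sum>i\<in>I. vnorm p (f i))"
proof (induction I rule: finite_induct)
  case (insert a I)
  thus ?case using vnorm_add[of p "f a" "\<lambda>j. \<Sum>i\<in>I. f i j"] by simp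
qed simp

lemma vnorm_1: "vnorm 1 v = abs (v 0)"
  by (simp add: vnorm_def)

lemma vnorm_cauchy_schwarz: "\<bar>\<Sum>j<p. v j * w j\<bar> \<le> vnorm p v * vnorm p w"
  unfolding vnorm_eq_L2_set
  by (rule order_trans[OF sum_abs]) (simp add: abs_mult L2_set_mult_ineq)

lemma vnorm_le_sqrt:
  assumes "\<And>j. j < p \<Longrightarrow> abs (v j) \<le> c" "0 \<le> c"
  shows "vnorm p v \<le> sqrt (real p) * c"
proof -
  have "sqn p v \<le> (\<Sum>j<p. c^2)"
    using assms by (intro sum_mono) (auto simp: abs_le_square_iff[symmetric])
  hence "vnorm p v \<le> sqrt (real p * c^2)" unfolding vnorm_def by simp
  thus ?thesis using assms(2) by (simp add: real_sqrt_mult)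
qed

abbreviation vpoly :: "nat \<Rightarrow> (nat \<Rightarrow> nat \<Rightarrow> real) \<Rightarrow> real \<Rightarrow> nat \<Rightarrow> real" where
  "vpoly t a x j \<equiv> \<Sum>l\<le>t. a l j * x ^ l"

text \<open>Induction on the degree: \<open>2^(t+1) P(x/2) - P(x)\<close> has degree at most \<open>t\<close>.\<close>

lemma vpoly_coeff_bound:
  "\<exists>C\<ge>0. \<forall>p (a :: nat \<Rightarrow> nat \<Rightarrow> real) B.
     (\<forall>x\<in>{0..1}. vnorm p (\<lambda>j. vpoly t a x j) \<le> B) \<longrightarrow> (\<forall>l\<le>t. vnorm p (a l) \<le> C * B)"
proof (induction t)
  case 0
  have "vnorm p (a 0) \<le> B" if "\<forall>x\<in>{0..1::real}. vnorm p (\<lambda>j. \<Sum>l\<le>0. a l j * x ^ l) \<le> B"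
    for p B and a :: "nat \<Rightarrow> nat \<Rightarrow> real"
    using bspec[OF that, of 0] by simp
  thus ?case by (intro exI[of _ 1]) auto
next
  case (Suc t)
  then obtain C where C: "C \<ge> 0" "\<And>p (a :: nat \<Rightarrow> nat \<Rightarrow> real) B l.
     (\<forall>x\<in>{0..1}. vnorm p (\<lambda>j. vpoly t a x j) \<le> B) \<Longrightarrow> l \<le> t \<Longrightarrow> vnorm p (a l) \<le> C * B"
    by blast
  define C1 where "C1 = C * (2 ^ Suc t + 1)"
  have C1: "C1 \<ge> 0" using C by (simp add: C1_def)
  have "vnorm p (a l) \<le> (1 + (real t + 1) * C1) * B"
    if P: "\<forall>x\<in>{0..1::real}. vnorm p (\<lambda>j. vpoly (Suc t) a x j) \<le> B" and l: "l \<le> Suc t"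
    for p B l and a :: "nat \<Rightarrow> nat \<Rightarrow> real"
  proof -
    have B: "B \<ge> 0" using bspec[OF P, of 0] order_trans[OF vnorm_nonneg] by simp
    define b where "b l j = (2 ^ (Suc t - l) - 1) * a l j" for l j
    have "vnorm p (\<lambda>j. vpoly t b x j) \<le> (2 ^ Suc t + 1) * B" if x: "x \<in> {0..1}" for x
    proof -
      have eq: "vpoly t b x j = 2 ^ Suc t * vpoly (Suc t) a (x / 2) j - vpoly (Suc t) a x j" for j
      proof -
        have "2 ^ Suc t * vpoly (Suc t) a (x / 2) j = (\<Sum>l\<le>Suc t. 2 ^ (Suc t - l) * a l j * x ^ l)"
          unfolding sum_distrib_left
        proof (rule sum.cong)
          fix l assume "l \<in> {..Suc t}"
          hence "(2::real) ^ Suc t = 2 ^ (Suc t - l) * 2 ^ l" by (simp flip: power_add)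
          thus "2 ^ Suc t * (a l j * (x / 2) ^ l) = 2 ^ (Suc t - l) * a l j * x ^ l"
            by (simp add: power_divide)
        qed simp
        hence "2 ^ Suc t * vpoly (Suc t) a (x / 2) j - vpoly (Suc t) a x j
            = vpoly (Suc t) b x j"
          by (simp only: b_def sum_subtractf[symmetric]) (simp add: algebra_simps)
        thus ?thesis by (simp add: b_def)
      qed
      have "vnorm p (\<lambda>j. vpoly t b x j) \<le>
          vnorm p (\<lambda>j. 2 ^ Suc t * vpoly (Suc t) a (x / 2) j) + vnorm p (\<lambda>j. vpoly (Suc t) a x j)"
        unfolding eq by (rule vnorm_diff)
      also have "... \<le> 2 ^ Suc t * B + B"
        unfolding vnorm_scale using bspec[OF P, of x] bspec[OF P, of "x / 2"] x
        by (intro add_mono) (auto intro!: mult_left_mono)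
      finally show ?thesis by (simp add: algebra_simps)
    qed
    hence bl: "vnorm p (b l) \<le> C1 * B" if "l \<le> t" for l
      using C(2)[of p b "(2 ^ Suc t + 1) * B" l] that by (simp add: C1_def mult.assoc)
    have al: "vnorm p (a l) \<le> C1 * B" if l: "l \<le> t" for l
    proof -
      have "(2::real) ^ 1 \<le> 2 ^ (Suc t - l)" using l by (intro power_increasing) auto
      hence "1 * vnorm p (a l) \<le> \<bar>2 ^ (Suc t - l) - 1\<bar> * vnorm p (a l)"
        by (intro mult_right_mono) auto
      also have "... = vnorm p (b l)" unfolding b_def by (rule vnorm_scale[symmetric])
      finally show ?thesis using bl[OF l] by simp
    qed
    show ?thesis
    proof (cases "l \<le> t")
      case True
      have "C1 * B \<le> (1 + (real t + 1) * C1) * B"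
        using B C1 by (intro mult_right_mono) (auto simp: algebra_simps)
      thus ?thesis using al[OF True] by simp
    next
      case False
      hence l: "l = Suc t" using l by simp
      have "vnorm p (a l) = vnorm p (\<lambda>j. vpoly (Suc t) a 1 j - (\<Sum>l\<le>t. a l j))"
        by (simp add: l)
      also have "... \<le> vnorm p (\<lambda>j. vpoly (Suc t) a 1 j) + vnorm p (\<lambda>j. \<Sum>l\<le>t. a l j)"
        by (rule vnorm_diff)
      also have "... \<le> B + (\<Sum>l\<le>t. vnorm p (a l))"
        using bspec[OF P, of 1] by (intro add_mono vnorm_sum) auto
      also have "... \<le> B + (\<Sum>l\<le>t. C1 * B)" using al by (intro add_mono sum_mono) auto
      finally show ?thesis by (simp add: algebra_simps)
    qed
  qed
  moreover have "1 + (real t + 1) * C1 \<ge> 0" using C1 by simp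
  ultimately show ?case by blast
qed

lemma holder_taylor:
  fixes g :: "nat \<Rightarrow> real \<Rightarrow> real"
  assumes "\<forall>l<t. \<forall>x\<in>{0..1}. (g l has_real_derivative g (Suc l) x) (at x within {0..1})"
    and "\<forall>x\<in>{0..1}. \<forall>x'\<in>{0..1}. abs (g t x - g t x') \<le> Lc * abs (x - x') powr r"
    and "0 \<le> Lc" "0 < r" and x0: "x0 \<in> {0..1}" and "x \<in> {0..1}"
  shows "\<bar>g 0 x - (\<Sum>l\<le>t. g l x0 / fact l * (x - x0) ^ l)\<bar> \<le> Lc * abs (x - x0) powr (real t + r)"
  using assms(1,2,6)
proof (induction t arbitrary: g x)
  case 0
  thus ?case using x0 by simp
next
  case (Suc t)
  define R where "R x = g 0 x - (\<Sum>l\<le>Suc t. g l x0 / fact l * (x - x0) ^ l)" for x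
  define R' where "R' x = g 1 x - (\<Sum>l\<le>t. g (Suc l) x0 / fact l * (x - x0) ^ l)" for x
  have IH: "abs (R' y) \<le> Lc * abs (y - x0) powr (real t + r)" if "y \<in> {0..1}" for y
    using Suc.IH[of "\<lambda>l. g (Suc l)" y] Suc.prems that by (simp add: R'_def)
  let ?S = "closed_segment x0 x"
  have sub: "?S \<subseteq> {0..1}" using x0 Suc.prems(3) by (intro closed_segment_subset) auto
  have der: "(R has_field_derivative R' y) (at y within ?S)" if y: "y \<in> ?S" for y
  proof -
    have "(g 0 has_real_derivative g 1 y) (at y within {0..1})" using Suc.prems(1) y sub by auto
    hence 1: "(g 0 has_real_derivative g 1 y) (at y within ?S)" by (rule DERIV_subset[OF _ sub])
    have R: "R = (\<lambda>x. g 0 x - (g 0 x0 + (\<Sum>l\<le>t. g (Suc l) x0 / fact (Suc l) * (x - x0) ^ Suc l)))"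
      unfolding R_def by (rule ext, subst sum.atMost_Suc_shift) simp
    have "((\<lambda>x. g (Suc l) x0 / fact (Suc l) * (x - x0) ^ Suc l) has_real_derivative
        g (Suc l) x0 / fact l * (y - x0) ^ l) (at y within ?S)" for l
    proof -
      have "((\<lambda>x. g (Suc l) x0 / fact (Suc l) * (x - x0) ^ Suc l) has_real_derivative
        g (Suc l) x0 / fact (Suc l) * (real (Suc l) * (y - x0) ^ l)) (at y within ?S)"
      proof -
        have "((\<lambda>x. x - x0) has_real_derivative 1) (at y within ?S)" by (auto intro!: derivative_eq_intros)
        from DERIV_cmult[OF DERIV_power[OF this, of "Suc l"], of "g (Suc l) x0 / fact (Suc l)"]
        show ?thesis by simp
      qed
      moreover have "g (Suc l) x0 / fact (Suc l) * (real (Suc l) * (y - x0) ^ l) = g (Suc l) x0 / fact l * (y - x0) ^ l"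
        by (simp add: fact_Suc del: of_nat_Suc)
      ultimately show ?thesis by simp
    qed
    hence "((\<lambda>x. \<Sum>l\<le>t. g (Suc l) x0 / fact (Suc l) * (x - x0) ^ Suc l) has_real_derivative
        (\<Sum>l\<le>t. g (Suc l) x0 / fact l * (y - x0) ^ l)) (at y within ?S)" by (intro DERIV_sum)
    from DERIV_diff[OF 1 DERIV_add[OF DERIV_const[of "g 0 x0"] this]] show ?thesis
      unfolding R R'_def by simp
  qed
  have "norm (R x - R x0) \<le> (Lc * abs (x - x0) powr (real t + r)) * norm (x - x0)"
  proof (rule field_differentiable_bound[of ?S R R'])
    fix y assume y: "y \<in> ?S"
    have "abs (y - x0) \<le> abs (x - x0)" using y by (auto simp: closed_segment_eq_real_ivl split: if_splits)
    hence "Lc * abs (y - x0) powr (real t + r) \<le> Lc * abs (x - x0) powr (real t + r)"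
      using assms(3,4) by (intro mult_left_mono powr_mono2) auto
    moreover have "abs (R' y) \<le> Lc * abs (y - x0) powr (real t + r)" using y sub by (intro IH) auto
    ultimately show "norm (R' y) \<le> Lc * abs (x - x0) powr (real t + r)" by simp
  qed (auto intro: der)
  moreover have "R x0 = 0" unfolding R_def by (subst sum.atMost_Suc_shift) simp
  moreover have "abs (x - x0) powr (real t + r) * abs (x - x0) = abs (x - x0) powr (real (Suc t) + r)"
    by (cases "x = x0") (simp_all add: powr_add powr_mult_base algebra_simps)
  ultimately show ?case by (simp add: R_def mult.assoc)
qed

lemma holder_class_Lc_nonneg: "holder_class t r Dc Lc f \<Longrightarrow> 0 \<le> Lc"
proof -
  assume "holder_class t r Dc Lc f"
  then obtain g :: "nat \<Rightarrow> real \<Rightarrow> real"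
    where "\<forall>x\<in>{0..1}. \<forall>x'\<in>{0..1}. abs (g t x - g t x') \<le> Lc * abs (x - x') powr r"
    unfolding holder_class_def by blast
  hence "abs (g t 0 - g t 1) \<le> Lc * abs (0 - 1) powr r" by (metis atLeastAtMost_iff order.refl zero_le_one)
  thus ?thesis by simp
qed

lemma holder_class_taylor:
  assumes "holder_class t r Dc Lc f" "0 < r" "x0 \<in> {0..1}"
  shows "\<exists>c. \<forall>x\<in>{0..1}. \<bar>f x - (\<Sum>l\<le>t. c l * (x - x0) ^ l)\<bar> \<le> Lc * abs (x - x0) powr (real t + r)"
proof -
  obtain g where g: "\<forall>x\<in>{0..1}. g 0 x = f x"
      "\<forall>l<t. \<forall>x\<in>{0..1}. (g l has_real_derivative g (Suc l) x) (at x within {0..1})"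
      "\<forall>x\<in>{0..1}. \<forall>x'\<in>{0..1}. abs (g t x - g t x') \<le> Lc * abs (x - x') powr r"
    using assms(1) unfolding holder_class_def by blast
  show ?thesis
    using holder_taylor[OF g(2,3) holder_class_Lc_nonneg[OF assms(1)] assms(2,3)] g(1)
    by (intro exI[of _ "\<lambda>l. g l x0 / fact l"]) auto
qed

lemma holder_class_continuous:
  assumes "holder_class t r Dc Lc f" "0 < r"
  shows "continuous_on {0..1} f"
proof -
  obtain g where g: "\<forall>x\<in>{0..1}. g 0 x = f x"
      "\<forall>l<t. \<forall>x\<in>{0..1}. (g l has_real_derivative g (Suc l) x) (at x within {0..1})"
      "\<forall>x\<in>{0..1}. \<forall>x'\<in>{0..1}. abs (g t x - g t x') \<le> Lc * abs (x - x') powr r"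
    using assms(1) unfolding holder_class_def by blast
  have "continuous_on {0..1} (g 0)"
  proof (cases t)
    case 0
    show ?thesis unfolding continuous_on_def
    proof
      fix x :: real assume x: "x \<in> {0..1}"
      have lim: "((\<lambda>y. Lc * abs (y - x) powr r) \<longlongrightarrow> Lc * abs (x - x) powr r) (at x within {0..1})"
        using assms(2) by (intro tendsto_mult tendsto_const tendsto_powr' tendsto_rabs tendsto_diff tendsto_ident_at) auto
      have "((\<lambda>y. g 0 y - g 0 x) \<longlongrightarrow> 0) (at x within {0..1})"
      proof (rule Lim_null_comparison[of _ "\<lambda>y. Lc * abs (y - x) powr r"])
        have "norm (g 0 y - g 0 x) \<le> Lc * abs (y - x) powr r" if "y \<in> {0..1}" for y
          using g(3) x 0 that by simp
        thus "\<forall>\<^sub>F y in at x within {0..1}. norm (g 0 y - g 0 x) \<le> Lc * abs (y - x) powr r"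
          unfolding eventually_at_filter by (intro always_eventually) blast
        show "((\<lambda>y. Lc * abs (y - x) powr r) \<longlongrightarrow> 0) (at x within {0..1})" using lim by simp
      qed
      thus "(g 0 \<longlongrightarrow> g 0 x) (at x within {0..1})" by (simp add: LIM_zero_iff)
    qed
  next
    case (Suc k)
    have "(g 0 has_real_derivative g (Suc 0) x) (at x within {0..1})" if "x \<in> {0..1}" for x
      using g(2) that Suc by blast
    thus ?thesis by (rule DERIV_continuous_on)
  qed
  thus ?thesis by (rule continuous_on_eq) (use g(1) in auto)
qed

text \<open>A scalar function \<open>f\<close> is treated as \<open>\<lambda>y j. f y\<close> with \<open>p = 1\<close>.\<close>

definition jetv :: "nat \<Rightarrow> real \<Rightarrow> nat \<Rightarrow> real set \<Rightarrow> real \<Rightarrow> (real \<Rightarrow> nat \<Rightarrow> real) \<Rightarrow> bool" where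
  "jetv t d p Y C F \<longleftrightarrow> (\<exists>a. (\<forall>l\<le>t. vnorm p (a l) \<le> C) \<and>
     (\<forall>y\<in>Y. vnorm p (\<lambda>j. F y j - vpoly t a y j) \<le> C * abs y powr d))"

lemma jetv_nonneg: "jetv t d p Y C F \<Longrightarrow> 0 \<le> C"
  unfolding jetv_def using vnorm_nonneg order_trans by blast

lemma jetv_mono: "jetv t d p Y C F \<Longrightarrow> C \<le> C' \<Longrightarrow> jetv t d p Y C' F"
proof -
  assume "jetv t d p Y C F" and le: "C \<le> C'"
  then obtain a where a: "\<And>l. l \<le> t \<Longrightarrow> vnorm p (a l) \<le> C"
      "\<And>y. y \<in> Y \<Longrightarrow> vnorm p (\<lambda>j. F y j - vpoly t a y j) \<le> C * abs y powr d"
    unfolding jetv_def by blast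
  have "C * abs y powr d \<le> C' * abs y powr d" for y using le by (intro mult_right_mono) auto
  thus ?thesis unfolding jetv_def using a le by (intro exI[of _ a]) (meson order_trans)
qed

lemma jetv_cong: "(\<And>y j. y \<in> Y \<Longrightarrow> j < p \<Longrightarrow> F y j = G y j) \<Longrightarrow> jetv t d p Y C F \<longleftrightarrow> jetv t d p Y C G"
proof -
  assume eq: "\<And>y j. y \<in> Y \<Longrightarrow> j < p \<Longrightarrow> F y j = G y j"
  have "vnorm p (\<lambda>j. F y j - vpoly t a y j) = vnorm p (\<lambda>j. G y j - vpoly t a y j)"
    if "y \<in> Y" for y a
    using eq[OF that] by (intro vnorm_cong) simp
  thus ?thesis unfolding jetv_def by simp
qed

lemma jetv_add:
  assumes "jetv t d p Y C F" "jetv t d p Y C' G"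
  shows "jetv t d p Y (C + C') (\<lambda>y j. F y j + G y j)"
proof -
  obtain a where a: "\<And>l. l \<le> t \<Longrightarrow> vnorm p (a l) \<le> C"
      "\<And>y. y \<in> Y \<Longrightarrow> vnorm p (\<lambda>j. F y j - vpoly t a y j) \<le> C * abs y powr d"
    using assms(1) unfolding jetv_def by blast
  obtain b where b: "\<And>l. l \<le> t \<Longrightarrow> vnorm p (b l) \<le> C'"
      "\<And>y. y \<in> Y \<Longrightarrow> vnorm p (\<lambda>j. G y j - vpoly t b y j) \<le> C' * abs y powr d"
    using assms(2) unfolding jetv_def by blast
  show ?thesis unfolding jetv_def
  proof (intro exI[of _ "\<lambda>l j. a l j + b l j"] conjI allI impI ballI)
    fix l assume "l \<le> t"
    thus "vnorm p (\<lambda>j. a l j + b l j) \<le> C + C'" using vnorm_add[of p "a l" "b l"] a(1)[of l] b(1)[of l] by simp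
  next
    fix y assume y: "y \<in> Y"
    have "(\<lambda>j. F y j + G y j - (\<Sum>l\<le>t. (a l j + b l j) * y ^ l))
        = (\<lambda>j. (F y j - vpoly t a y j) + (G y j - vpoly t b y j))"
      by (simp add: algebra_simps sum.distrib)
    hence "vnorm p (\<lambda>j. F y j + G y j - (\<Sum>l\<le>t. (a l j + b l j) * y ^ l)) \<le> C * abs y powr d + C' * abs y powr d"
      using vnorm_add[of p "\<lambda>j. F y j - vpoly t a y j" "\<lambda>j. G y j - vpoly t b y j"] a(2)[OF y] b(2)[OF y]
      by simp
    thus "vnorm p (\<lambda>j. F y j + G y j - (\<Sum>l\<le>t. (a l j + b l j) * y ^ l)) \<le> (C + C') * abs y powr d"
      by (simp add: algebra_simps)
  qed
qed

lemma jetv_scale: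
  assumes "jetv t d p Y C F"
  shows "jetv t d p Y (abs c * C) (\<lambda>y j. c * F y j)"
proof -
  obtain a where a: "\<And>l. l \<le> t \<Longrightarrow> vnorm p (a l) \<le> C"
      "\<And>y. y \<in> Y \<Longrightarrow> vnorm p (\<lambda>j. F y j - vpoly t a y j) \<le> C * abs y powr d"
    using assms(1) unfolding jetv_def by blast
  show ?thesis unfolding jetv_def
  proof (intro exI[of _ "\<lambda>l j. c * a l j"] conjI allI impI ballI)
    fix l assume "l \<le> t"
    thus "vnorm p (\<lambda>j. c * a l j) \<le> abs c * C" unfolding vnorm_scale using a(1) by (intro mult_left_mono) auto
  next
    fix y assume y: "y \<in> Y"
    have "(\<lambda>j. c * F y j - (\<Sum>l\<le>t. c * a l j * y ^ l)) = (\<lambda>j. c * (F y j - vpoly t a y j))"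
      by (simp add: algebra_simps sum_distrib_left)
    thus "vnorm p (\<lambda>j. c * F y j - (\<Sum>l\<le>t. c * a l j * y ^ l)) \<le> abs c * C * abs y powr d"
      using a(2)[OF y] by (simp add: vnorm_scale mult_left_mono mult.assoc)
  qed
qed

lemma jetv_const: "0 < d \<Longrightarrow> jetv t d 1 Y (abs c) (\<lambda>y j. c)"
  unfolding jetv_def vnorm_1
  by (intro exI[of _ "\<lambda>l j. if l = 0 then c else 0"])
     (auto simp: if_distrib[of "\<lambda>x. x * _"] cong: if_cong)

lemma jetv_small:
  assumes "\<And>y. y \<in> Y \<Longrightarrow> vnorm p (F y) \<le> C * abs y powr d" "0 \<le> C"
  shows "jetv t d p Y C F"
  unfolding jetv_def using assms by (intro exI[of _ "\<lambda>l j. 0"]) auto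

lemma abs_le_1_subset:
  fixes y :: real
  assumes "Y \<subseteq> {-1..1}" "y \<in> Y"
  shows "abs y \<le> 1"
proof -
  have "-1 \<le> y" "y \<le> 1" using assms by auto
  thus ?thesis by linarith
qed

locale jet_order =
  fixes t :: nat and d :: real
  assumes d_ge: "1 \<le> d" and d_le: "d \<le> real t + 1"
begin

lemma power_le_powr_d: "abs y \<le> 1 \<Longrightarrow> t < n \<Longrightarrow> abs (y::real) ^ n \<le> abs y powr d"
proof -
  assume y: "abs y \<le> 1" and n: "t < n"
  show ?thesis
  proof (cases "y = 0")
    case True thus ?thesis using n by (cases n) auto
  next
    case False
    have "abs y ^ n = abs y powr real n" using False by (simp add: powr_realpow)
    also have "... \<le> abs y powr d" using y False n d_le by (intro powr_mono') auto
    finally show ?thesis .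
  qed
qed

lemma powr_d_le: "abs y \<le> 1 \<Longrightarrow> abs (y::real) powr d \<le> abs y"
  using powr_mono'[of 1 d "abs y"] d_ge by (cases "y = 0") auto

lemma vpoly_norm_le:
  assumes "\<And>l. l \<le> t \<Longrightarrow> vnorm p (a l) \<le> C" "abs y \<le> 1" "0 \<le> C"
  shows "vnorm p (\<lambda>j. vpoly t a y j) \<le> (real t + 1) * C"
proof -
  have "vnorm p (\<lambda>j. vpoly t a y j) \<le> (\<Sum>l\<le>t. vnorm p (\<lambda>j. a l j * y ^ l))"
    by (rule vnorm_sum) simp
  also have "... \<le> (\<Sum>l\<le>t. C)"
  proof (rule sum_mono)
    fix l assume l: "l \<in> {..t}"
    have "vnorm p (\<lambda>j. a l j * y ^ l) = abs y ^ l * vnorm p (a l)"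
      using vnorm_scale[of p "y ^ l" "a l"] by (simp add: mult.commute power_abs)
    also have "... \<le> 1 * C" using assms l by (intro mult_mono power_le_one) auto
    finally show "vnorm p (\<lambda>j. a l j * y ^ l) \<le> C" by simp
  qed
  finally show ?thesis by (simp add: add.commute)
qed

lemma jetv_bilinear:
  fixes M :: "(nat \<Rightarrow> real) \<Rightarrow> (nat \<Rightarrow> real) \<Rightarrow> nat \<Rightarrow> real"
  assumes lin1: "\<And>v v' w c j. M (\<lambda>k. v k + c * v' k) w j = M v w j + c * M v' w j"
    and lin2: "\<And>v w w' c j. M v (\<lambda>k. w k + c * w' k) j = M v w j + c * M v w' j"
    and bd: "\<And>v w. vnorm q (M v w) \<le> vnorm p1 v * vnorm p2 w"
    and Y: "Y \<subseteq> {-1..1}"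
    and F: "jetv t d p1 Y C1 F" and G: "jetv t d p2 Y C2 G"
  shows "jetv t d q Y ((real t + 3)^2 * C1 * C2) (\<lambda>y. M (F y) (G y))"
proof -
  obtain a where a: "\<And>l. l \<le> t \<Longrightarrow> vnorm p1 (a l) \<le> C1"
      "\<And>y. y \<in> Y \<Longrightarrow> vnorm p1 (\<lambda>j. F y j - vpoly t a y j) \<le> C1 * abs y powr d"
    using F unfolding jetv_def by blast
  obtain b where b: "\<And>l. l \<le> t \<Longrightarrow> vnorm p2 (b l) \<le> C2"
      "\<And>y. y \<in> Y \<Longrightarrow> vnorm p2 (\<lambda>j. G y j - vpoly t b y j) \<le> C2 * abs y powr d"
    using G unfolding jetv_def by blast
  note C = jetv_nonneg[OF F] jetv_nonneg[OF G]
  define T where "T = real t + 1"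
  have T: "T \<ge> 1" by (simp add: T_def)
  have z1: "M (\<lambda>k. 0) w j = 0" for w j using lin1[of "\<lambda>k. 0" "-1" "\<lambda>k. 0" w j] by simp
  have z2: "M v (\<lambda>k. 0) j = 0" for v j using lin2[of v "\<lambda>k. 0" "-1" "\<lambda>k. 0" j] by simp
  have s1: "M (\<lambda>k. \<Sum>i\<le>n. a i k * y ^ i) w j = (\<Sum>i\<le>n. y ^ i * M (a i) w j)" for n y w j
  proof (induction n)
    case 0 thus ?case using lin1[of "\<lambda>k. 0" 1 "a 0" w j] z1 by simp
  next
    case (Suc n)
    thus ?case using lin1[of "\<lambda>k. \<Sum>i\<le>n. a i k * y ^ i" "y ^ Suc n" "a (Suc n)" w j] by (simp add: mult.commute)
  qed
  have s2: "M v (\<lambda>k. \<Sum>i\<le>n. b i k * y ^ i) j = (\<Sum>i\<le>n. y ^ i * M v (b i) j)" for n y v j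
  proof (induction n)
    case 0 thus ?case using lin2[of v "\<lambda>k. 0" 1 "b 0" j] z2 by simp
  next
    case (Suc n)
    thus ?case using lin2[of v "\<lambda>k. \<Sum>i\<le>n. b i k * y ^ i" "y ^ Suc n" "b (Suc n)" j] by (simp add: mult.commute)
  qed
  define e where "e l j = (\<Sum>i\<le>l. M (a i) (b (l - i)) j)" for l j
  have MM: "vnorm q (M (a i) (b k)) \<le> C1 * C2" if "i \<le> t" "k \<le> t" for i k
    using bd[of "a i" "b k"] mult_mono[OF a(1)[OF that(1)] b(1)[OF that(2)]] C by simp
  show ?thesis unfolding jetv_def
  proof (intro exI[of _ e] conjI allI impI ballI)
    fix l assume l: "l \<le> t"
    have "vnorm q (e l) \<le> (\<Sum>i\<le>l. vnorm q (M (a i) (b (l - i))))" unfolding e_def by (rule vnorm_sum) simp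
    also have "... \<le> (\<Sum>i\<le>l. C1 * C2)" using l by (intro sum_mono MM) auto
    also have "... = (real l + 1) * (C1 * C2)" by simp
    also have "... \<le> ((real t + 3)^2) * (C1 * C2)"
      using C l by (intro mult_right_mono) (auto simp: power2_eq_square algebra_simps intro: add_mono order_trans[of _ "real t"])
    finally show "vnorm q (e l) \<le> (real t + 3)^2 * C1 * C2" by (simp add: mult.assoc)
  next
    fix y assume yY: "y \<in> Y"
    have y: "abs y \<le> 1" by (rule abs_le_1_subset[OF Y yY])
    define P where "P = (\<lambda>j. vpoly t a y j)"
    define Q where "Q = (\<lambda>j. vpoly t b y j)"
    define eps where "eps = abs y powr d"
    have eps: "0 \<le> eps" "eps \<le> 1" using powr_d_le[OF y] y by (auto simp: eps_def)
    have P: "vnorm p1 P \<le> T * C1" unfolding P_def T_def by (intro vpoly_norm_le a(1) y C)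
    have Q: "vnorm p2 Q \<le> T * C2" unfolding Q_def T_def by (intro vpoly_norm_le b(1) y C)
    have FP: "vnorm p1 (\<lambda>j. F y j - P j) \<le> C1 * eps" using a(2)[OF yY] by (simp add: P_def eps_def)
    have GQ: "vnorm p2 (\<lambda>j. G y j - Q j) \<le> C2 * eps" using b(2)[OF yY] by (simp add: Q_def eps_def)
    have Gn: "vnorm p2 (G y) \<le> (T + 1) * C2"
    proof -
      have "vnorm p2 (G y) \<le> vnorm p2 (\<lambda>j. G y j - Q j) + vnorm p2 Q"
        using vnorm_add[of p2 "\<lambda>j. G y j - Q j" Q] by simp
      also have "... \<le> C2 * 1 + T * C2" using GQ Q eps C by (intro add_mono order_trans[OF GQ] mult_left_mono) auto
      finally show ?thesis by (simp add: algebra_simps)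
    qed
    have d1: "M (F y) (G y) j - M P Q j = M (\<lambda>j. F y j - P j) (G y) j + M P (\<lambda>j. G y j - Q j) j" for j
      using lin1[of "F y" "-1" P "G y" j] lin2[of P "G y" "-1" Q j] by simp
    have n1: "vnorm q (\<lambda>j. M (F y) (G y) j - M P Q j) \<le> (C1 * eps) * ((T + 1) * C2) + (T * C1) * (C2 * eps)"
      unfolding d1
      by (rule order_trans[OF vnorm_add])
         (intro add_mono order_trans[OF bd] mult_mono FP Gn P GQ; use C eps T in simp)
    have PQ: "M P Q j - vpoly t e y j
        = (\<Sum>i\<le>t. \<Sum>k\<le>t. if i + k \<le> t then 0 else y ^ (i + k) * M (a i) (b k) j)" for j
    proof -
      have "vpoly t e y j = (\<Sum>l\<le>t. \<Sum>i\<le>l. y ^ (i + (l - i)) * M (a i) (b (l - i)) j)"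
        unfolding e_def sum_distrib_right by (intro sum.cong) (auto simp: mult.commute)
      also have "... = (\<Sum>(i, k)\<in>{(i, k). i + k \<le> t}. y ^ (i + k) * M (a i) (b k) j)"
        using sum.triangle_reindex_eq[of "\<lambda>i k. y ^ (i + k) * M (a i) (b k) j" t] by simp
      also have "... = (\<Sum>(i, k)\<in>{..t} \<times> {..t}. if i + k \<le> t then y ^ (i + k) * M (a i) (b k) j else 0)"
        by (intro sum.mono_neutral_cong_left) (auto split: if_splits)
      also have "... = (\<Sum>i\<le>t. \<Sum>k\<le>t. if i + k \<le> t then y ^ (i + k) * M (a i) (b k) j else 0)"
        by (simp add: sum.cartesian_product)
      finally have 1: "vpoly t e y j = ..." .
      have 2: "M P Q j = (\<Sum>i\<le>t. \<Sum>k\<le>t. y ^ (i + k) * M (a i) (b k) j)"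
        unfolding P_def Q_def s1 s2 by (simp add: sum_distrib_left power_add mult.assoc)
      show ?thesis unfolding 1 2 sum_subtractf[symmetric] by (intro sum.cong refl) auto
    qed
    have n2: "vnorm q (\<lambda>j. M P Q j - vpoly t e y j) \<le> T * (T * (eps * (C1 * C2)))"
    proof -
      have "vnorm q (\<lambda>j. M P Q j - vpoly t e y j)
          \<le> (\<Sum>i\<le>t. \<Sum>k\<le>t. vnorm q (\<lambda>j. if i + k \<le> t then 0 else y ^ (i + k) * M (a i) (b k) j))"
        unfolding PQ by (rule order_trans[OF vnorm_sum]) (auto intro!: sum_mono vnorm_sum)
      also have "... \<le> (\<Sum>i\<le>t. \<Sum>k\<le>t. eps * (C1 * C2))"
      proof (intro sum_mono)
        fix i k assume ik: "i \<in> {..t}" "k \<in> {..t}"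
        show "vnorm q (\<lambda>j. if i + k \<le> t then 0 else y ^ (i + k) * M (a i) (b k) j) \<le> eps * (C1 * C2)"
        proof (cases "i + k \<le> t")
          case True thus ?thesis using eps C by simp
        next
          case False
          hence "abs y ^ (i + k) \<le> eps" unfolding eps_def using y by (intro power_le_powr_d) auto
          thus ?thesis using False ik MM[of i k] eps by (simp add: vnorm_scale power_abs) (intro mult_mono; simp)
        qed
      qed
      finally show ?thesis by (simp add: T_def algebra_simps)
    qed
    have "vnorm q (\<lambda>j. M (F y) (G y) j - vpoly t e y j)
        \<le> vnorm q (\<lambda>j. M (F y) (G y) j - M P Q j) + vnorm q (\<lambda>j. M P Q j - vpoly t e y j)"
      using vnorm_add[of q "\<lambda>j. M (F y) (G y) j - M P Q j" "\<lambda>j. M P Q j - vpoly t e y j"] by simp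
    also have "... \<le> (C1 * eps) * ((T + 1) * C2) + (T * C1) * (C2 * eps) + T * (T * (eps * (C1 * C2)))"
      by (intro add_mono n1 n2)
    also have "... = (T^2 + 2 * T + 1) * (C1 * C2 * eps)" by (simp add: algebra_simps power2_eq_square)
    also have "... \<le> (real t + 3)^2 * (C1 * C2 * eps)"
      using C eps T by (intro mult_right_mono) (auto simp: T_def power2_eq_square algebra_simps)
    finally show "vnorm q (\<lambda>j. M (F y) (G y) j - vpoly t e y j) \<le> (real t + 3)^2 * C1 * C2 * abs y powr d"
      by (simp add: eps_def mult.assoc)
  qed
qed

lemma jetv_dot:
  assumes "Y \<subseteq> {-1..1}" "jetv t d p Y C1 F" "jetv t d p Y C2 G"
  shows "jetv t d 1 Y ((real t + 3)^2 * C1 * C2) (\<lambda>y j. \<Sum>k<p. F y k * G y k)"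
  by (rule jetv_bilinear[where M = "\<lambda>v w j. \<Sum>k<p. v k * w k", OF _ _ _ assms])
     (auto simp: vnorm_1 vnorm_1[unfolded One_nat_def] vnorm_cauchy_schwarz algebra_simps sum.distrib sum_distrib_left)

lemma jetv_smult:
  assumes "Y \<subseteq> {-1..1}" "jetv t d 1 Y C1 (\<lambda>y j. f y)" "jetv t d p Y C2 G"
  shows "jetv t d p Y ((real t + 3)^2 * C1 * C2) (\<lambda>y j. f y * G y j)"
  by (rule jetv_bilinear[where M = "\<lambda>v w j. v 0 * w j" and F = "\<lambda>y j. f y", OF _ _ _ assms])
     (auto simp: vnorm_1 vnorm_1[unfolded One_nat_def] vnorm_scale algebra_simps)

lemma jetv_power:
  "\<exists>C'. \<forall>Y f. Y \<subseteq> {-1..1} \<longrightarrow> jetv t d 1 Y C (\<lambda>y j. f y) \<longrightarrow> jetv t d 1 Y C' (\<lambda>y j. f y ^ i)"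
proof (induction i)
  case 0
  have "jetv t d 1 Y 1 (\<lambda>y j. 1)" for Y using jetv_const[of d t Y 1] d_ge by simp
  thus ?case by (intro exI[of _ 1]) (simp del: One_nat_def)
next
  case (Suc i)
  then obtain C' where "\<And>Y f. Y \<subseteq> {-1..1} \<Longrightarrow> jetv t d 1 Y C (\<lambda>y j. f y) \<Longrightarrow> jetv t d 1 Y C' (\<lambda>y j. f y ^ i)"
    by blast
  hence "jetv t d 1 Y ((real t + 3)^2 * C * C') (\<lambda>y j. f y ^ Suc i)"
    if "Y \<subseteq> {-1..1}" "jetv t d 1 Y C (\<lambda>y j. f y)" for Y f
    using jetv_smult[OF that(1) that(2), of 1 C' "\<lambda>y j. f y ^ i"] that by simp
  thus ?case by blast
qed

lemma jetv_geometric_sum: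
  "\<exists>C'. \<forall>Y f. Y \<subseteq> {-1..1} \<longrightarrow> jetv t d 1 Y C (\<lambda>y j. f y) \<longrightarrow> jetv t d 1 Y C' (\<lambda>y j. \<Sum>i\<le>n. f y ^ i)"
proof (induction n)
  case 0
  have "jetv t d 1 Y 1 (\<lambda>y j. 1)" for Y using jetv_const[of d t Y 1] d_ge by simp
  thus ?case by (intro exI[of _ 1]) (simp del: One_nat_def)
next
  case (Suc n)
  then obtain C1 where 1: "\<And>Y f. Y \<subseteq> {-1..1} \<Longrightarrow> jetv t d 1 Y C (\<lambda>y j. f y) \<Longrightarrow> jetv t d 1 Y C1 (\<lambda>y j. \<Sum>i\<le>n. f y ^ i)"
    by blast
  obtain C2 where 2: "\<And>Y f. Y \<subseteq> {-1..1} \<Longrightarrow> jetv t d 1 Y C (\<lambda>y j. f y) \<Longrightarrow> jetv t d 1 Y C2 (\<lambda>y j. f y ^ Suc n)"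
    using jetv_power[of C "Suc n"] by blast
  have "jetv t d 1 Y (C1 + C2) (\<lambda>y j. \<Sum>i\<le>Suc n. f y ^ i)"
    if "Y \<subseteq> {-1..1}" "jetv t d 1 Y C (\<lambda>y j. f y)" for Y f
    using jetv_add[OF 1[OF that] 2[OF that]] by simp
  thus ?case by blast
qed

lemma jetv_recip:
  assumes C: "0 \<le> C"
  shows "\<exists>C'. \<forall>Y s. Y \<subseteq> {-1..1} \<longrightarrow> 0 \<in> Y \<longrightarrow> (\<forall>y\<in>Y. 0 \<le> s y) \<longrightarrow> jetv t d 1 Y C (\<lambda>y j. s y) \<longrightarrow>
     jetv t d 1 Y C' (\<lambda>y j. 1 / (4 + s y))"
proof -
  define T where "T = real t + 1"
  obtain C1 where C1: "\<And>Y f. Y \<subseteq> {-1..1} \<Longrightarrow> jetv t d 1 Y (2 * C) (\<lambda>y j. f y) \<Longrightarrow> jetv t d 1 Y C1 (\<lambda>y j. \<Sum>i\<le>t. f y ^ i)"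
    using jetv_geometric_sum[of "2 * C" t] by blast
  define C2 where "C2 = (T * C) ^ Suc t * (4 + C) / 4"
  have C2: "C2 \<ge> 0" using C by (simp add: C2_def T_def)
  have "jetv t d 1 Y (abs C1 + C2) (\<lambda>y j. 1 / (4 + s y))"
    if Y: "Y \<subseteq> {-1..1}" "0 \<in> Y" and s: "\<forall>y\<in>Y. 0 \<le> s y" and jet: "jetv t d 1 Y C (\<lambda>y j. s y)" for Y s
  proof -
    obtain a :: "nat \<Rightarrow> nat \<Rightarrow> real" where a': "(\<forall>l\<le>t. abs (a l 0) \<le> C) \<and>
      (\<forall>y\<in>Y. \<bar>s y - (\<Sum>l\<le>t. a l 0 * y ^ l)\<bar> \<le> C * abs y powr d)"
      using jet unfolding jetv_def vnorm_1 ..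
    have a: "\<And>l. l \<le> t \<Longrightarrow> abs (a l 0) \<le> C"
      "\<And>y. y \<in> Y \<Longrightarrow> \<bar>s y - (\<Sum>l\<le>t. a l 0 * y ^ l)\<bar> \<le> C * abs y powr d"
      using a' by auto
    define s0 where "s0 = s 0"
    have s0: "s0 = a 0 0"
    proof -
      have "(\<Sum>l\<le>t. a l (0::nat) * 0 ^ l) = a 0 0"
        by (simp add: power_0_left if_distrib[of "\<lambda>x. _ * x"] cong: if_cong)
      thus ?thesis using a(2)[OF Y(2)] by (simp add: s0_def)
    qed
    have s0n: "0 \<le> s0" "s0 \<le> C" using s Y(2) a(1)[of 0] s0 by (auto simp: s0_def)
    define w where "w y = (s0 - s y) / (4 + s0)" for y
    have jw: "jetv t d 1 Y (2 * C) (\<lambda>y j. w y)"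
    proof -
      have "jetv t d 1 Y (abs s0 + abs (-1) * C) (\<lambda>y j. s0 + (-1) * s y)"
        using d_ge by (intro jetv_add jetv_const jetv_scale jet) auto
      hence "jetv t d 1 Y (abs (1 / (4 + s0)) * (abs s0 + abs (-1) * C)) (\<lambda>y j. 1 / (4 + s0) * (s0 + (-1) * s y))"
        by (rule jetv_scale)
      moreover have "abs (1 / (4 + s0)) * (abs s0 + abs (-1) * C) \<le> 2 * C"
      proof -
        have "abs (1 / (4 + s0)) * (abs s0 + abs (-1) * C) \<le> 1 * (C + C)"
          using s0n C by (intro mult_mono) auto
        thus ?thesis by simp
      qed
      ultimately show ?thesis by (simp add: w_def jetv_mono)
    qed
    have wb: "abs (w y) \<le> T * C * abs y" if y: "y \<in> Y" for y
    proof -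
      have y1: "abs y \<le> 1" by (rule abs_le_1_subset[OF Y(1) y])
      have "(\<Sum>l\<le>t. a l 0 * y ^ l) = a 0 0 + (\<Sum>l\<in>{1..t}. a l 0 * y ^ l)"
      proof -
        have "{..t} = insert 0 {1..t}" by auto
        thus ?thesis by simp
      qed
      hence "s y - s0 = (s y - (\<Sum>l\<le>t. a l 0 * y ^ l)) + (\<Sum>l\<in>{1..t}. a l 0 * y ^ l)"
        using s0 by simp
      hence "abs (s y - s0) \<le> \<bar>s y - (\<Sum>l\<le>t. a l 0 * y ^ l)\<bar> + (\<Sum>l\<in>{1..t}. abs (a l 0 * y ^ l))"
        using abs_triangle_ineq[of "s y - (\<Sum>l\<le>t. a l 0 * y ^ l)" "\<Sum>l\<in>{1..t}. a l 0 * y ^ l"]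
          sum_abs[of "\<lambda>l. a l 0 * y ^ l" "{1..t}"] by linarith
      also have "... \<le> C * abs y + (\<Sum>l\<in>{1..t}. C * abs y)"
      proof (intro add_mono sum_mono)
        show "\<bar>s y - (\<Sum>l\<le>t. a l 0 * y ^ l)\<bar> \<le> C * abs y"
          using a(2)[OF y] mult_left_mono[OF powr_d_le[OF y1] C] by simp
        fix l assume l: "l \<in> {1..t}"
        have "abs y ^ l \<le> abs y ^ 1" using l y1 by (intro power_decreasing) auto
        thus "abs (a l 0 * y ^ l) \<le> C * abs y"
          unfolding abs_mult power_abs using a(1)[of l] l C by (intro mult_mono) auto
      qed
      also have "... = T * C * abs y" by (simp add: T_def algebra_simps)
      finally have "abs (s y - s0) \<le> T * C * abs y" .
      moreover have "abs (w y) \<le> abs (s y - s0)"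
        using s0n unfolding w_def by (simp add: abs_divide divide_le_eq abs_minus_commute) (simp add: mult_le_cancel_left1 distrib_left)
      ultimately show ?thesis by simp
    qed
    have rem: "1 / (1 - w y) = (\<Sum>i\<le>t. w y ^ i) + w y ^ Suc t / (1 - w y)"
      and pos: "1 / (1 - w y) \<le> (4 + C) / 4" "0 < 1 - w y" and fin: "1 / (4 + s y) = 1 / (4 + s0) * (1 / (1 - w y))"
      if y: "y \<in> Y" for y
    proof -
      have e: "1 - w y = (4 + s y) / (4 + s0)" using s0n by (simp add: w_def field_simps)
      have sy: "0 \<le> s y" using s y by simp
      show p: "0 < 1 - w y" unfolding e using sy s0n by simp
      have "1 / (1 - w y) = (4 + s0) / (4 + s y)" unfolding e by simp
      also have "... \<le> (4 + C) / 4" using sy s0n C by (intro frac_le) auto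
      finally show "1 / (1 - w y) \<le> (4 + C) / 4" .
      show "1 / (4 + s y) = 1 / (4 + s0) * (1 / (1 - w y))" unfolding e using s0n by simp
      have "(1 - w y) * (\<Sum>i\<le>t. w y ^ i) = 1 - w y ^ Suc t" by (rule sum_gp_basic)
      thus "1 / (1 - w y) = (\<Sum>i\<le>t. w y ^ i) + w y ^ Suc t / (1 - w y)"
        using p by (simp add: field_simps)
    qed
    have "jetv t d 1 Y C2 (\<lambda>y j. w y ^ Suc t / (1 - w y))"
    proof (rule jetv_small[OF _ C2])
      fix y assume y: "y \<in> Y"
      have y1: "abs y \<le> 1" by (rule abs_le_1_subset[OF Y(1) y])
      have "\<bar>w y ^ Suc t / (1 - w y)\<bar> = abs (w y) ^ Suc t * (1 / (1 - w y))"
        using pos(2)[OF y] by (simp add: abs_mult power_abs)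
      also have "... \<le> (T * C * abs y) ^ Suc t * ((4 + C) / 4)"
        using wb[OF y] pos[OF y] C by (intro mult_mono power_mono) (auto simp: T_def)
      also have "... = C2 * abs y ^ Suc t" unfolding C2_def power_mult_distrib by simp
      also have "... \<le> C2 * abs y powr d" using C2 y1 by (intro mult_left_mono power_le_powr_d) auto
      finally show "vnorm 1 (\<lambda>j. w y ^ Suc t / (1 - w y)) \<le> C2 * abs y powr d" unfolding vnorm_1 .
    qed
    from jetv_add[OF C1[OF Y(1) jw] this]
    have "jetv t d 1 Y (C1 + C2) (\<lambda>y j. 1 / (1 - w y))"
      using rem by (subst jetv_cong[where G = "\<lambda>y j. (\<Sum>i\<le>t. w y ^ i) + w y ^ Suc t / (1 - w y)"]) auto
    hence "jetv t d 1 Y (abs (1 / (4 + s0)) * (C1 + C2)) (\<lambda>y j. 1 / (4 + s0) * (1 / (1 - w y)))"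
      by (rule jetv_scale)
    hence "jetv t d 1 Y (abs (1 / (4 + s0)) * (C1 + C2)) (\<lambda>y j. 1 / (4 + s y))"
      using fin by (subst jetv_cong[where G = "\<lambda>y j. 1 / (4 + s0) * (1 / (1 - w y))"]) auto
    moreover have "abs (1 / (4 + s0)) * (C1 + C2) \<le> 1 * (abs C1 + C2)"
      using s0n C2 by (intro order_trans[OF mult_left_mono[of "C1 + C2" "abs C1 + C2"] mult_right_mono]) auto
    ultimately show ?thesis by (simp add: jetv_mono)
  qed
  thus ?thesis by blast
qed

lemma jetv_ratio:
  assumes C: "0 \<le> C"
  shows "\<exists>C'. \<forall>p Y F G. Y \<subseteq> {-1..1} \<longrightarrow> 0 \<in> Y \<longrightarrow> (\<forall>y\<in>Y. 0 \<le> (\<Sum>k<p. F y k * G y k)) \<longrightarrow>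
     jetv t d p Y C F \<longrightarrow> jetv t d p Y C G \<longrightarrow>
     jetv t d p Y C' (\<lambda>y j. 1 / (4 + (\<Sum>k<p. F y k * G y k)) * F y j)"
proof -
  have "0 \<le> (real t + 3)^2 * C * C" using C by simp
  from jetv_recip[OF this] obtain C1 where C1': "\<forall>Y s. Y \<subseteq> {-1..1} \<longrightarrow> 0 \<in> Y \<longrightarrow> (\<forall>y\<in>Y. 0 \<le> s y) \<longrightarrow>
     jetv t d 1 Y ((real t + 3)^2 * C * C) (\<lambda>y j. s y) \<longrightarrow> jetv t d 1 Y C1 (\<lambda>y j. 1 / (4 + s y))" ..
  note C1 = C1'[THEN spec, THEN spec, THEN mp, THEN mp, THEN mp, THEN mp]
  have "jetv t d p Y ((real t + 3)^2 * C1 * C) (\<lambda>y j. 1 / (4 + (\<Sum>k<p. F y k * G y k)) * F y j)"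
    if "Y \<subseteq> {-1..1}" "0 \<in> Y" "\<forall>y\<in>Y. 0 \<le> (\<Sum>k<p. F y k * G y k)" "jetv t d p Y C F" "jetv t d p Y C G"
    for p Y F G
    using jetv_smult[OF that(1) C1[OF that(1-3) jetv_dot[OF that(1,4,5)]] that(4)] by simp
  thus ?thesis by blast
qed

end

section \<open>Spline approximation\<close>

lemma sum_binomial_recenter:
  fixes A g :: "nat \<Rightarrow> real"
  shows "(\<Sum>l\<le>t. (\<Sum>i\<le>t. A i * (real (i choose l) * z ^ (i - l))) * g l)
    = (\<Sum>i\<le>t. A i * (\<Sum>l\<le>i. real (i choose l) * z ^ (i - l) * g l))"
proof -
  have "(\<Sum>l\<le>t. (\<Sum>i\<le>t. A i * (real (i choose l) * z ^ (i - l))) * g l)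
      = (\<Sum>i\<le>t. \<Sum>l\<le>t. A i * (real (i choose l) * z ^ (i - l) * g l))"
    unfolding sum_distrib_right by (subst sum.swap) (simp add: mult_ac)
  also have "... = (\<Sum>i\<le>t. \<Sum>l\<le>i. A i * (real (i choose l) * z ^ (i - l) * g l))"
    by (intro sum.cong refl sum.mono_neutral_right) auto
  finally show ?thesis by (simp add: sum_distrib_left)
qed

lemma holder_jetv:
  assumes r: "0 < r" and d: "d = real t + r"
  obtains C where "0 \<le> C"
    and "\<And>p (f :: real \<Rightarrow> nat \<Rightarrow> real) x0 H. \<lbrakk>\<forall>j<p. holder_class t r Dc Lc (\<lambda>u. f u j);
      \<forall>u\<in>{0..1}. vnorm p (f u) \<le> M; x0 \<in> {0..1}; 0 < H; H \<le> 1; sqrt (real p) * H powr d \<le> 1\<rbrakk> \<Longrightarrow>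
      jetv t d p {y. abs y \<le> 1 \<and> x0 + H * y \<in> {0..1}} C (\<lambda>y. f (x0 + H * y))"
proof -
  obtain C0 where C0: "C0 \<ge> 0" and C0b: "\<And>p (a :: nat \<Rightarrow> nat \<Rightarrow> real) B l.
     (\<forall>x\<in>{0..1}. vnorm p (\<lambda>j. vpoly t a x j) \<le> B) \<Longrightarrow> l \<le> t \<Longrightarrow> vnorm p (a l) \<le> C0 * B"
    using vpoly_coeff_bound[of t] by blast
  define B where "B = abs M + abs Lc"
  define C where "C = 2 ^ t * (C0 * B) + abs Lc"
  have B: "B \<ge> 0" and C: "C \<ge> abs Lc" using C0 by (auto simp: B_def C_def)
  have main: "jetv t d p {y. abs y \<le> 1 \<and> x0 + H * y \<in> {0..1}} C (\<lambda>y. f (x0 + H * y))"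
    if f: "\<forall>j<p. holder_class t r Dc Lc (\<lambda>u. f u j)" and M: "\<forall>u\<in>{0..1}. vnorm p (f u) \<le> M"
      and x0: "x0 \<in> {0..1}" and H: "0 < H" "H \<le> 1" and pH: "sqrt (real p) * H powr d \<le> 1"
    for p x0 H and f :: "real \<Rightarrow> nat \<Rightarrow> real"
  proof -
    let ?Y = "{y. abs y \<le> 1 \<and> x0 + H * y \<in> {0..1}}"
    have "\<exists>c. j < p \<longrightarrow> (\<forall>x\<in>{0..1}. \<bar>f x j - (\<Sum>l\<le>t. c l * (x - x0) ^ l)\<bar> \<le> Lc * abs (x - x0) powr d)" for j
      using holder_class_taylor[of t r Dc Lc "\<lambda>u. f u j" x0] f r x0 unfolding d by blast
    then obtain c where c: "\<And>j x. j < p \<Longrightarrow> x \<in> {0..1} \<Longrightarrow>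
        \<bar>f x j - (\<Sum>l\<le>t. c j l * (x - x0) ^ l)\<bar> \<le> Lc * abs (x - x0) powr d" by metis
    define a where "a l j = c j l * H ^ l" for l j
    have err: "vnorm p (\<lambda>j. f (x0 + H * y) j - vpoly t a y j) \<le> abs Lc * abs y powr d"
      if y: "y \<in> ?Y" for y
    proof -
      have "vnorm p (\<lambda>j. f (x0 + H * y) j - vpoly t a y j)
          \<le> sqrt (real p) * (abs Lc * (H powr d * abs y powr d))"
      proof (rule vnorm_le_sqrt)
        fix j assume j: "j < p"
        have "\<bar>f (x0 + H * y) j - vpoly t a y j\<bar> \<le> Lc * abs (H * y) powr d"
          using c[OF j, of "x0 + H * y"] y by (simp add: a_def power_mult_distrib mult.assoc)
        also have "... \<le> abs Lc * abs (H * y) powr d" by (intro mult_right_mono) auto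
        also have "abs (H * y) powr d = H powr d * abs y powr d" using H by (simp add: abs_mult powr_mult)
        finally show "\<bar>f (x0 + H * y) j - vpoly t a y j\<bar> \<le> abs Lc * (H powr d * abs y powr d)" .
      qed auto
      also have "... = (sqrt (real p) * H powr d) * (abs Lc * abs y powr d)" by simp
      also have "... \<le> 1 * (abs Lc * abs y powr d)" using pH by (intro mult_right_mono) auto
      finally show ?thesis by simp
    qed
    have Pb: "vnorm p (\<lambda>j. vpoly t a y j) \<le> B" if y: "y \<in> ?Y" for y
    proof -
      have "vnorm p (\<lambda>j. vpoly t a y j)
          = vnorm p (\<lambda>j. f (x0 + H * y) j - (f (x0 + H * y) j - vpoly t a y j))" by simp
      also have "... \<le> vnorm p (f (x0 + H * y)) + vnorm p (\<lambda>j. f (x0 + H * y) j - vpoly t a y j)"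
        by (rule vnorm_diff)
      also have "... \<le> M + abs Lc * 1"
      proof (intro add_mono order_trans[OF err[OF y]] mult_left_mono)
        show "abs y powr d \<le> 1" using y r d by (intro powr_le1) auto
      qed (use y M in auto)
      finally show ?thesis by (simp add: B_def)
    qed
    define sg :: real where "sg = (if x0 \<le> 1/2 then 1/2 else -1/2)"
    have sY: "sg * s \<in> ?Y" if s: "s \<in> {0..1}" for s
    proof -
      have "0 \<le> H * s" "H * s \<le> 1" using s H by (auto intro: mult_le_one)
      moreover have "H * (sg * s) = sg * (H * s)" by simp
      ultimately show ?thesis using x0 s by (auto simp: sg_def abs_mult)
    qed
    have al: "vnorm p (a l) \<le> 2 ^ t * (C0 * B)" if l: "l \<le> t" for l
    proof -
      have "vnorm p (\<lambda>j. sg ^ l * a l j) \<le> C0 * B"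
      proof (rule C0b[OF _ l, of p "\<lambda>l j. sg ^ l * a l j"], intro ballI)
        fix s :: real assume s: "s \<in> {0..1}"
        show "vnorm p (\<lambda>j. \<Sum>l\<le>t. sg ^ l * a l j * s ^ l) \<le> B"
          using Pb[OF sY[OF s]] by (simp add: power_mult_distrib mult_ac)
      qed
      hence le: "\<bar>sg ^ l\<bar> * vnorm p (a l) \<le> C0 * B" by (simp add: vnorm_scale)
      have sl: "\<bar>sg ^ l\<bar> = 1 / 2 ^ l" by (simp add: sg_def power_abs power_divide)
      have "vnorm p (a l) = 2 ^ l * (\<bar>sg ^ l\<bar> * vnorm p (a l))" unfolding sl by simp
      also have "... \<le> 2 ^ t * (C0 * B)" using l by (intro mult_mono[OF _ le]) auto
      finally show ?thesis .
    qed
    show ?thesis unfolding jetv_def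
    proof (intro exI[of _ a] conjI allI impI ballI)
      fix l assume "l \<le> t" thus "vnorm p (a l) \<le> C" using al[of l] by (simp add: C_def)
    next
      fix y assume "y \<in> ?Y"
      from err[OF this] show "vnorm p (\<lambda>j. f (x0 + H * y) j - vpoly t a y j) \<le> C * abs y powr d"
        using mult_right_mono[OF C, of "abs y powr d"] by simp
    qed
  qed
  have "0 \<le> C" using C by simp
  thus thesis using main by (rule that)
qed

lemma ratio_local_taylor:
  assumes r: "0 < r" "r \<le> 1" and d: "d = real t + r" "1 \<le> d"
  obtains C where "0 \<le> C"
    and "\<And>p (f :: real \<Rightarrow> nat \<Rightarrow> real) g x0 H. \<lbrakk>\<forall>j<p. holder_class t r Dc Lc (\<lambda>u. f u j);
      \<forall>j<p. holder_class t r Dc' Lc' (\<lambda>u. g u j);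
      \<forall>u\<in>{0..1}. vnorm p (f u) \<le> M; \<forall>u\<in>{0..1}. vnorm p (g u) \<le> M';
      \<forall>u\<in>{0..1}. 0 \<le> (\<Sum>k<p. f u k * g u k);
      x0 \<in> {0..1}; 0 < H; H \<le> 1; sqrt (real p) * H powr d = 1\<rbrakk> \<Longrightarrow>
      \<exists>a. \<forall>x\<in>{0..1}. abs (x - x0) \<le> H \<longrightarrow>
        vnorm p (\<lambda>j. 1 / (4 + (\<Sum>k<p. f x k * g x k)) * f x j - vpoly t a (x - x0) j)
          \<le> C * sqrt (real p) * abs (x - x0) powr d"
proof (cases rule: holder_jetv[OF r(1) d(1), where Dc = Dc and Lc = Lc and M = M])
  case C1: (1 C1)
  show thesis
  proof (cases rule: holder_jetv[OF r(1) d(1), where Dc = Dc' and Lc = Lc' and M = M'])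
    case C2: (1 C2)
    interpret jet_order t d using r d by unfold_locales auto
    have "0 \<le> max C1 C2" using C1(1) by simp
    from jetv_ratio[OF this] obtain C where C: "\<forall>p Y F G. Y \<subseteq> {-1..1} \<longrightarrow> 0 \<in> Y \<longrightarrow> (\<forall>y\<in>Y. 0 \<le> (\<Sum>k<p. F y k * G y k)) \<longrightarrow>
       jetv t d p Y (max C1 C2) F \<longrightarrow> jetv t d p Y (max C1 C2) G \<longrightarrow>
       jetv t d p Y C (\<lambda>y j. 1 / (4 + (\<Sum>k<p. F y k * G y k)) * F y j)" ..
    note C = C[THEN spec, THEN spec, THEN spec, THEN spec, THEN mp, THEN mp, THEN mp, THEN mp, THEN mp]
    have main: "\<exists>a. \<forall>x\<in>{0..1}. abs (x - x0) \<le> H \<longrightarrow>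
        vnorm p (\<lambda>j. 1 / (4 + (\<Sum>k<p. f x k * g x k)) * f x j - vpoly t a (x - x0) j)
          \<le> abs C * sqrt (real p) * abs (x - x0) powr d"
      if f: "\<forall>j<p. holder_class t r Dc Lc (\<lambda>u. f u j)" and g: "\<forall>j<p. holder_class t r Dc' Lc' (\<lambda>u. g u j)"
       and M: "\<forall>u\<in>{0..1}. vnorm p (f u) \<le> M" "\<forall>u\<in>{0..1}. vnorm p (g u) \<le> M'"
       and s: "\<forall>u\<in>{0..1}. 0 \<le> (\<Sum>k<p. f u k * g u k)"
       and x0: "x0 \<in> {0..1}" and H: "0 < H" "H \<le> 1" and pH: "sqrt (real p) * H powr d = 1"
      for p x0 H and f g :: "real \<Rightarrow> nat \<Rightarrow> real"
    proof -
      let ?Y = "{y. abs y \<le> 1 \<and> x0 + H * y \<in> {0..1}}"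
      let ?th = "\<lambda>x j. 1 / (4 + (\<Sum>k<p. f x k * g x k)) * f x j"
      have jf: "jetv t d p ?Y (max C1 C2) (\<lambda>y. f (x0 + H * y))"
        by (rule jetv_mono[OF C1(2)[OF f M(1) x0 H eq_refl[OF pH]] max.cobounded1])
      have jg: "jetv t d p ?Y (max C1 C2) (\<lambda>y. g (x0 + H * y))"
        by (rule jetv_mono[OF C2(2)[OF g M(2) x0 H eq_refl[OF pH]] max.cobounded2])
      have Y: "?Y \<subseteq> {-1..1}" "0 \<in> ?Y" using x0 by (auto simp: abs_le_iff)
      have "jetv t d p ?Y C (\<lambda>y. ?th (x0 + H * y))"
        by (rule C[OF Y _ jf jg]) (use s in auto)
      then obtain b where b: "\<And>y. y \<in> ?Y \<Longrightarrow> vnorm p (\<lambda>j. ?th (x0 + H * y) j - vpoly t b y j) \<le> C * abs y powr d"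
        unfolding jetv_def by blast
      show ?thesis
      proof (intro exI[of _ "\<lambda>l j. b l j / H ^ l"] ballI impI)
        fix x :: real assume x: "x \<in> {0..1}" "abs (x - x0) \<le> H"
        define y where "y = (x - x0) / H"
        have xy: "x0 + H * y = x" using H by (simp add: y_def)
        have y: "y \<in> ?Y" using x H by (simp add: xy y_def abs_divide)
        have sq: "1 / H powr d = sqrt (real p)" using pH H by (simp add: field_simps)
        have "(\<Sum>l\<le>t. b l j / H ^ l * (x - x0) ^ l) = vpoly t b y j" for j
          by (simp add: y_def power_divide)
        hence "vnorm p (\<lambda>j. ?th x j - (\<Sum>l\<le>t. b l j / H ^ l * (x - x0) ^ l)) \<le> C * abs y powr d"
          using b[OF y] unfolding xy by simp
        also have "... \<le> abs C * abs y powr d" by (intro mult_right_mono) auto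
        also have "abs y powr d = (1 / H powr d) * abs (x - x0) powr d"
          using H by (simp add: y_def abs_divide powr_divide)
        finally show "vnorm p (\<lambda>j. ?th x j - (\<Sum>l\<le>t. b l j / H ^ l * (x - x0) ^ l))
            \<le> abs C * sqrt (real p) * abs (x - x0) powr d" unfolding sq by simp
      qed
    qed
    show thesis by (rule that[OF abs_ge_zero main])
  qed
qed

text \<open>The \<open>k\<close>-th coefficient is that of the Taylor polynomial at the knot \<open>tk k\<close>. At a point \<open>x\<close> of the support it
  is compared with the coefficient of the Taylor polynomial at \<open>x\<close>, whose value at \<open>x\<close> is exact.\<close>

lemma spline_quasi_interpolation:
  assumes d0: "0 < d"
  obtains C where "0 \<le> C"
    and "\<And>m K xi p h A (f :: real \<Rightarrow> nat \<Rightarrow> real). \<lbrakk>spline_knots m K xi; t < m;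
      \<forall>k. knotvec m K xi (k + m) - knotvec m K xi k \<le> h; 0 < h; h \<le> 1/2; 0 \<le> A;
      \<forall>x0\<in>{0..1}. \<exists>a. \<forall>x\<in>{0..1}. abs (x - x0) \<le> 2 * h \<longrightarrow>
        vnorm p (\<lambda>j. f x j - vpoly t a (x - x0) j) \<le> A * abs (x - x0) powr d\<rbrakk> \<Longrightarrow>
      \<exists>v. \<forall>x. 0 \<le> x \<longrightarrow> x < 1 \<longrightarrow>
        vnorm p (\<lambda>j. f x j - (\<Sum>k<K + m. v k j * bspl (knotvec m K xi) m k x)) \<le> C * A * h powr d"
proof -
  obtain C0 where C0: "C0 \<ge> 0" and C0b: "\<And>p (a :: nat \<Rightarrow> nat \<Rightarrow> real) B l.
     (\<forall>x\<in>{0..1}. vnorm p (\<lambda>j. vpoly t a x j) \<le> B) \<Longrightarrow> l \<le> t \<Longrightarrow> vnorm p (a l) \<le> C0 * B"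
    using vpoly_coeff_bound[of t] by blast
  define C where "C = (real t + 1) * (C0 * (2 * 2 powr d))"
  have main: "\<exists>v. \<forall>x. 0 \<le> x \<longrightarrow> x < 1 \<longrightarrow> vnorm p (\<lambda>j. f x j - (\<Sum>k<K + m. v k j * bspl (knotvec m K xi) m k x)) \<le> C * A * h powr d"
    if "spline_knots m K xi" and tm: "t < m" and gap: "\<forall>k. knotvec m K xi (k + m) - knotvec m K xi k \<le> h"
      and h: "0 < h" "h \<le> 1/2" and A: "0 \<le> A"
      and tay: "\<forall>x0\<in>{0..1}. \<exists>a. \<forall>x\<in>{0..1}. abs (x - x0) \<le> 2 * h \<longrightarrow>
        vnorm p (\<lambda>j. f x j - vpoly t a (x - x0) j) \<le> A * abs (x - x0) powr d"
    for m K xi p h A and f :: "real \<Rightarrow> nat \<Rightarrow> real"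
  proof -
    interpret spline_knots m K xi by fact
    obtain a where a: "\<And>x0 x. x0 \<in> {0..1} \<Longrightarrow> x \<in> {0..1} \<Longrightarrow> abs (x - x0) \<le> 2 * h \<Longrightarrow>
        vnorm p (\<lambda>j. f x j - vpoly t (a x0) (x - x0) j) \<le> A * abs (x - x0) powr d"
      using bchoice[OF tay] by blast
    define v where "v k j = (\<Sum>l\<le>t. a (tk k) l j * cf k l (tk k))" for k j
    have tk01: "tk k \<in> {0..1}" for k using tk_nonneg tk_le_1 by simp
    show ?thesis
    proof (intro exI[of _ v] allI impI)
      fix x :: real assume x: "0 \<le> x" "x < 1"
      have x01: "x \<in> {0..1}" using x by simp
      define b where "b k l j = (\<Sum>i\<le>t. a x i j * (real (i choose l) * (tk k - x) ^ (i - l)))" for k l j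
      have rec: "vpoly t (b k) (y - tk k) j = (\<Sum>i\<le>t. a x i j * (y - x) ^ i)" for k j y
      proof -
        have "(\<Sum>l\<le>i. real (i choose l) * (tk k - x) ^ (i - l) * (y - tk k) ^ l) = (y - x) ^ i" for i
          using binomial_ring[of "y - tk k" "tk k - x" i] by (simp add: mult_ac)
        thus ?thesis unfolding b_def sum_binomial_recenter by simp
      qed
      have cfr: "(\<Sum>l\<le>t. b k l j * cf k l (tk k)) = (\<Sum>i\<le>t. a x i j * cf k i x)" if k: "k < K + m" for k j
        unfolding b_def sum_binomial_recenter using k tm cf_recenter[of _ k x "tk k"] by (intro sum.cong) auto
      have fx: "f x j = (\<Sum>k<K + m. Bs k x * (\<Sum>l\<le>t. b k l j * cf k l (tk k)))" if j: "j < p" for j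
      proof -
        have "vnorm p (\<lambda>j. f x j - vpoly t (a x) (x - x) j) \<le> 0"
          using a[OF x01 x01] h d0 by simp
        hence "(\<Sum>j<p. (f x j - vpoly t (a x) (x - x) j)^2) \<le> 0"
          unfolding vnorm_def by simp
        hence "(\<Sum>j<p. (f x j - vpoly t (a x) (x - x) j)^2) = 0"
          by (intro antisym sum_nonneg) auto
        hence "(f x j - vpoly t (a x) (x - x) j)^2 = 0"
          using j by (subst (asm) sum_nonneg_eq_0_iff) auto
        hence "f x j = vpoly t (a x) (x - x) j" by simp
        also have "... = (\<Sum>l\<le>t. a x l j * (\<Sum>k<K + m. cf k l x * Bs k x))"
          using tm power_eq_spline[OF x, of _ x] by (intro sum.cong) auto
        also have "... = (\<Sum>k<K + m. Bs k x * (\<Sum>l\<le>t. a x l j * cf k l x))"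
          unfolding sum_distrib_left by (subst sum.swap) (simp add: mult_ac)
        also have "... = (\<Sum>k<K + m. Bs k x * (\<Sum>l\<le>t. b k l j * cf k l (tk k)))" by (simp add: cfr)
        finally show ?thesis .
      qed
      define R where "R k l j = b k l j - a (tk k) l j" for k l j
      define E where "E = C0 * (2 * A * (2 * h) powr d)"
      have E: "E \<ge> 0" using C0 A by (simp add: E_def)
      have R: "vnorm p (R k l) * h ^ l \<le> E" if B: "Bs k x \<noteq> 0" and l: "l \<le> t" for k l
      proof -
        have xk: "tk k \<le> x" "x < tk (k + m)" using bspl_support[OF x(2) B] by auto
        have xk': "abs (x - tk k) \<le> h" using xk gap[rule_format, of k] by simp
        have Rb: "vnorm p (\<lambda>j. vpoly t (R k) (y - tk k) j) \<le> 2 * A * (2 * h) powr d"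
          if y: "y \<in> {0..1}" "abs (y - tk k) \<le> h" for y
        proof -
          have yx: "abs (y - x) \<le> 2 * h" using y xk' by linarith
          have "(\<lambda>j. vpoly t (R k) (y - tk k) j)
              = (\<lambda>j. (f y j - vpoly t (a (tk k)) (y - tk k) j) - (f y j - vpoly t (a x) (y - x) j))"
            by (simp add: R_def left_diff_distrib sum_subtractf rec)
          hence "vnorm p (\<lambda>j. vpoly t (R k) (y - tk k) j)
              \<le> vnorm p (\<lambda>j. f y j - vpoly t (a (tk k)) (y - tk k) j) + vnorm p (\<lambda>j. f y j - vpoly t (a x) (y - x) j)"
            using vnorm_diff[of p "\<lambda>j. f y j - vpoly t (a (tk k)) (y - tk k) j" "\<lambda>j. f y j - vpoly t (a x) (y - x) j"]
            by simp
          also have "... \<le> A * abs (y - tk k) powr d + A * abs (y - x) powr d"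
            using y h yx x01 tk01 by (intro add_mono a) auto
          also have "... \<le> A * (2 * h) powr d + A * (2 * h) powr d"
            using y h yx A d0 by (intro add_mono mult_left_mono powr_mono2) auto
          finally show ?thesis by simp
        qed
        define sg where "sg = (if tk k \<le> 1/2 then h else - h)"
        have "vnorm p (\<lambda>j. sg ^ l * R k l j) \<le> C0 * (2 * A * (2 * h) powr d)"
        proof (rule C0b[OF _ l, of p "\<lambda>l j. sg ^ l * R k l j"], intro ballI)
          fix s :: real assume s: "s \<in> {0..1}"
          have "0 \<le> h * s" "h * s \<le> h" using s h by (auto simp: mult_left_le)
          hence hs: "0 \<le> h * s" "h * s \<le> h" "h * s \<le> 1/2" using h(2) by linarith+
          have "tk k + sg * s \<in> {0..1}" "\<bar>sg * s\<bar> \<le> h"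
            using hs tk01[of k] by (auto simp: sg_def)
          hence "vnorm p (\<lambda>j. vpoly t (R k) (sg * s) j) \<le> 2 * A * (2 * h) powr d"
            using Rb[of "tk k + sg * s"] by simp
          thus "vnorm p (\<lambda>j. \<Sum>l\<le>t. sg ^ l * R k l j * s ^ l) \<le> 2 * A * (2 * h) powr d"
            by (simp add: power_mult_distrib mult_ac)
        qed
        moreover have "\<bar>sg ^ l\<bar> = h ^ l" using h by (simp add: sg_def power_abs)
        ultimately show ?thesis unfolding vnorm_scale E_def by (simp add: mult.commute)
      qed
      have cfb: "abs (cf k l (tk k)) \<le> h ^ l" if l: "l \<le> t" for k l
      proof (rule cf_bound)
        fix j assume "1 \<le> j" "j < m"
        thus "\<bar>tk (k + j) - tk k\<bar> \<le> h"
          using gap[rule_format, of k] tk_mono[of k "k + j"] tk_mono[of "k + j" "k + m"] by simp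
      qed (use l tm h in auto)
      have diff: "f x j - (\<Sum>k<K + m. v k j * Bs k x) = (\<Sum>k<K + m. \<Sum>l\<le>t. Bs k x * cf k l (tk k) * R k l j)"
        if "j < p" for j
        unfolding fx[OF that] v_def R_def
        by (simp add: sum_subtractf[symmetric] sum_distrib_left sum_distrib_right algebra_simps)
      have "vnorm p (\<lambda>j. f x j - (\<Sum>k<K + m. v k j * Bs k x))
          = vnorm p (\<lambda>j. \<Sum>k<K + m. \<Sum>l\<le>t. Bs k x * cf k l (tk k) * R k l j)"
        using diff by (intro vnorm_cong) auto
      also have "... \<le> (\<Sum>k<K + m. vnorm p (\<lambda>j. \<Sum>l\<le>t. Bs k x * cf k l (tk k) * R k l j))"
        by (rule vnorm_sum) simp
      also have "... \<le> (\<Sum>k<K + m. \<Sum>l\<le>t. vnorm p (\<lambda>j. Bs k x * cf k l (tk k) * R k l j))"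
        by (intro sum_mono vnorm_sum) simp
      also have "... \<le> (\<Sum>k<K + m. \<Sum>l\<le>t. Bs k x * E)"
      proof (intro sum_mono)
        fix k l assume l: "l \<in> {..t}"
        have B0: "0 \<le> Bs k x" by (rule bspl_nonneg[OF x(2)])
        have "abs (cf k l (tk k)) * vnorm p (R k l) \<le> E" if "Bs k x \<noteq> 0"
        proof -
          have "abs (cf k l (tk k)) * vnorm p (R k l) \<le> h ^ l * vnorm p (R k l)"
            using cfb[of l k] l by (intro mult_right_mono) auto
          also have "... \<le> E" using R[OF that, of l] l by (simp add: mult.commute)
          finally show ?thesis .
        qed
        hence "Bs k x * (abs (cf k l (tk k)) * vnorm p (R k l)) \<le> Bs k x * E"
          using B0 by (cases "Bs k x = 0") (auto intro!: mult_left_mono)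
        thus "vnorm p (\<lambda>j. Bs k x * cf k l (tk k) * R k l j) \<le> Bs k x * E"
          using B0 by (simp add: vnorm_scale abs_mult mult.assoc)
      qed
      also have "... = (real t + 1) * E * (\<Sum>k<K + m. Bs k x)"
        by (simp add: sum_distrib_left mult_ac add.commute)
      also have "... = (real t + 1) * E" using partition_of_unity[OF x] by simp
      also have "... = C * A * h powr d" using h by (simp add: E_def C_def powr_mult)
      finally show "vnorm p (\<lambda>j. f x j - (\<Sum>k<K + m. v k j * Bs k x)) \<le> C * A * h powr d" .
    qed
  qed
  have "0 \<le> C" using C0 by (simp add: C_def)
  thus thesis using main by (rule that)
qed

section \<open>The least-squares minimiser\<close>

lemma gaussian_square_integral:
  assumes sym: "\<forall>i<n. \<forall>j<n. S i j = S j i"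
    and pos: "\<And>v. \<exists>i<n. v i \<noteq> 0 \<Longrightarrow> 0 < quad n S v"
  shows "integral\<^sup>L (gaussian n mm S) (\<lambda>x. (z - (\<Sum>j<n. \<theta> j * (x j - a j)))^2)
    = z^2 - 2 * z * (\<Sum>j<n. \<theta> j * (mm j - a j)) + quad n S \<theta> + (\<Sum>j<n. \<theta> j * (mm j - a j))^2"
proof -
  let ?G = "gaussian n mm S"
  note mom = gaussian_moments[OF sym, where mm = mm]
  have 1: "has_bochner_integral ?G (\<lambda>x. z^2 * 1) (z^2 * 1)"
    by (intro has_bochner_integral_mult_right mom(1)) (rule pos)
  have 2: "has_bochner_integral ?G (\<lambda>x. (-2 * z) * (\<Sum>j<n. \<theta> j * (x j - a j))) ((-2 * z) * (\<Sum>j<n. \<theta> j * (mm j - a j)))"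
    by (intro has_bochner_integral_mult_right has_bochner_integral_sum mom(2)) (auto intro: pos)
  have 3: "has_bochner_integral ?G (\<lambda>x. \<Sum>i<n. \<Sum>j<n. (\<theta> i * \<theta> j) * ((x i - a i) * (x j - a j)))
      (\<Sum>i<n. \<Sum>j<n. (\<theta> i * \<theta> j) * (S i j + (mm i - a i) * (mm j - a j)))"
    by (intro has_bochner_integral_mult_right has_bochner_integral_sum mom(3)) (auto intro: pos)
  have eq: "z^2 * 1 + (-2 * z) * (\<Sum>j<n. \<theta> j * (x j - a j)) + (\<Sum>i<n. \<Sum>j<n. (\<theta> i * \<theta> j) * ((x i - a i) * (x j - a j)))
      = (z - (\<Sum>j<n. \<theta> j * (x j - a j)))^2" for x
  proof -
    have "(\<Sum>i<n. \<Sum>j<n. (\<theta> i * \<theta> j) * ((x i - a i) * (x j - a j))) = (\<Sum>j<n. \<theta> j * (x j - a j)) * (\<Sum>j<n. \<theta> j * (x j - a j))"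
      unfolding sum_product by (simp add: mult_ac)
    thus ?thesis by (simp add: power2_eq_square algebra_simps)
  qed
  have "(\<Sum>i<n. \<Sum>j<n. (\<theta> i * \<theta> j) * (S i j + (mm i - a i) * (mm j - a j)))
      = quad n S \<theta> + (\<Sum>j<n. \<theta> j * (mm j - a j)) * (\<Sum>j<n. \<theta> j * (mm j - a j))"
    unfolding sum_product quad_def sum.distrib[symmetric] by (intro sum.cong refl) (simp add: algebra_simps)
  with has_bochner_integral_integral_eq[OF has_bochner_integral_add[OF has_bochner_integral_add[OF 1 2] 3]]
  show ?thesis unfolding eq by (simp add: power2_eq_square algebra_simps)
qed

definition Acov :: "(real \<Rightarrow> nat \<Rightarrow> real) \<Rightarrow> (real \<Rightarrow> nat \<Rightarrow> real) \<Rightarrow> (real \<Rightarrow> nat \<Rightarrow> nat \<Rightarrow> real)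
    \<Rightarrow> real \<Rightarrow> nat \<Rightarrow> nat \<Rightarrow> real" where
  "Acov mu1 mu2 Sig u i j = Sig u i j + (mu1 u i - mu2 u i) * (mu1 u j - mu2 u j) / 4"

lemma mid_diff: "mu1 u j - mid mu1 mu2 u j = (mu1 u j - mu2 u j) / 2"
  "mu2 u j - mid mu1 mu2 u j = - ((mu1 u j - mu2 u j) / 2)"
  by (simp_all add: mid_def field_simps)

lemma quad_Acov:
  "quad p (Acov mu1 mu2 Sig u) v = quad p (Sig u) v + (\<Sum>j<p. v j * (mu1 u j - mu2 u j))^2 / 4"
proof -
  have "(\<Sum>j<p. v j * (mu1 u j - mu2 u j))^2 / 4
      = (\<Sum>i<p. \<Sum>j<p. v i * ((mu1 u i - mu2 u i) * (mu1 u j - mu2 u j) / 4) * v j)"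
    unfolding power2_eq_square sum_product sum_divide_distrib by (intro sum.cong refl) simp
  thus ?thesis unfolding quad_def Acov_def sum.distrib[symmetric]
    by (simp add: sum.distrib[symmetric] algebra_simps)
qed

context
  fixes p :: nat and mu1 mu2 :: "real \<Rightarrow> nat \<Rightarrow> real" and Sig :: "real \<Rightarrow> nat \<Rightarrow> nat \<Rightarrow> real" and u :: real
  assumes sym: "\<forall>i<p. \<forall>j<p. Sig u i j = Sig u j i"
    and pos: "\<And>v. \<exists>i<p. v i \<noteq> 0 \<Longrightarrow> 0 < quad p (Sig u) v"
begin

lemma condE_prod:
  assumes "i < p" "j < p"
  shows "condE p mu1 mu2 Sig u (\<lambda>y x. (x i - mid mu1 mu2 u i) * (x j - mid mu1 mu2 u j)) = Acov mu1 mu2 Sig u i j"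
  using has_bochner_integral_integral_eq[OF gaussian_moments(3)[OF sym pos assms]]
  unfolding condE_def Acov_def by (simp add: mid_diff)

lemma condE_Z:
  assumes "i < p"
  shows "condE p mu1 mu2 Sig u (\<lambda>y x. (x i - mid mu1 mu2 u i) * c * Zval y) = c * (mu1 u i - mu2 u i) / 4"
  using has_bochner_integral_integral_eq[OF gaussian_moments(2)[OF sym pos assms]]
  unfolding condE_def by (simp add: mid_diff Zval_def mult.assoc)

lemma lsq_risk_eq:
  "lsq_risk p mu1 mu2 Sig u \<theta> = 1/4 - (\<Sum>j<p. \<theta> j * (mu1 u j - mu2 u j)) / 2 + quad p (Acov mu1 mu2 Sig u) \<theta>"
proof -
  have s: "(\<Sum>j<p. \<theta> j * ((mu1 u j - mu2 u j) / 2)) = (\<Sum>j<p. \<theta> j * (mu1 u j - mu2 u j)) / 2"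
    "(\<Sum>j<p. \<theta> j * (- ((mu1 u j - mu2 u j) / 2))) = - ((\<Sum>j<p. \<theta> j * (mu1 u j - mu2 u j)) / 2)"
    by (simp_all add: sum_divide_distrib sum_negf)
  have gs: "integral\<^sup>L (gaussian p mm (Sig u)) (\<lambda>x. (z - (\<Sum>j<p. \<theta> j * (x j - a j)))^2)
    = z^2 - 2 * z * (\<Sum>j<p. \<theta> j * (mm j - a j)) + quad p (Sig u) \<theta> + (\<Sum>j<p. \<theta> j * (mm j - a j))^2" for mm z a
    by (rule gaussian_square_integral[OF sym]) (rule pos)
  show ?thesis
    unfolding lsq_risk_def condE_def quad_Acov gs mid_diff s
    by (simp add: Zval_def power2_eq_square field_simps)
qed

lemma minimiser_eq:
  assumes beta: "\<And>i. i < p \<Longrightarrow> (\<Sum>j<p. Sig u i j * b j) = mu1 u i - mu2 u i"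
    and min: "\<And>\<theta>. lsq_risk p mu1 mu2 Sig u th \<le> lsq_risk p mu1 mu2 Sig u \<theta>"
  defines "s \<equiv> \<Sum>k<p. b k * (mu1 u k - mu2 u k)"
  shows "0 \<le> s" and "i < p \<Longrightarrow> th i = 1 / (4 + s) * b i"
    and "i < p \<Longrightarrow> (\<Sum>j<p. Acov mu1 mu2 Sig u i j * th j) = (mu1 u i - mu2 u i) / 4"
proof -
  let ?A = "Acov mu1 mu2 Sig u"
  have quadS: "0 \<le> quad p (Sig u) v" for v
    using pos[of v] by (cases "\<exists>i<p. v i \<noteq> 0") (auto simp: quad_def)
  have sq: "s = quad p (Sig u) b" unfolding s_def quad_eq_sum using beta by (intro sum.cong) auto
  show s0: "0 \<le> s" unfolding sq by (rule quadS)
  define t0 where "t0 i = 1 / (4 + s) * b i" for i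
  have At0: "(\<Sum>j<p. ?A i j * t0 j) = (mu1 u i - mu2 u i) / 4" if i: "i < p" for i
  proof -
    have "(\<Sum>j<p. ?A i j * t0 j) = 1 / (4 + s) * ((\<Sum>j<p. Sig u i j * b j) + (mu1 u i - mu2 u i) / 4 * s)"
    proof -
      have "?A i j * t0 j = 1 / (4 + s) * (Sig u i j * b j) + 1 / (4 + s) * ((mu1 u i - mu2 u i) / 4) * (b j * (mu1 u j - mu2 u j))" for j
      proof -
        have "(S + x * y / 4) * (k * c) = k * (S * c) + k * (x / 4) * (c * y)" for S x y k c :: real
          by (simp add: field_simps)
        thus ?thesis unfolding t0_def Acov_def .
      qed
      hence "(\<Sum>j<p. ?A i j * t0 j) = 1 / (4 + s) * (\<Sum>j<p. Sig u i j * b j) + 1 / (4 + s) * ((mu1 u i - mu2 u i) / 4) * s"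
        unfolding s_def by (simp only: sum.distrib sum_distrib_left)
      thus ?thesis by (simp add: distrib_left)
    qed
    also have "... = 1 / (4 + s) * ((mu1 u i - mu2 u i) * (4 + s) / 4)"
      unfolding beta[OF i] by (simp add: field_simps)
    also have "... = (mu1 u i - mu2 u i) / 4" using s0 by simp
    finally show ?thesis .
  qed
  have symA: "\<forall>i<p. \<forall>j<p. ?A i j = ?A j i" using sym by (simp add: Acov_def)
  define w where "w i = th i - t0 i" for i
  have "quad p ?A th = quad p ?A (\<lambda>i. t0 i + 1 * w i)" by (simp add: w_def)
  also have "... = quad p ?A t0 + 2 * (\<Sum>i<p. w i * (\<Sum>j<p. ?A i j * t0 j)) + quad p ?A w"
    unfolding quad_add[OF symA] by simp
  also have "(\<Sum>i<p. w i * (\<Sum>j<p. ?A i j * t0 j)) = (\<Sum>i<p. w i * (mu1 u i - mu2 u i)) / 4"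
    by (simp add: At0 sum_divide_distrib)
  finally have q: "quad p ?A th = quad p ?A t0 + (\<Sum>i<p. w i * (mu1 u i - mu2 u i)) / 2 + quad p ?A w" by simp
  have "(\<Sum>i<p. w i * (mu1 u i - mu2 u i)) = (\<Sum>i<p. th i * (mu1 u i - mu2 u i)) - (\<Sum>i<p. t0 i * (mu1 u i - mu2 u i))"
    by (simp add: w_def left_diff_distrib sum_subtractf)
  hence "quad p ?A w \<le> 0" using min[of t0] q unfolding lsq_risk_eq by argo
  hence "quad p (Sig u) w \<le> 0" unfolding quad_Acov by (smt (verit) zero_le_power2 divide_nonneg_nonneg)
  hence w0: "\<forall>i<p. w i = 0" using pos[of w] by force
  thus th: "i < p \<Longrightarrow> th i = 1 / (4 + s) * b i" for i by (simp add: w_def t0_def)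
  show "(\<Sum>j<p. ?A i j * th j) = (mu1 u i - mu2 u i) / 4" if i: "i < p" for i
    using At0[OF i] w0 by (simp add: w_def)
qed

end

definition unitM :: "real measure" where "unitM = restrict_space lborel {0..1}"

lemma space_unitM [simp]: "space unitM = {0..1}"
  by (simp add: unitM_def space_restrict_space)

lemma finite_measure_unitM: "finite_measure unitM"
  by (rule finite_measureI) (simp add: unitM_def space_restrict_space emeasure_restrict_space)

lemma set_integral_unitM: "(LINT u:{0..1}|lborel. f u) = integral\<^sup>L unitM f" for f :: "real \<Rightarrow> real"
  unfolding unitM_def set_lebesgue_integral_def by (subst integral_restrict_space) auto

definition nice :: "(real \<Rightarrow> real) \<Rightarrow> bool" where
  "nice f \<longleftrightarrow> f \<in> borel_measurable unitM \<and> (\<exists>C. \<forall>u\<in>{0..1}. abs (f u) \<le> C)"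

lemma nice_integrable: "nice f \<Longrightarrow> integrable unitM f"
proof -
  assume "nice f"
  then obtain C where C: "\<forall>u\<in>{0..1}. abs (f u) \<le> C" and m: "f \<in> borel_measurable unitM"
    unfolding nice_def by blast
  have "AE u in unitM. norm (f u) \<le> C" using C by (intro AE_I2) simp
  thus ?thesis using m by (rule finite_measure.integrable_const_bound[OF finite_measure_unitM])
qed

lemma nice_const: "nice (\<lambda>u. c)" unfolding nice_def by auto

lemma nice_add: assumes "nice f" "nice g" shows "nice (\<lambda>u. f u + g u)"
proof -
  obtain C C' where "\<forall>u\<in>{0..1}. abs (f u) \<le> C" "\<forall>u\<in>{0..1}. abs (g u) \<le> C'" using assms unfolding nice_def by blast
  hence "\<forall>u\<in>{0..1}. abs (f u + g u) \<le> C + C'" by (auto intro: order_trans[OF abs_triangle_ineq] add_mono)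
  thus ?thesis using assms unfolding nice_def by auto
qed

lemma nice_mult: assumes "nice f" "nice g" shows "nice (\<lambda>u. f u * g u)"
proof -
  obtain C C' where "\<forall>u\<in>{0..1}. abs (f u) \<le> C" "\<forall>u\<in>{0..1}. abs (g u) \<le> C'" using assms unfolding nice_def by blast
  hence "abs (f u) \<le> abs C" "abs (g u) \<le> abs C'" if "u \<in> {0..1}" for u
    using that by (meson abs_ge_self order_trans)+
  hence "\<forall>u\<in>{0..1}. abs (f u * g u) \<le> abs C * abs C'"
    unfolding abs_mult by (intro ballI mult_mono) auto
  thus ?thesis using assms unfolding nice_def by auto
qed

lemma nice_diff: "nice f \<Longrightarrow> nice g \<Longrightarrow> nice (\<lambda>u. f u - g u)"
  using nice_add[of f "\<lambda>u. (-1) * g u"] nice_mult[OF nice_const, of g "-1"] by simp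

lemma nice_sum: "(\<And>i. i \<in> I \<Longrightarrow> nice (f i)) \<Longrightarrow> nice (\<lambda>u. \<Sum>i\<in>I. f i u)"
proof (induction I rule: infinite_finite_induct)
  case (insert x F)
  thus ?case using nice_add[of "f x" "\<lambda>u. \<Sum>i\<in>F. f i u"] by simp
qed (auto simp: nice_const)

lemma nice_power2: "nice f \<Longrightarrow> nice (\<lambda>u. (f u)^2)"
  unfolding power2_eq_square by (rule nice_mult)

lemma nice_borel:
  assumes "f \<in> borel_measurable borel" "\<And>u. u \<in> {0..1} \<Longrightarrow> abs (f u) \<le> C"
  shows "nice f"
proof -
  have "f \<in> borel_measurable unitM" unfolding unitM_def using assms(1) by (intro measurable_restrict_space1) simp
  thus ?thesis unfolding nice_def using assms(2) by blast
qed

lemma nice_continuous: assumes "continuous_on {0..1} f" shows "nice f"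
proof -
  have "f \<in> borel_measurable (restrict_space borel {0..1})" by (rule borel_measurable_continuous_on_restrict[OF assms])
  moreover have "borel_measurable (restrict_space borel {0..1}) = (borel_measurable unitM :: (real \<Rightarrow> real) set)"
    unfolding unitM_def by (intro measurable_cong_sets sets_restrict_space_cong) auto
  moreover have "compact (f ` {0..1})" by (intro compact_continuous_image assms) auto
  hence "bounded (f ` {0..1})" by (rule compact_imp_bounded)
  then obtain C where "\<forall>u\<in>{0..1}. abs (f u) \<le> C" unfolding bounded_iff by auto
  ultimately show ?thesis unfolding nice_def by (intro conjI exI[of _ C]) auto
qed

lemma nice_cong: "(\<And>u. u \<in> {0..1} \<Longrightarrow> f u = g u) \<Longrightarrow> nice f \<longleftrightarrow> nice g"
  unfolding nice_def using measurable_cong[of unitM f g borel] by simp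

lemma sum_block: "(\<Sum>i<p * L. f i) = (\<Sum>j<p. \<Sum>k<L. f (j * L + k))" for f :: "nat \<Rightarrow> real"
proof -
  have "(\<Sum>i<p * L. f i) = (\<Sum>j<p. sum f {j * L..<j * L + L})" by (rule sum.nat_group[symmetric])
  moreover have "sum f {j * L..<j * L + L} = (\<Sum>k<L. f (j * L + k))" for j
    using sum.shift_bounds_nat_ivl[of f 0 "j * L" L] by (simp add: lessThan_atLeast0 add.commute)
  ultimately show ?thesis by simp
qed

lemma AE_unitM_interval:
  assumes AE: "AE u in unitM. P u" and ab: "0 \<le> a" "a < b" "b \<le> 1"
  shows "\<exists>x. a < x \<and> x < b \<and> P x"
proof (rule ccontr)
  assume no: "\<nexists>x. a < x \<and> x < b \<and> P x"
  have "AE u in lborel. u \<in> {0..1} \<longrightarrow> P u" using AE unfolding unitM_def by (subst (asm) AE_restrict_space_iff) auto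
  hence "AE u in lborel. u \<notin> {a<..<b}" by (rule AE_mp) (use no ab in \<open>auto intro!: AE_I2\<close>)
  hence "{a<..<b} \<in> null_sets lborel" by (subst AE_iff_null_sets) auto
  thus False using ab by (simp add: null_sets_def)
qed

section \<open>Quasi-optimality of the population estimator\<close>

locale galerkin = spline_knots m K xi
  for m K :: nat and xi :: "nat \<Rightarrow> real" +
  fixes p :: nat and h :: "real \<Rightarrow> real" and mu1 mu2 :: "real \<Rightarrow> nat \<Rightarrow> real"
    and Sig :: "real \<Rightarrow> nat \<Rightarrow> nat \<Rightarrow> real" and th :: "real \<Rightarrow> nat \<Rightarrow> real"
    and lam0 lam1 D1 D2 M :: real
  assumes lam: "0 < lam0" and D1: "0 < D1"
    and sym: "\<And>u. u \<in> {0..1} \<Longrightarrow> \<forall>i<p. \<forall>j<p. Sig u i j = Sig u j i"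
    and Sig_meas: "\<And>i j. (\<lambda>u. Sig u i j) \<in> borel_measurable borel"
    and ell: "\<And>u v. u \<in> {0..1} \<Longrightarrow> lam0 * sqn p v \<le> quad p (Sig u) v"
    and ell': "\<And>u v. u \<in> {0..1} \<Longrightarrow> quad p (Sig u) v \<le> lam1 * sqn p v"
    and h_meas: "h \<in> borel_measurable borel"
    and h_bd: "\<And>u. u \<in> {0..1} \<Longrightarrow> D1 \<le> h u \<and> h u \<le> D2"
    and mu1: "\<And>j. j < p \<Longrightarrow> nice (\<lambda>u. mu1 u j)" and mu2: "\<And>j. j < p \<Longrightarrow> nice (\<lambda>u. mu2 u j)"
    and th: "\<And>j. j < p \<Longrightarrow> nice (\<lambda>u. th u j)"
    and Ath: "\<And>u i. u \<in> {0..1} \<Longrightarrow> i < p \<Longrightarrow>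
       (\<Sum>j<p. Acov mu1 mu2 Sig u i j * th u j) = (mu1 u i - mu2 u i) / 4"
    and dM: "\<And>u. u \<in> {0..1} \<Longrightarrow> vnorm p (\<lambda>j. mu1 u j - mu2 u j) \<le> M"
begin

abbreviation L :: nat where "L \<equiv> K + m"
abbreviation A :: "real \<Rightarrow> nat \<Rightarrow> nat \<Rightarrow> real" where "A \<equiv> Acov mu1 mu2 Sig"
abbreviation Bk :: "nat \<Rightarrow> real \<Rightarrow> real" where "Bk \<equiv> Bsc m K xi"
abbreviation DD :: "nat \<Rightarrow> nat \<Rightarrow> real" where "DD \<equiv> Dmat p m K xi h mu1 mu2 Sig"
abbreviation gam :: "nat \<Rightarrow> real" where "gam \<equiv> gamma_til p m K xi h mu1 mu2 Sig"
abbreviation th_til :: "real \<Rightarrow> nat \<Rightarrow> real" where "th_til \<equiv> theta_til p m K xi h mu1 mu2 Sig"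
abbreviation bil :: "real \<Rightarrow> (nat \<Rightarrow> real) \<Rightarrow> (nat \<Rightarrow> real) \<Rightarrow> real" where
  "bil u v w \<equiv> \<Sum>i<p. v i * (\<Sum>j<p. A u i j * w j)"
abbreviation bb :: "nat \<Rightarrow> real" where "bb \<equiv> bvec p m K xi h mu1 mu2 Sig"

definition spl :: "(nat \<Rightarrow> real) \<Rightarrow> real \<Rightarrow> nat \<Rightarrow> real" where
  "spl w u j = (\<Sum>k<L. w (j * L + k) * Bk k u)"

lemma L_pos: "0 < L" using m_pos by simp

lemma posS: "u \<in> {0..1} \<Longrightarrow> \<exists>i<p. v i \<noteq> 0 \<Longrightarrow> 0 < quad p (Sig u) v"
  using lam ell by (rule quad_pos_if_elliptic)

lemma nice_h: "nice h"
proof (rule nice_borel[OF h_meas, of "abs D1 + abs D2"])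
  fix u :: real assume "u \<in> {0..1}"
  from h_bd[OF this] show "abs (h u) \<le> abs D1 + abs D2" by linarith
qed

lemma nice_Sig: assumes "i < p" "j < p" shows "nice (\<lambda>u. Sig u i j)"
proof (rule nice_borel[OF Sig_meas, of _ _ "lam1"])
  fix u :: real assume u: "u \<in> {0..1}"
  define e :: "nat \<Rightarrow> nat \<Rightarrow> real" where "e = (\<lambda>i k. if k = i then 1 else 0)"
  have es: "(\<Sum>k<p. e i k * f k) = f i" if "i < p" for i f
    using that by (simp add: e_def if_distrib[of "\<lambda>x. x * _"] cong: if_cong)
  have es': "(\<Sum>k<p. f k * e i k) = f i" if "i < p" for i f
    using es[OF that, of f] by (simp add: mult.commute)
  have e2: "sqn p (e i) = 1" if "i < p" for i
    using es[OF that, of "e i"] by (simp add: power2_eq_square) (simp add: e_def)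
  have q: "0 \<le> quad p (Sig u) v" for v
    using ell[OF u, of v] lam by (smt (verit) mult_nonneg_nonneg sum_nonneg zero_le_power2)
  have up: "quad p (Sig u) (e i) \<le> lam1" if "i < p" for i using ell'[OF u, of "e i"] e2[OF that] by simp
  have "0 \<le> quad p (Sig u) (e i) + 2 * s * Sig u j i + s^2 * quad p (Sig u) (e j)" for s
    using q[of "\<lambda>k. e i k + s * e j k"] unfolding quad_add[OF sym[OF u]] es[OF assms(2)] es'[OF assms(1)] .
  from this[of 1] this[of "-1"] up[OF assms(1)] up[OF assms(2)]
  show "abs (Sig u i j) \<le> lam1" using sym[OF u] assms by (simp add: abs_le_iff)
qed

lemma nice_delta: "j < p \<Longrightarrow> nice (\<lambda>u. mu1 u j - mu2 u j)"
  by (intro nice_diff mu1 mu2)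

lemma nice_A: assumes "i < p" "j < p" shows "nice (\<lambda>u. A u i j)"
proof -
  have "nice (\<lambda>u. Sig u i j + 1/4 * ((mu1 u i - mu2 u i) * (mu1 u j - mu2 u j)))"
    using assms by (intro nice_add nice_mult nice_const nice_Sig nice_delta)
  thus ?thesis by (simp add: Acov_def)
qed

lemma nice_Bk: "k < L \<Longrightarrow> nice (Bk k)"
proof (rule nice_borel[of _ "sqrt (real L) * (1 + abs (Bs k 1))"])
  show "Bk k \<in> borel_measurable borel" unfolding Bsc_def by measurable
  fix u :: real assume k: "k < L" and u: "u \<in> {0..1}"
  have "abs (Bs k u) \<le> 1 + abs (Bs k 1)"
  proof (cases "u = 1")
    case False
    hence u': "0 \<le> u" "u < 1" using u by auto
    have nn: "0 \<le> Bs l u" for l by (rule bspl_nonneg[OF u'(2)])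
    have "Bs k u \<le> (\<Sum>l<L. Bs l u)" using k nn by (intro member_le_sum) auto
    thus ?thesis using partition_of_unity[OF u'] nn[of k] by simp
  qed simp
  thus "abs (Bk k u) \<le> sqrt (real L) * (1 + abs (Bs k 1))"
    by (simp add: Bsc_def abs_mult mult_left_mono)
qed

lemma nice_spl: "nice (\<lambda>u. spl w u j)"
  unfolding spl_def by (intro nice_sum nice_mult nice_const nice_Bk) auto

lemma div_block_less: "i < p * L \<Longrightarrow> i div L < p"
  by (simp add: less_mult_imp_div_less)

lemma mod_block_less: "i mod L < L" using L_pos by simp

lemma block_div: "k < L \<Longrightarrow> (j * L + k) div L = j" and block_mod: "k < L \<Longrightarrow> (j * L + k) mod L = k"
proof -
  assume k: "k < L"
  have "L \<noteq> 0" using L_pos by simp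
  hence "(j * L + k) div L = j + k div L" by (rule div_mult_self3)
  thus "(j * L + k) div L = j" using k by (simp only: div_less add_0_right)
  show "(j * L + k) mod L = k" using k by (simp only: mod_mult_self3 mod_less)
qed

lemma Dmat_eq:
  assumes "i < p * L" "i' < p * L"
  shows "DD i i' = (\<integral>u. h u * (Bk (i mod L) u * Bk (i' mod L) u * A u (i div L) (i' div L)) \<partial>unitM)"
  unfolding Dmat_def popE_def set_integral_unitM
proof (rule Bochner_Integration.integral_cong)
  fix u assume "u \<in> space unitM"
  hence u: "u \<in> {0..1}" by simp
  have "(\<lambda>y x. Btil m K xi mu1 mu2 i u x * Btil m K xi mu1 mu2 i' u x)
     = (\<lambda>(y::bool) x. Bk (i mod L) u * Bk (i' mod L) u *
        ((x (i div L) - mid mu1 mu2 u (i div L)) * (x (i' div L) - mid mu1 mu2 u (i' div L))))"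
    by (simp add: Btil_def mult_ac)
  moreover have "condE p mu1 mu2 Sig u (\<lambda>y x. c * g y x) = c * condE p mu1 mu2 Sig u g" for c g
    by (simp add: condE_def algebra_simps)
  moreover have "condE p mu1 mu2 Sig u (\<lambda>y x. (x (i div L) - mid mu1 mu2 u (i div L)) * (x (i' div L) - mid mu1 mu2 u (i' div L)))
      = A u (i div L) (i' div L)"
    by (rule condE_prod, rule sym[OF u], erule posS[OF u], rule div_block_less[OF assms(1)], rule div_block_less[OF assms(2)])
  ultimately show "h u * condE p mu1 mu2 Sig u (\<lambda>y x. Btil m K xi mu1 mu2 i u x * Btil m K xi mu1 mu2 i' u x)
      = h u * (Bk (i mod L) u * Bk (i' mod L) u * A u (i div L) (i' div L))"
    by simp
qed simp

lemma bvec_eq: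
  assumes "i < p * L"
  shows "bb i = (\<integral>u. h u * (Bk (i mod L) u * (\<Sum>j<p. A u (i div L) j * th u j)) \<partial>unitM)"
  unfolding bvec_def popE_def set_integral_unitM
proof (rule Bochner_Integration.integral_cong)
  fix u assume "u \<in> space unitM"
  hence u: "u \<in> {0..1}" by simp
  have "condE p mu1 mu2 Sig u (\<lambda>y x. (x (i div L) - mid mu1 mu2 u (i div L)) * c * Zval y)
      = c * (mu1 u (i div L) - mu2 u (i div L)) / 4" for c
    by (rule condE_Z, rule sym[OF u], erule posS[OF u], rule div_block_less[OF assms])
  thus "h u * condE p mu1 mu2 Sig u (\<lambda>y x. Btil m K xi mu1 mu2 i u x * Zval y)
      = h u * (Bk (i mod L) u * (\<Sum>j<p. A u (i div L) j * th u j))"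
    unfolding Btil_def Ath[OF u div_block_less[OF assms]] by simp
qed simp

lemma Dmat_apply:
  assumes i: "i < p * L"
  shows "(\<Sum>i'<p * L. DD i i' * w i') = (\<integral>u. h u * (Bk (i mod L) u * (\<Sum>j<p. A u (i div L) j * spl w u j)) \<partial>unitM)"
proof -
  have "(\<Sum>i'<p * L. DD i i' * w i')
      = (\<Sum>i'<p * L. \<integral>u. h u * (Bk (i mod L) u * Bk (i' mod L) u * A u (i div L) (i' div L)) * w i' \<partial>unitM)"
    using Dmat_eq[OF i] by (intro sum.cong) auto
  also have "... = (\<integral>u. (\<Sum>i'<p * L. h u * (Bk (i mod L) u * Bk (i' mod L) u * A u (i div L) (i' div L)) * w i') \<partial>unitM)"
    by (rule Bochner_Integration.integral_sum[symmetric])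
       (auto intro!: nice_integrable nice_mult nice_const nice_h nice_Bk nice_A div_block_less[OF i] div_block_less mod_block_less)
  also have "... = (\<integral>u. h u * (Bk (i mod L) u * (\<Sum>j<p. A u (i div L) j * spl w u j)) \<partial>unitM)"
  proof (intro Bochner_Integration.integral_cong refl)
    fix u
    show "(\<Sum>i'<p * L. h u * (Bk (i mod L) u * Bk (i' mod L) u * A u (i div L) (i' div L)) * w i')
        = h u * (Bk (i mod L) u * (\<Sum>j<p. A u (i div L) j * spl w u j))"
      unfolding sum_block spl_def sum_distrib_left
      by (intro sum.cong refl) (simp add: block_div block_mod mult_ac)
  qed
  finally show ?thesis .
qed

lemma test_integral:
  assumes g: "\<And>j. j < p \<Longrightarrow> nice (g j)"
  shows "(\<Sum>i<p * L. w i * (\<integral>u. h u * (Bk (i mod L) u * g (i div L) u) \<partial>unitM))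
    = (\<integral>u. h u * (\<Sum>j<p. spl w u j * g j u) \<partial>unitM)"
proof -
  have "(\<Sum>i<p * L. w i * (\<integral>u. h u * (Bk (i mod L) u * g (i div L) u) \<partial>unitM))
      = (\<Sum>i<p * L. \<integral>u. w i * (h u * (Bk (i mod L) u * g (i div L) u)) \<partial>unitM)" by simp
  also have "... = (\<integral>u. (\<Sum>i<p * L. w i * (h u * (Bk (i mod L) u * g (i div L) u))) \<partial>unitM)"
    by (rule Bochner_Integration.integral_sum[symmetric])
       (auto intro!: nice_integrable nice_mult nice_const nice_h nice_Bk g div_block_less mod_block_less)
  also have "... = (\<integral>u. h u * (\<Sum>j<p. spl w u j * g j u) \<partial>unitM)"
  proof (intro Bochner_Integration.integral_cong refl)
    fix u
    show "(\<Sum>i<p * L. w i * (h u * (Bk (i mod L) u * g (i div L) u))) = h u * (\<Sum>j<p. spl w u j * g j u)"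
      unfolding sum_block spl_def sum_distrib_left sum_distrib_right
      by (intro sum.cong refl) (simp add: block_div block_mod mult_ac)
  qed
  finally show ?thesis .
qed

lemma nice_A_apply: "(\<And>j. j < p \<Longrightarrow> nice (\<lambda>u. f u j)) \<Longrightarrow> i < p \<Longrightarrow> nice (\<lambda>u. \<Sum>j<p. A u i j * f u j)"
  by (intro nice_sum nice_mult nice_A) auto

lemma nice_quad: "(\<And>j. j < p \<Longrightarrow> nice (\<lambda>u. f u j)) \<Longrightarrow> nice (\<lambda>u. h u * quad p (A u) (f u))"
  unfolding quad_eq_sum by (intro nice_mult nice_h nice_sum nice_A_apply) auto

lemma quad_A_lower: "u \<in> {0..1} \<Longrightarrow> lam0 * sqn p v \<le> quad p (A u) v"
  unfolding quad_Acov using ell[of u v] by (simp add: add_increasing2)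

lemma quad_A_upper: "u \<in> {0..1} \<Longrightarrow> quad p (A u) v \<le> (lam1 + M^2 / 4) * sqn p v"
proof -
  assume u: "u \<in> {0..1}"
  have "(\<Sum>j<p. v j * (mu1 u j - mu2 u j))^2 \<le> (vnorm p v * vnorm p (\<lambda>j. mu1 u j - mu2 u j))^2"
    using vnorm_cauchy_schwarz[of v "\<lambda>j. mu1 u j - mu2 u j" p] by (simp add: abs_le_square_iff[symmetric])
  also have "... \<le> (vnorm p v * M)^2"
    using dM[OF u] by (intro power_mono mult_left_mono) auto
  also have "... = M^2 * sqn p v" by (simp add: power_mult_distrib vnorm_sq)
  finally show ?thesis unfolding quad_Acov using ell'[OF u, of v] by (simp add: algebra_simps)
qed

lemma D_pos:
  assumes w: "\<exists>i<p * L. w i \<noteq> 0"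
  shows "0 < quad (p * L) DD w"
proof (rule ccontr)
  assume neg: "\<not> 0 < quad (p * L) DD w"
  define F where "F u = h u * quad p (A u) (spl w u)" for u
  have "quad (p * L) DD w = (\<Sum>i<p * L. w i * (\<integral>u. h u * (Bk (i mod L) u * (\<Sum>j<p. A u (i div L) j * spl w u j)) \<partial>unitM))"
    unfolding quad_eq_sum using Dmat_apply by (intro sum.cong) auto
  also have "... = (\<integral>u. h u * bil u (spl w u) (spl w u) \<partial>unitM)"
    by (rule test_integral) (intro nice_A_apply nice_spl)
  also have "... = integral\<^sup>L unitM F" unfolding F_def quad_eq_sum[of p] ..
  finally have q: "quad (p * L) DD w = integral\<^sup>L unitM F" .
  have F0: "D1 * (lam0 * sqn p (spl w u)) \<le> F u" if u: "u \<in> {0..1}" for u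
    unfolding F_def using h_bd[OF u] quad_A_lower[OF u, of "spl w u"] D1 lam
    by (intro mult_mono) (auto intro!: mult_nonneg_nonneg sum_nonneg)
  have Fn: "0 \<le> F u" if u: "u \<in> {0..1}" for u
    by (rule order_trans[OF _ F0[OF u]]) (use D1 lam in \<open>auto intro!: mult_nonneg_nonneg sum_nonneg\<close>)
  have Fi: "integrable unitM F" unfolding F_def by (intro nice_integrable nice_quad nice_spl)
  have AE0: "AE u in unitM. 0 \<le> F u" using Fn by (intro AE_I2) simp
  have "integral\<^sup>L unitM F = 0" using neg q integral_nonneg_AE[OF AE0] by simp
  hence "AE u in unitM. F u = 0" using integral_nonneg_eq_0_iff_AE[OF Fi AE0] by simp
  hence AE: "AE u in unitM. \<forall>j<p. spl w u j = 0"
  proof (rule AE_mp, intro AE_I2 impI)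
    fix u assume "u \<in> space unitM" and F: "F u = 0"
    hence u: "u \<in> {0..1}" by simp
    have "sqn p (spl w u) = 0"
      using F0[OF u] F D1 lam by (intro antisym sum_nonneg) (auto simp: mult_le_0_iff)
    thus "\<forall>j<p. spl w u j = 0" by (subst (asm) sum_nonneg_eq_0_iff) auto
  qed
  obtain i where i: "i < p * L" "w i \<noteq> 0" using w by blast
  have "w (i div L * L + i mod L) = 0"
  proof (rule bspl_lin_indep[of "\<lambda>k. w (i div L * L + k)"])
    fix a b :: real assume "0 \<le> a" "a < b" "b \<le> 1"
    then obtain x where x: "a < x" "x < b" "\<forall>j<p. spl w x j = 0" using AE_unitM_interval[OF AE] by blast
    have "0 = (\<Sum>k<L. w (i div L * L + k) * Bk k x)"
      using x(3) div_block_less[OF i(1)] by (simp add: spl_def)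
    also have "... = sqrt (real L) * (\<Sum>k<L. w (i div L * L + k) * Bs k x)"
      unfolding Bsc_def sum_distrib_left by (intro sum.cong refl) simp
    finally have "(\<Sum>k<L. w (i div L * L + k) * Bs k x) = 0" using L_pos by simp
    thus "\<exists>x. a < x \<and> x < b \<and> (\<Sum>k<K + m. w (i div L * L + k) * Bs k x) = 0" using x by blast
  qed (rule mod_block_less)
  thus False using i by (simp only: div_mult_mod_eq)
qed

lemma theta_til_eq_spl: "th_til u j = spl gam u j"
  by (simp add: theta_til_def spl_def)

lemma galerkin_orthogonality:
  "(\<integral>u. h u * (\<Sum>i<p. spl w u i * (\<Sum>j<p. A u i j * spl gam u j)) \<partial>unitM)
   = (\<integral>u. h u * bil u (spl w u) (th u) \<partial>unitM)"
proof -
  have eq: "(\<Sum>i'<p * L. DD i i' * gam i') = bb i" if "i < p * L" for i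
    unfolding gamma_til_def by (rule mat_inv_solve[OF posdef_inj[OF D_pos] that])
  have "(\<integral>u. h u * bil u (spl w u) (spl gam u) \<partial>unitM)
      = (\<Sum>i<p * L. w i * (\<integral>u. h u * (Bk (i mod L) u * (\<Sum>j<p. A u (i div L) j * spl gam u j)) \<partial>unitM))"
    by (rule test_integral[symmetric]) (intro nice_A_apply nice_spl)
  also have "... = (\<Sum>i<p * L. w i * bb i)"
    using eq Dmat_apply[of _ gam] by (intro sum.cong) auto
  also have "... = (\<Sum>i<p * L. w i * (\<integral>u. h u * (Bk (i mod L) u * (\<Sum>j<p. A u (i div L) j * th u j)) \<partial>unitM))"
    using bvec_eq by (intro sum.cong) auto
  also have "... = (\<integral>u. h u * bil u (spl w u) (th u) \<partial>unitM)"
    by (rule test_integral) (intro nice_A_apply th)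
  finally show ?thesis .
qed

lemma quasi_optimality:
  assumes v: "\<And>x. 0 \<le> x \<Longrightarrow> x < 1 \<Longrightarrow> vnorm p (\<lambda>j. th x j - (\<Sum>k<L. v k j * Bs k x)) \<le> eps"
    and eps: "0 \<le> eps" and lam1: "0 \<le> lam1" and D2: "0 \<le> D2"
  shows "L2dist p th_til th \<le> sqrt (D2 * (lam1 + M^2 / 4) / (D1 * lam0)) * eps"
proof -
  define w where "w i = v (i mod L) (i div L) / sqrt (real L)" for i
  have splw: "spl w u j = (\<Sum>k<L. v k j * Bs k u)" for u j
    unfolding spl_def
  proof (intro sum.cong refl)
    fix k assume "k \<in> {..<L}"
    hence *: "(j * L + k) mod L = k" "(j * L + k) div L = j" by (simp_all only: lessThan_iff block_div block_mod)
    have "a / s * (s * b) = a * b" if "s \<noteq> 0" for a b s :: real using that by simp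
    moreover have "sqrt (real L) \<noteq> 0" using L_pos by (simp only: real_sqrt_eq_zero_cancel_iff of_nat_eq_0_iff)
    ultimately show "w (j * L + k) * Bk k u = v k j * Bs k u" unfolding w_def Bsc_def * by blast
  qed
  define e where "e u j = spl gam u j - th u j" for u j
  define z where "z i = w i - gam i" for i
  have splz: "spl z u j = spl w u j - spl gam u j" for u j
    by (simp add: spl_def z_def left_diff_distrib sum_subtractf)
  have nice_e: "j < p \<Longrightarrow> nice (\<lambda>u. e u j)" for j unfolding e_def by (intro nice_diff nice_spl th)
  have nice_ze: "nice (\<lambda>u. h u * bil u (spl z u) (f u))"
    if "\<And>j. j < p \<Longrightarrow> nice (\<lambda>u. f u j)" for f
    using that by (intro nice_mult nice_h nice_sum nice_spl nice_A_apply) auto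
  have orth: "(\<integral>u. h u * bil u (spl z u) (e u) \<partial>unitM) = 0"
  proof -
    have "h u * bil u (spl z u) (e u)
        = h u * bil u (spl z u) (spl gam u) - h u * bil u (spl z u) (th u)" for u
      unfolding e_def by (simp add: right_diff_distrib sum_subtractf)
    thus ?thesis
      using galerkin_orthogonality[of z] nice_integrable[OF nice_ze[of "spl gam"]] nice_integrable[OF nice_ze[of th]]
      by (simp add: nice_spl th)
  qed
  define F where "F u = h u * quad p (A u) (e u)" for u
  define G where "G u = h u * quad p (A u) (\<lambda>j. spl w u j - th u j)" for u
  have iF: "integrable unitM F" unfolding F_def by (intro nice_integrable nice_quad nice_e)
  have iG: "integrable unitM G" unfolding G_def by (intro nice_integrable nice_quad nice_diff nice_spl th)
  have FG: "F u + 2 * (h u * bil u (spl z u) (e u)) \<le> G u" if u: "u \<in> {0..1}" for u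
  proof -
    have symA: "\<forall>i<p. \<forall>j<p. A u i j = A u j i" using sym[OF u] by (simp add: Acov_def)
    have "quad p (A u) (\<lambda>j. spl w u j - th u j) = quad p (A u) (\<lambda>j. e u j + 1 * spl z u j)"
      by (simp add: e_def splz)
    also have "... = quad p (A u) (e u) + 2 * bil u (spl z u) (e u) + quad p (A u) (spl z u)"
      unfolding quad_add[OF symA] by simp
    finally have "quad p (A u) (e u) + 2 * bil u (spl z u) (e u)
        \<le> quad p (A u) (\<lambda>j. spl w u j - th u j)"
      using order_trans[OF _ quad_A_lower[OF u, of "spl z u"], of 0] lam by (simp add: sum_nonneg)
    hence "h u * (quad p (A u) (e u) + 2 * bil u (spl z u) (e u))
        \<le> h u * quad p (A u) (\<lambda>j. spl w u j - th u j)"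
      using h_bd[OF u] D1 by (intro mult_left_mono) auto
    thus ?thesis by (simp add: F_def G_def algebra_simps)
  qed
  have iZ: "integrable unitM (\<lambda>u. h u * bil u (spl z u) (e u))"
    by (intro nice_integrable nice_ze nice_e)
  have "integral\<^sup>L unitM F = (\<integral>u. F u + 2 * (h u * bil u (spl z u) (e u)) \<partial>unitM)"
    using iF iZ orth by simp
  also have "... \<le> integral\<^sup>L unitM G"
    using iF iZ iG FG by (intro integral_mono) auto
  finally have 1: "integral\<^sup>L unitM F \<le> integral\<^sup>L unitM G" .
  define E where "E u = sqn p (e u)" for u
  have iE: "integrable unitM E" unfolding E_def by (intro nice_integrable nice_sum nice_power2 nice_e) auto
  have "D1 * lam0 * integral\<^sup>L unitM E = (\<integral>u. D1 * lam0 * E u \<partial>unitM)" by simp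
  also have "... \<le> integral\<^sup>L unitM F"
  proof (rule integral_mono)
    fix u assume "u \<in> space unitM"
    hence u: "u \<in> {0..1}" by simp
    have "D1 * (lam0 * E u) \<le> F u" unfolding F_def E_def
      using h_bd[OF u] quad_A_lower[OF u, of "e u"] D1 lam
      by (intro mult_mono) (auto intro!: mult_nonneg_nonneg sum_nonneg)
    thus "D1 * lam0 * E u \<le> F u" by (simp add: mult.assoc)
  qed (use iE iF in auto)
  finally have 2: "D1 * lam0 * integral\<^sup>L unitM E \<le> integral\<^sup>L unitM F" .
  define Lam where "Lam = lam1 + M^2 / 4"
  have Lam: "0 \<le> Lam" using lam1 by (simp add: Lam_def)
  have "integral\<^sup>L unitM G \<le> (\<integral>u. D2 * (Lam * eps^2) \<partial>unitM)"
  proof (rule integral_mono_AE[OF iG])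
    show "integrable unitM (\<lambda>u. D2 * (Lam * eps^2))" by (intro nice_integrable nice_const)
    have "AE u in lborel. u \<noteq> (1::real)" by (rule AE_lborel_singleton)
    hence "AE u in unitM. u \<noteq> 1" unfolding unitM_def by (subst AE_restrict_space_iff) auto
    thus "AE u in unitM. G u \<le> D2 * (Lam * eps^2)"
    proof (rule AE_mp, intro AE_I2 impI)
      fix u :: real assume "u \<in> space unitM" and u1: "u \<noteq> 1"
      hence u: "u \<in> {0..1}" and u': "0 \<le> u" "u < 1" by auto
      have "(\<Sum>j<p. (spl w u j - th u j)^2) = (vnorm p (\<lambda>j. th u j - spl w u j))^2"
        unfolding vnorm_sq by (simp add: power2_commute)
      also have "... \<le> eps^2" using v[OF u'] unfolding splw by (intro power_mono) auto
      finally have s: "(\<Sum>j<p. (spl w u j - th u j)^2) \<le> eps^2" .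
      have "quad p (A u) (\<lambda>j. spl w u j - th u j) \<le> Lam * (\<Sum>j<p. (spl w u j - th u j)^2)"
        unfolding Lam_def by (rule quad_A_upper[OF u])
      also have "... \<le> Lam * eps^2" using s Lam by (intro mult_left_mono)
      finally have q: "quad p (A u) (\<lambda>j. spl w u j - th u j) \<le> Lam * eps^2" .
      have q0: "0 \<le> quad p (A u) (\<lambda>j. spl w u j - th u j)"
        using order_trans[OF _ quad_A_lower[OF u, of "\<lambda>j. spl w u j - th u j"], of 0] lam by (simp add: sum_nonneg)
      show "G u \<le> D2 * (Lam * eps^2)" unfolding G_def
        using h_bd[OF u] q q0 D2 by (intro mult_mono) auto
    qed
  qed
  also have "... = D2 * (Lam * eps^2)"
    by (simp add: unitM_def measure_restrict_space space_restrict_space)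
  finally have 3: "integral\<^sup>L unitM G \<le> D2 * (Lam * eps^2)" .
  have DL: "0 < D1 * lam0" using D1 lam by simp
  have "D1 * lam0 * integral\<^sup>L unitM E \<le> D2 * (Lam * eps^2)" using 1 2 3 by linarith
  hence E: "integral\<^sup>L unitM E \<le> D2 * Lam / (D1 * lam0) * eps^2" using DL by (simp add: field_simps)
  have "L2dist p th_til th = sqrt (integral\<^sup>L unitM E)"
    unfolding L2dist_def set_integral_unitM theta_til_eq_spl E_def e_def ..
  also have "... \<le> sqrt (D2 * Lam / (D1 * lam0) * eps^2)" using E by simp
  also have "... = sqrt (D2 * Lam / (D1 * lam0)) * eps"
    unfolding real_sqrt_mult[of _ "eps^2"] using eps by simp
  finally show ?thesis unfolding Lam_def .
qed

end

section \<open>The rate\<close>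

lemma holder_class_diff:
  assumes "holder_class t r Dc Lc f" "holder_class t r Dc Lc g"
  shows "holder_class t r (2 * Dc) (2 * Lc) (\<lambda>u. f u - g u)"
proof -
  obtain F where F: "\<forall>x\<in>{0..1}. F 0 x = f x"
      "\<forall>l<t. \<forall>x\<in>{0..1}. (F l has_real_derivative F (Suc l) x) (at x within {0..1})"
      "\<forall>l\<le>t. \<forall>x\<in>{0..1}. abs (F l x) \<le> Dc"
      "\<forall>x\<in>{0..1}. \<forall>x'\<in>{0..1}. abs (F t x - F t x') \<le> Lc * abs (x - x') powr r"
    using assms(1) unfolding holder_class_def by blast
  obtain G where G: "\<forall>x\<in>{0..1}. G 0 x = g x"
      "\<forall>l<t. \<forall>x\<in>{0..1}. (G l has_real_derivative G (Suc l) x) (at x within {0..1})"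
      "\<forall>l\<le>t. \<forall>x\<in>{0..1}. abs (G l x) \<le> Dc"
      "\<forall>x\<in>{0..1}. \<forall>x'\<in>{0..1}. abs (G t x - G t x') \<le> Lc * abs (x - x') powr r"
    using assms(2) unfolding holder_class_def by blast
  show ?thesis unfolding holder_class_def
  proof (intro exI[of _ "\<lambda>l x. F l x - G l x"] conjI allI impI ballI)
    fix x :: real assume "x \<in> {0..1}" thus "F 0 x - G 0 x = f x - g x" using F(1) G(1) by simp
  next
    fix l and x :: real assume "l < t" "x \<in> {0..1}"
    thus "((\<lambda>x. F l x - G l x) has_real_derivative F (Suc l) x - G (Suc l) x) (at x within {0..1})"
      using F(2) G(2) by (intro DERIV_diff) blast+
  next
    fix l and x :: real assume l: "l \<le> t" and x: "x \<in> {0..1}"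
    have "abs (F l x) \<le> Dc" "abs (G l x) \<le> Dc" using F(3) G(3) l x by blast+
    thus "abs (F l x - G l x) \<le> 2 * Dc" by linarith
  next
    fix x x' :: real assume x: "x \<in> {0..1}" "x' \<in> {0..1}"
    have "abs (F t x - F t x') \<le> Lc * abs (x - x') powr r" "abs (G t x - G t x') \<le> Lc * abs (x - x') powr r"
      using F(4) G(4) x by blast+
    thus "\<bar>F t x - G t x - (F t x' - G t x')\<bar> \<le> 2 * Lc * abs (x - x') powr r" by linarith
  qed
qed

lemma (in spline_knots) knot_gap_bound:
  assumes qu: "\<And>i j. i \<le> K \<Longrightarrow> j \<le> K \<Longrightarrow> ext_knot K xi (Suc i) - ext_knot K xi i
      \<le> cq * (ext_knot K xi (Suc j) - ext_knot K xi j)"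
    and cq: "cq \<le> c" "0 \<le> c"
  shows "tk (k + m) - tk k \<le> (real m)^2 * c / real (K + m)"
proof -
  let ?e = "ext_knot K xi"
  have gap: "?e (Suc i) - ?e i \<le> c / real (K + 1)" for i
  proof (cases "i \<le> K")
    case True
    have "(\<Sum>j<Suc K. ?e (Suc i) - ?e i) \<le> (\<Sum>j<Suc K. c * (?e (Suc j) - ?e j))"
    proof (rule sum_mono)
      fix j assume j: "j \<in> {..<Suc K}"
      have "cq * (?e (Suc j) - ?e j) \<le> c * (?e (Suc j) - ?e j)"
        using cq knots_incr[of j] j by (intro mult_right_mono) auto
      thus "?e (Suc i) - ?e i \<le> c * (?e (Suc j) - ?e j)" using qu[OF True, of j] j by simp
    qed
    also have "... = c * (?e (Suc K) - ?e 0)"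
      unfolding sum_distrib_left[symmetric] sum_lessThan_telescope ..
    also have "... = c" by (simp add: ext_knot_def)
    finally have "real (K + 1) * (?e (Suc i) - ?e i) \<le> c" by simp
    thus ?thesis by (simp add: field_simps)
  next
    case False
    thus ?thesis using cq by (simp add: ext_knot_def)
  qed
  have tgap: "tk (Suc i) - tk i \<le> c / real (K + 1)" for i
    unfolding knotvec_eq_ext_knot using gap[of "i + 1 - m"] cq
    by (cases "m \<le> i + 1") (auto simp: Suc_diff_le)
  have "tk (k + n) - tk k \<le> real n * (c / real (K + 1))" for n
  proof (induction n)
    case (Suc n)
    thus ?case using tgap[of "k + n"] by (simp add: algebra_simps add_divide_distrib)
  qed simp
  hence "tk (k + m) - tk k \<le> real m * (c / real (K + 1))" .
  also have "... \<le> real m * (c * real m / real (K + m))"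
  proof (intro mult_left_mono)
    have "K * 1 \<le> K * m" using m_pos by (intro mult_left_mono) auto
    hence "real (K + m) \<le> real (m * (K + 1))" unfolding of_nat_le_iff by (simp add: algebra_simps)
    hence "c * real (K + m) \<le> c * real (m * (K + 1))" using cq by (intro mult_left_mono) auto
    thus "c / real (K + 1) \<le> c * real m / real (K + m)"
      using m_pos by (subst frac_le_eq) (auto simp: divide_le_0_iff algebra_simps)
  qed auto
  finally show ?thesis by (simp add: power2_eq_square mult_ac)
qed

lemma uniform_bound:
  fixes m t :: nat and r lam0 lam1 D1 D2 Dc Lc M cq :: real
  assumes r: "0 < r" "r \<le> 1" and d1: "real t + r \<ge> 1" and dm: "real t + r \<le> real m"
    and lam01: "0 < lam0" "lam0 \<le> lam1" and D: "0 < D1" "D1 \<le> D2"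
  obtains C where "\<And>p K xi h mu1 mu2 Sig th.
    \<lbrakk>\<forall>i\<le>K. ext_knot K xi i < ext_knot K xi (Suc i);
     \<forall>i\<le>K. \<forall>j\<le>K. ext_knot K xi (Suc i) - ext_knot K xi i \<le> cq * (ext_knot K xi (Suc j) - ext_knot K xi j);
     1 \<le> p;
     \<forall>u\<in>{0..1}. \<forall>i<p. \<forall>j<p. Sig u i j = Sig u j i;
     \<forall>i j. (\<lambda>u. Sig u i j) \<in> borel_measurable borel;
     \<forall>u\<in>{0..1}. lam0 \<le> lam_min p (Sig u) \<and> lam_max p (Sig u) \<le> lam1;
     h \<in> borel_measurable borel;
     \<forall>u\<in>{0..1}. D1 \<le> h u \<and> h u \<le> D2;
     \<forall>j<p. holder_class t r Dc Lc (\<lambda>u. mu1 u j) \<and> holder_class t r Dc Lc (\<lambda>u. mu2 u j)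
          \<and> holder_class t r Dc Lc (\<lambda>u. beta_star p mu1 mu2 Sig u j);
     \<forall>u\<in>{0..1}. \<forall>\<theta>. lsq_risk p mu1 mu2 Sig u (th u) \<le> lsq_risk p mu1 mu2 Sig u \<theta>;
     \<forall>u\<in>{0..1}. vnorm p (\<lambda>j. mu1 u j - mu2 u j) \<le> M \<and> vnorm p (th u) \<le> M\<rbrakk> \<Longrightarrow>
     L2dist p (theta_til p m K xi h mu1 mu2 Sig) th \<le> C * sqrt (real p) * real (K + m) powr (- (real t + r))"
proof -
  define d where "d = real t + r"
  have d: "d = real t + r" "1 \<le> d" "0 < d" using d1 r by (auto simp: d_def)
  have tm: "t < m" and m1: "1 \<le> m" using dm r d1 by linarith+
  show thesis
  proof (rule ratio_local_taylor[OF r d(1,2), where Dc = Dc and Lc = Lc and Dc' = "2 * Dc" and Lc' = "2 * Lc"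
        and M = "M / lam0" and M' = M], rule spline_quasi_interpolation[OF d(3), where t = t], goal_cases)
    case cs: (1 Ct Cq)
    note Ct = cs(1,2) and Cq = cs(3,4)
    define c1 where "c1 = (real m)^2 * max cq 1"
    have c1: "0 < c1" using m1 by (simp add: c1_def)
    define C2 where "C2 = Cq * Ct * c1 powr d + abs M * (2 * c1) powr d"
    define kap where "kap = sqrt (D2 * (lam1 + M^2 / 4) / (D1 * lam0))"
    show thesis
    proof (rule that[of "kap * C2"], goal_cases)
      case prems: (1 p K xi h mu1 mu2 Sig th)
      note incr = prems(1) and qu = prems(2) and p = prems(3) and sym = prems(4) and Sm = prems(5) and ev = prems(6)
        and hm = prems(7) and hb = prems(8) and hol = prems(9) and min = prems(10) and bM = prems(11)
      let ?be = "beta_star p mu1 mu2 Sig" and ?de = "\<lambda>u j. mu1 u j - mu2 u j"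
      let ?s = "\<lambda>u. \<Sum>k<p. ?be u k * ?de u k"
      have M0: "0 \<le> M"
      proof -
        have "vnorm p (th 0) \<le> M" using bM by simp
        thus ?thesis using vnorm_nonneg[of p "th 0"] by linarith
      qed
      have kn: "spline_knots m K xi" using m1 incr by unfold_locales auto
      have ell: "lam0 * sqn p v \<le> quad p (Sig u) v" "quad p (Sig u) v \<le> lam1 * sqn p v"
        if u: "u \<in> {0..1}" for u v
      proof -
        have s0: "0 \<le> sqn p v" by (intro sum_nonneg) auto
        have sy: "\<forall>i<p. \<forall>j<p. Sig u i j = Sig u j i" using sym u by blast
        have "lam0 * sqn p v \<le> lam_min p (Sig u) * sqn p v"
          using ev u s0 by (intro mult_right_mono) auto
        thus "lam0 * sqn p v \<le> quad p (Sig u) v" using lam_min_le_quad[OF p sy, of v] by linarith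
        have "lam_max p (Sig u) * sqn p v \<le> lam1 * sqn p v"
          using ev u s0 by (intro mult_right_mono) auto
        thus "quad p (Sig u) v \<le> lam1 * sqn p v" using quad_le_lam_max[OF p sy, of v] by linarith
      qed
      have pos: "0 < quad p (Sig u) v" if u: "u \<in> {0..1}" and v: "\<exists>i<p. v i \<noteq> 0" for u v
        by (rule quad_pos_if_elliptic[OF lam01(1) ell(1)[OF u] v])
      have beta: "(\<Sum>j<p. Sig u i j * ?be u j) = ?de u i" if u: "u \<in> {0..1}" and i: "i < p" for u i
        unfolding beta_star_def
        by (rule mat_inv_solve[OF posdef_inj i], erule pos[OF u], assumption+)
      have me: "0 \<le> ?s u" "\<And>i. i < p \<Longrightarrow> th u i = 1 / (4 + ?s u) * ?be u i"
        "\<And>i. i < p \<Longrightarrow> (\<Sum>j<p. Acov mu1 mu2 Sig u i j * th u j) = ?de u i / 4" if u: "u \<in> {0..1}" for u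
      proof -
        have sy: "\<forall>i<p. \<forall>j<p. Sig u i j = Sig u j i" using sym u by blast
        have mn: "\<And>\<theta>. lsq_risk p mu1 mu2 Sig u (th u) \<le> lsq_risk p mu1 mu2 Sig u \<theta>" using min u by blast
        note R = minimiser_eq[where p = p and Sig = Sig and u = u and ?mu1.0 = mu1 and ?mu2.0 = mu2 and b = "?be u" and th = "th u"]
        show "0 \<le> ?s u" by (rule R(1)[OF sy pos[OF u] beta[OF u] mn])
        show "\<And>i. i < p \<Longrightarrow> th u i = 1 / (4 + ?s u) * ?be u i" by (rule R(2)[OF sy pos[OF u] beta[OF u] mn])
        show "\<And>i. i < p \<Longrightarrow> (\<Sum>j<p. Acov mu1 mu2 Sig u i j * th u j) = ?de u i / 4"
          by (rule R(3)[OF sy pos[OF u] beta[OF u] mn])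
      qed
      have contb: "continuous_on {0..1} (\<lambda>u. ?be u j)" and contd: "continuous_on {0..1} (\<lambda>u. ?de u j)"
        if j: "j < p" for j
      proof -
        have hc: "holder_class t r Dc Lc (\<lambda>u. mu1 u j)" "holder_class t r Dc Lc (\<lambda>u. mu2 u j)"
            "holder_class t r Dc Lc (\<lambda>u. ?be u j)" using hol j by blast+
        show "continuous_on {0..1} (\<lambda>u. ?be u j)" by (rule holder_class_continuous[OF hc(3) r(1)])
        show "continuous_on {0..1} (\<lambda>u. ?de u j)"
          by (intro continuous_on_diff holder_class_continuous[OF hc(1) r(1)] holder_class_continuous[OF hc(2) r(1)])
      qed
      have nice_th: "nice (\<lambda>u. th u j)" if j: "j < p" for j
      proof -
        have "4 + ?s u \<noteq> 0" if "u \<in> {0..1}" for u using me(1)[OF that] by linarith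
        hence "continuous_on {0..1} (\<lambda>u. 1 / (4 + ?s u) * ?be u j)"
          using j by (intro continuous_intros contb contd) auto
        hence "nice (\<lambda>u. 1 / (4 + ?s u) * ?be u j)" by (rule nice_continuous)
        thus ?thesis using me(2) j by (subst nice_cong[where g = "\<lambda>u. 1 / (4 + ?s u) * ?be u j"]) auto
      qed
      interpret spline_knots m K xi by (rule kn)
      interpret galerkin m K xi p h mu1 mu2 Sig th lam0 lam1 D1 D2 M
      proof
        show "nice (\<lambda>u. mu1 u j)" "nice (\<lambda>u. mu2 u j)" if "j < p" for j
          using hol that by (auto intro!: nice_continuous holder_class_continuous[OF _ r(1)])
      qed (use lam01 D sym Sm ell hm hb nice_th me bM in auto)
      have vb: "vnorm p (?be u) \<le> M / lam0" if u: "u \<in> {0..1}" for u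
      proof (cases "vnorm p (?be u) = 0")
        case False
        have "lam0 * (vnorm p (?be u))^2 \<le> quad p (Sig u) (?be u)" unfolding vnorm_sq by (rule ell(1)[OF u])
        also have "... = ?s u" unfolding quad_eq_sum using beta[OF u] by simp
        also have "... \<le> vnorm p (?be u) * vnorm p (?de u)"
          using vnorm_cauchy_schwarz[of "?be u" "?de u" p] by linarith
        also have "... \<le> vnorm p (?be u) * M" using bM u by (intro mult_left_mono) auto
        finally have "vnorm p (?be u) * (lam0 * vnorm p (?be u)) \<le> vnorm p (?be u) * M"
          by (simp add: power2_eq_square mult_ac)
        moreover have "0 < vnorm p (?be u)" using False vnorm_nonneg[of p "?be u"] by linarith
        ultimately have "lam0 * vnorm p (?be u) \<le> M" by simp
        thus ?thesis using lam01 by (simp add: field_simps)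
      qed (use M0 lam01 in auto)
      define Ln where "Ln = real (K + m)"
      have Ln: "0 < Ln" using m1 by (simp add: Ln_def)
      define eta where "eta = c1 / Ln"
      have eta: "0 < eta" using c1 Ln by (simp add: eta_def)
      have gap: "\<forall>k. tk (k + m) - tk k \<le> eta"
        using knot_gap_bound[of cq "max cq 1"] qu by (simp add: eta_def c1_def Ln_def)
      define H where "H = real p powr (- 1 / (2 * d))"
      have H: "0 < H" "H \<le> 1"
        using p d powr_mono[of "- 1 / (2 * d)" 0 "real p"] by (auto simp: H_def)
      have pH: "sqrt (real p) * H powr d = 1"
      proof -
        have e: "- 1 / (2 * d) * d = - (1/2)" using d(3) by simp
        have "H powr d = real p powr (- (1/2))" unfolding H_def powr_powr e ..
        thus ?thesis using p by (simp add: powr_minus powr_half_sqrt)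
      qed
      define eps where "eps = C2 * (sqrt (real p) * Ln powr (- d))"
      have eta_d: "(a * eta) powr d = (a * c1) powr d * Ln powr (- d)" if "0 \<le> a" for a
        using that c1 Ln by (simp add: eta_def powr_divide powr_minus powr_mult divide_simps)
      have nn: "0 \<le> Cq * Ct * c1 powr d" "0 \<le> abs M * (2 * c1) powr d" using Cq(1) Ct(1) by auto
      have eps0: "0 \<le> eps" using nn by (simp add: eps_def C2_def)
      have "\<exists>v. \<forall>x. 0 \<le> x \<longrightarrow> x < 1 \<longrightarrow> vnorm p (\<lambda>j. th x j - (\<Sum>k<K + m. v k j * Bs k x)) \<le> eps"
      proof (cases "2 * eta \<le> H")
        case True
        have "\<exists>a. \<forall>x\<in>{0..1}. abs (x - x0) \<le> 2 * eta \<longrightarrow>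
          vnorm p (\<lambda>j. th x j - vpoly t a (x - x0) j) \<le> (Ct * sqrt (real p)) * abs (x - x0) powr d"
          if x0: "x0 \<in> {0..1}" for x0
        proof -
          have "\<exists>a. \<forall>x\<in>{0..1}. abs (x - x0) \<le> H \<longrightarrow>
            vnorm p (\<lambda>j. 1 / (4 + ?s x) * ?be x j - vpoly t a (x - x0) j)
              \<le> Ct * sqrt (real p) * abs (x - x0) powr d"
            by (rule Ct(2)) (use hol holder_class_diff vb bM me(1) x0 H pH in auto)
          then obtain a where a: "\<And>x. x \<in> {0..1} \<Longrightarrow> abs (x - x0) \<le> H \<Longrightarrow>
            vnorm p (\<lambda>j. 1 / (4 + ?s x) * ?be x j - vpoly t a (x - x0) j)
              \<le> Ct * sqrt (real p) * abs (x - x0) powr d" by blast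
          show ?thesis
          proof (intro exI[of _ a] ballI impI)
            fix x :: real assume x: "x \<in> {0..1}" "abs (x - x0) \<le> 2 * eta"
            have "vnorm p (\<lambda>j. th x j - vpoly t a (x - x0) j)
                = vnorm p (\<lambda>j. 1 / (4 + ?s x) * ?be x j - vpoly t a (x - x0) j)"
              using me(2)[OF x(1)] by (intro vnorm_cong) simp
            thus "vnorm p (\<lambda>j. th x j - vpoly t a (x - x0) j) \<le> (Ct * sqrt (real p)) * abs (x - x0) powr d"
              using a[OF x(1)] x(2) True by simp
          qed
        qed
        hence loc: "\<forall>x0\<in>{0..1}. \<exists>a. \<forall>x\<in>{0..1}. abs (x - x0) \<le> 2 * eta \<longrightarrow>
          vnorm p (\<lambda>j. th x j - vpoly t a (x - x0) j) \<le> (Ct * sqrt (real p)) * abs (x - x0) powr d"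
          by blast
        have e2: "eta \<le> 1/2" using True H by simp
        have A0: "0 \<le> Ct * sqrt (real p)" using Ct(1) by simp
        from Cq(2)[OF kn tm gap eta e2 A0 loc] obtain v where v: "\<forall>x. 0 \<le> x \<longrightarrow> x < 1 \<longrightarrow>
            vnorm p (\<lambda>j. th x j - (\<Sum>k<K + m. v k j * Bs k x)) \<le> Cq * (Ct * sqrt (real p)) * eta powr d" ..
        have "Cq * (Ct * sqrt (real p)) * eta powr d = (Cq * Ct * c1 powr d) * (sqrt (real p) * Ln powr (- d))"
          using eta_d[of 1] by simp
        also have "... \<le> eps" unfolding eps_def C2_def using nn by (intro mult_right_mono) auto
        finally show ?thesis using v by (meson order_trans)
      next
        case False
        have "vnorm p (\<lambda>j. th x j - (\<Sum>k<K + m. 0 * Bs k x)) \<le> eps" if x: "0 \<le> x" "x < 1" for x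
        proof -
          have "vnorm p (th x) \<le> M * 1" using bM x by simp
          also have "... = M * (sqrt (real p) * H powr d)" using pH by simp
          also have "... \<le> M * (sqrt (real p) * (2 * eta) powr d)"
            using M0 False H d by (intro mult_left_mono powr_mono2) auto
          also have "... = (abs M * (2 * c1) powr d) * (sqrt (real p) * Ln powr (- d))"
            using eta_d[of 2] M0 by simp
          also have "... \<le> eps" unfolding eps_def C2_def using nn by (intro mult_right_mono) auto
          finally show ?thesis by simp
        qed
        thus ?thesis by (intro exI[of _ "\<lambda>k j. 0"]) auto
      qed
      then obtain v where v: "\<And>x. 0 \<le> x \<Longrightarrow> x < 1 \<Longrightarrow> vnorm p (\<lambda>j. th x j - (\<Sum>k<K + m. v k j * Bs k x)) \<le> eps"
        by blast
      have "L2dist p (theta_til p m K xi h mu1 mu2 Sig) th \<le> kap * eps"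
        unfolding kap_def by (rule quasi_optimality[OF v eps0]) (use lam01 D in auto)
      thus ?case
        by (simp add: eps_def Ln_def d_def mult.assoc)
    qed
  qed
qed

theorem theorem1:
  fixes m t :: nat and r lam0 lam1 D1 D2 Dc Lc M cq :: real
  assumes "0 < r" and "r \<le> 1" and "real t + r \<ge> 1"
    and "real t + r \<le> real m"
    and "0 < lam0" and "lam0 \<le> lam1" and "0 < D1" and "D1 \<le> D2"
  shows "\<exists>C. \<forall>(p :: nat \<Rightarrow> nat) (K :: nat \<Rightarrow> nat) (xi :: nat \<Rightarrow> nat \<Rightarrow> real)
      (h :: nat \<Rightarrow> real \<Rightarrow> real) (mu1 :: nat \<Rightarrow> real \<Rightarrow> nat \<Rightarrow> real) (mu2 :: nat \<Rightarrow> real \<Rightarrow> nat \<Rightarrow> real)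
      (Sig :: nat \<Rightarrow> real \<Rightarrow> nat \<Rightarrow> nat \<Rightarrow> real) (thstar :: nat \<Rightarrow> real \<Rightarrow> nat \<Rightarrow> real).
     \<comment> \<open>quasi-uniform interior knots, L_n = K n + m \<rightarrow> \<infinity>\<close>
     (\<forall>n. \<forall>i\<le>K n. ext_knot (K n) (xi n) i < ext_knot (K n) (xi n) (Suc i)) \<longrightarrow>
     (\<forall>n. \<forall>i\<le>K n. \<forall>j\<le>K n.
        ext_knot (K n) (xi n) (Suc i) - ext_knot (K n) (xi n) i
          \<le> cq * (ext_knot (K n) (xi n) (Suc j) - ext_knot (K n) (xi n) j)) \<longrightarrow>
     filterlim (\<lambda>n. K n + m) at_top sequentially \<longrightarrow>
     (\<forall>n. 1 \<le> p n) \<longrightarrow>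
     \<comment> \<open>Sig n u is a (measurable in u) covariance matrix\<close>
     (\<forall>n. \<forall>u\<in>{0..1}. \<forall>i<p n. \<forall>j<p n. Sig n u i j = Sig n u j i) \<longrightarrow>
     (\<forall>n i j. (\<lambda>u. Sig n u i j) \<in> borel_measurable borel) \<longrightarrow>
     \<comment> \<open>(C1)\<close>
     (\<forall>n. \<forall>u\<in>{0..1}. lam0 \<le> lam_min (p n) (Sig n u) \<and> lam_max (p n) (Sig n u) \<le> lam1) \<longrightarrow>
     \<comment> \<open>(C2): h n is a density of U on [0,1]\<close>
     (\<forall>n. h n \<in> borel_measurable borel) \<longrightarrow>
     (\<forall>n. \<forall>u\<in>{0..1}. D1 \<le> h n u \<and> h n u \<le> D2) \<longrightarrow>
     (\<forall>n. (LINT u:{0..1}|lborel. h n u) = 1) \<longrightarrow>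
     \<comment> \<open>(C3)\<close>
     (\<forall>n. \<forall>j<p n. holder_class t r Dc Lc (\<lambda>u. mu1 n u j)
                 \<and> holder_class t r Dc Lc (\<lambda>u. mu2 n u j)
                 \<and> holder_class t r Dc Lc (\<lambda>u. beta_star (p n) (mu1 n) (mu2 n) (Sig n) u j)) \<longrightarrow>
     \<comment> \<open>theta* n u minimises the conditional least-squares risk\<close>
     (\<forall>n. \<forall>u\<in>{0..1}. \<forall>\<theta>.
        lsq_risk (p n) (mu1 n) (mu2 n) (Sig n) u (thstar n u)
          \<le> lsq_risk (p n) (mu1 n) (mu2 n) (Sig n) u \<theta>) \<longrightarrow>
     \<comment> \<open>(C4)\<close>
     (\<forall>n. \<forall>u\<in>{0..1}. vnorm (p n) (\<lambda>j. mu1 n u j - mu2 n u j) \<le> M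
                     \<and> vnorm (p n) (thstar n u) \<le> M) \<longrightarrow>
     (\<lambda>n. real (p n)) \<in> o(\<lambda>n. real n powr ((2 * (real t + r) - 1) / (2 * (real t + r) + 1))) \<longrightarrow>
     (\<forall>\<^sub>F n in sequentially.
        L2dist (p n) (theta_til (p n) m (K n) (xi n) (h n) (mu1 n) (mu2 n) (Sig n)) (thstar n)
          \<le> C * sqrt (real (p n)) * real (K n + m) powr (- (real t + r)))"
proof (cases rule: uniform_bound[OF assms, where cq = cq and Dc = Dc and Lc = Lc and M = M])
  case C: (1 C)
  show ?thesis
    by (rule exI[of _ C], intro allI impI always_eventually, rule C; (erule spec | assumption))
qed

end
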